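(* Let $P$ be the transition kernel of a Metropolis–Hastings chain on $\Omega\subseteq\mathbf{R}^n$, reversible with respect to the probability measure $\pi$, and let $\{A_1,\dots,A_m\}$ be a partition of $\Omega$ with $\pi(A_i)>0$ for each $i$. For each $i$ let $P_{A_i}$ be the kernel on $A_i$ given by $$P_{A_i}(x,B)=P(x,B)+1_B(x)P(x,A_i^c)\qquad (x\in A_i,\ B\subset A_i \text{ measurable}),$$ and let $P_H$ be the stochastic matrix on $\{1,\dots,m\}$ given by $$P_H(i,j)=\frac{1}{2\pi(A_i)}\int_{A_i}P(x,A_j)\,\pi(dx)\quad (i\neq j),\qquad P_H(i,i)=1-\sum_{j\ne i}P_H(i,j).$$ Then $$\mathbf{Gap}(P)\ \ge\ \tfrac12\,\mathbf{Gap}(P_H)\Bigl(\min_{i=1,\dots,m}\mathbf{Gap}(P_{A_i})\Bigr).$$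
   Context: $\Omega\subseteq\mathbf{R}^n$ is convex, $\mu$ is Lebesgue measure, and $\pi$ is a Borel probability measure on $\Omega$ with density $\pi(x)$ with respect to $\mu$. The sets $A_i$ are disjoint and measurable. Metropolis–Hastings chain: a symmetric proposal density $k(x,y)=k(|x-y|)$ induces the transition kernel $P(x,dy)=a(x,y)k(x,y)\,\mu(dy)+r(x)\delta_x(dy)$ on $\Omega$, where $a(x,y)=\min(\pi(y)/\pi(x),1)$ and $r(x)=1-\int_\Omega a(x,y)k(x,y)\,\mu(dy)$ is the probability that the proposed move is rejected. Spectral gap: for a kernel $P$ reversible with respect to a probability measure $\pi$, $P$ acts as a self-adjoint contraction $Pf(x)=\int f(y)P(x,dy)$ on $L^2(\pi)$. Let $P_0$ be its restriction to $L_0^2(\pi)=\{f\in L^2(\pi):\int f\,d\pi=0\}$. Then $\mathbf{Gap}(P)=1-\|P_0\|$, with $\|P_0\|$ the operator norm. The kernel $P_{A_i}$ is reversible with respect to the (normalized) restriction of $\pi$ to $A_i$, and $P_H$ is reversible with respect to the probability vector $(\pi(A_1),\dots,\pi(A_m))$; their spectral gaps are taken with respect to these measures. *)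

theory Defs
  imports "HOL-Probability.Probability"
begin

section \<open>Spectral gap of a Markov kernel\<close>

text \<open>A kernel is a family \<open>K x\<close> of measures and \<open>N\<close> is the reference probability measure.
  There is no type of \<open>L\<^sup>2\<close> spaces in the library, so elements of \<open>L\<^sup>2(N)\<close> are represented by
  real-valued measurable functions; all quantities below are invariant under changing such a
  function on an \<open>N\<close>-null set whenever \<open>N\<close> is invariant under \<open>K\<close>.\<close>

definition L2_norm :: "'b measure \<Rightarrow> ('b \<Rightarrow> real) \<Rightarrow> real" where
  "L2_norm N f = sqrt (\<integral>x. (f x)\<^sup>2 \<partial>N)"

definition L2_zero :: "'b measure \<Rightarrow> ('b \<Rightarrow> real) set" where
  "L2_zero N = {f \<in> borel_measurable N. integrable N (\<lambda>x. (f x)\<^sup>2) \<and> (\<integral>x. f x \<partial>N) = 0}"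

definition kernel_op :: "('b \<Rightarrow> 'b measure) \<Rightarrow> ('b \<Rightarrow> real) \<Rightarrow> 'b \<Rightarrow> real" where
  "kernel_op K f x = (\<integral>y. f y \<partial>K x)"

definition op_norm_zero :: "'b measure \<Rightarrow> ('b \<Rightarrow> 'b measure) \<Rightarrow> real" where
  "op_norm_zero N K = (SUP f \<in> {f \<in> L2_zero N. L2_norm N f \<le> 1}. L2_norm N (kernel_op K f))"

definition Gap :: "'b measure \<Rightarrow> ('b \<Rightarrow> 'b measure) \<Rightarrow> real" where
  "Gap N K = 1 - op_norm_zero N K"


section \<open>The Metropolis--Hastings chain\<close>

text \<open>Lebesgue measure on the Borel sets of the subspace \<open>\<Omega>\<close>. A convex set is Lebesgue measurable
  but not necessarily Borel, hence \<open>emeasure lebesgue\<close> instead of \<open>restrict_space lborel \<Omega>\<close>.\<close>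

definition leb_on :: "(real^'n) set \<Rightarrow> (real^'n) measure" where
  "leb_on \<Omega> = measure_of \<Omega> (sets (restrict_space borel \<Omega>)) (emeasure lebesgue)"

definition target :: "(real^'n) set \<Rightarrow> (real^'n \<Rightarrow> real) \<Rightarrow> (real^'n) measure" where
  "target \<Omega> p = density (leb_on \<Omega>) (\<lambda>x. ennreal (p x))"

text \<open>The proposal density is a probability density on the whole space; proposals that fall
  outside \<open>\<Omega>\<close> are rejected.\<close>

definition proposal_density :: "'n::finite itself \<Rightarrow> (real \<Rightarrow> real) \<Rightarrow> bool" where
  "proposal_density _ k \<longleftrightarrow> k \<in> borel_measurable borel \<and> (\<forall>r\<ge>0. 0 \<le> k r) \<and>
     (\<forall>x::real^'n. (\<integral>\<^sup>+y. ennreal (k (norm (x - y))) \<partial>lborel) = 1)"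

text \<open>Where \<open>p x = 0\<close> the convention \<open>p y / 0 = 0\<close> makes the chain reject every move; these points
  form a null set of the target measure.\<close>

definition mh_accept :: "(real^'n \<Rightarrow> real) \<Rightarrow> real^'n \<Rightarrow> real^'n \<Rightarrow> real" where
  "mh_accept p x y = min (p y / p x) 1"

definition mh_reject ::
  "(real^'n) set \<Rightarrow> (real \<Rightarrow> real) \<Rightarrow> (real^'n \<Rightarrow> real) \<Rightarrow> real^'n \<Rightarrow> real" where
  "mh_reject \<Omega> k p x = 1 - (\<integral>y. mh_accept p x y * k (norm (x - y)) \<partial>leb_on \<Omega>)"

definition mh_kernel ::
  "(real^'n) set \<Rightarrow> (real \<Rightarrow> real) \<Rightarrow> (real^'n \<Rightarrow> real) \<Rightarrow> real^'n \<Rightarrow> (real^'n) measure" where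
  "mh_kernel \<Omega> k p x = measure_of \<Omega> (sets (leb_on \<Omega>))
     (\<lambda>B. (\<integral>\<^sup>+y\<in>B. ennreal (mh_accept p x y * k (norm (x - y))) \<partial>leb_on \<Omega>)
          + ennreal (mh_reject \<Omega> k p x) * indicator B x)"


section \<open>Decomposition of a chain along a partition\<close>

definition cond_measure :: "'b measure \<Rightarrow> 'b set \<Rightarrow> 'b measure" where
  "cond_measure N A = scale_measure (1 / emeasure N A) (restrict_space N A)"

definition restricted_kernel ::
  "'b measure \<Rightarrow> ('b \<Rightarrow> 'b measure) \<Rightarrow> 'b set \<Rightarrow> 'b \<Rightarrow> 'b measure" where
  "restricted_kernel N K A x = measure_of A (sets (restrict_space N A))
     (\<lambda>B. emeasure (K x) B + indicator B x * emeasure (K x) (space N - A))"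

definition flow :: "'b measure \<Rightarrow> ('b \<Rightarrow> 'b measure) \<Rightarrow> (nat \<Rightarrow> 'b set) \<Rightarrow> nat \<Rightarrow> nat \<Rightarrow> real" where
  "flow N K A i j = (1 / (2 * measure N (A i))) * (\<integral>x\<in>A i. measure (K x) (A j) \<partial>N)"

definition P_H ::
  "'b measure \<Rightarrow> ('b \<Rightarrow> 'b measure) \<Rightarrow> (nat \<Rightarrow> 'b set) \<Rightarrow> nat \<Rightarrow> nat \<Rightarrow> nat \<Rightarrow> real" where
  "P_H N K A m i j =
     (if i = j then 1 - (\<Sum>l\<in>{1..m} - {i}. flow N K A i l) else flow N K A i j)"

text \<open>A matrix (resp. vector) on \<open>{1..m}\<close> as a kernel (resp. measure), so that \<open>Gap\<close> applies.\<close>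

definition matrix_kernel :: "nat \<Rightarrow> (nat \<Rightarrow> nat \<Rightarrow> real) \<Rightarrow> nat \<Rightarrow> nat measure" where
  "matrix_kernel m Q i = point_measure {1..m} (\<lambda>j. ennreal (Q i j))"

definition vector_measure :: "nat \<Rightarrow> (nat \<Rightarrow> real) \<Rightarrow> nat measure" where
  "vector_measure m v = point_measure {1..m} (\<lambda>i. ennreal (v i))"


section \<open>The set functions above are measures\<close>

text \<open>\<open>measure_of\<close> yields the zero measure when its argument is not countably additive; the
  following facts show that this does not happen here.\<close>

lemma convex_sets_lebesgue:
  fixes S :: "(real^'n) set"
  assumes "convex S" shows "S \<in> sets lebesgue"
proof -
  have "negligible (S - interior S)"
    by (rule negligible_subset[OF negligible_convex_frontier[OF assms]])
       (use closure_subset in \<open>auto simp: frontier_def\<close>)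
  then have "S - interior S \<in> sets lebesgue"
    by (simp add: negligible_iff_null_sets null_setsD2)
  moreover have "interior S \<in> sets lebesgue"
    by (simp add: lborelD)
  moreover have "S = (S - interior S) \<union> interior S"
    using interior_subset by auto
  ultimately show ?thesis by (metis sets.Un)
qed

lemma space_leb_on [simp]: "space (leb_on \<Omega>) = \<Omega>"
  and sets_leb_on: "sets (leb_on \<Omega>) = sets (restrict_space borel \<Omega>)"
proof -
  have "sets (restrict_space borel \<Omega>) \<subseteq> Pow \<Omega>"
    using sets.space_closed[of "restrict_space borel \<Omega>"] by (simp add: space_restrict_space)
  then show "space (leb_on \<Omega>) = \<Omega>" "sets (leb_on \<Omega>) = sets (restrict_space borel \<Omega>)"
    unfolding leb_on_def
    using sets.sigma_sets_eq[of "restrict_space borel \<Omega>"]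
    by (auto simp: space_measure_of sets_measure_of space_restrict_space)
qed

lemma emeasure_leb_on:
  assumes "convex \<Omega>" "B \<in> sets (leb_on \<Omega>)"
  shows "emeasure (leb_on \<Omega>) B = emeasure lebesgue B"
proof (rule emeasure_measure_of[OF leb_on_def])
  show "sets (restrict_space borel \<Omega>) \<subseteq> Pow \<Omega>"
    using sets.space_closed[of "restrict_space borel \<Omega>"] by (simp add: space_restrict_space)
  have sub: "sets (leb_on \<Omega>) \<subseteq> sets lebesgue"
  proof
    fix X assume "X \<in> sets (leb_on \<Omega>)"
    then obtain C where "C \<in> sets borel" "X = \<Omega> \<inter> C"
      by (auto simp: sets_leb_on sets_restrict_space)
    moreover from this have "C \<in> sets lebesgue"
      by (simp add: sets_completionI_sets)
    ultimately show "X \<in> sets lebesgue"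
      using convex_sets_lebesgue[OF assms(1)] by auto
  qed
  show "countably_additive (sets (leb_on \<Omega>)) (emeasure lebesgue)"
    unfolding countably_additive_def using sub by (auto intro!: suminf_emeasure)
qed (use assms in \<open>auto simp: positive_def\<close>)

lemma emeasure_mh_kernel:
  assumes "p \<in> borel_measurable (leb_on \<Omega>)" "k \<in> borel_measurable borel"
    and "B \<in> sets (leb_on \<Omega>)"
  shows "emeasure (mh_kernel \<Omega> k p x) B =
     (\<integral>\<^sup>+y\<in>B. ennreal (mh_accept p x y * k (norm (x - y))) \<partial>leb_on \<Omega>)
          + ennreal (mh_reject \<Omega> k p x) * indicator B x"
proof (rule emeasure_measure_of[OF mh_kernel_def])
  let ?L = "leb_on \<Omega>"
  let ?g = "\<lambda>y. ennreal (mh_accept p x y * k (norm (x - y)))"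
  have id: "(\<lambda>y. y) \<in> ?L \<rightarrow>\<^sub>M borel"
    using measurable_restrict_space1[of "\<lambda>y. y" borel borel \<Omega>]
    by (simp add: measurable_cong_sets[OF sets_leb_on refl])
  have "(\<lambda>y. norm (x - y)) \<in> borel_measurable ?L"
    using id by measurable
  from measurable_compose[OF this assms(2)]
  have g: "?g \<in> borel_measurable ?L"
    unfolding mh_accept_def using assms(1) by measurable
  let ?f = "\<lambda>B. (\<integral>\<^sup>+y\<in>B. ?g y \<partial>?L) + ennreal (mh_reject \<Omega> k p x) * indicator B x"
  have S: "sets (mh_kernel \<Omega> k p x) = sets ?L"
    using sets.space_closed[of ?L] sets.sigma_sets_eq[of ?L]
    by (simp add: mh_kernel_def sets_measure_of)
  show "countably_additive (sets (mh_kernel \<Omega> k p x)) ?f"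
    unfolding countably_additive_def S
  proof (intro allI impI)
    fix F :: "nat \<Rightarrow> _"
    assume F: "range F \<subseteq> sets ?L" and d: "disjoint_family F" and "\<Union> (range F) \<in> sets ?L"
    have *: "ennreal (mh_reject \<Omega> k p x) * indicator (\<Union> (range F)) x
        = (\<Sum>i. ennreal (mh_reject \<Omega> k p x) * indicator (F i) x)"
      by (simp add: suminf_indicator[OF d])
    have **: "(\<integral>\<^sup>+y\<in>A. ?g y \<partial>?L) = emeasure (density ?L ?g) A" if "A \<in> sets ?L" for A
      using g that by (simp add: emeasure_density)
    have "(\<Sum>i. ?f (F i)) = (\<Sum>i. (\<integral>\<^sup>+y\<in>F i. ?g y \<partial>?L))
        + (\<Sum>i. ennreal (mh_reject \<Omega> k p x) * indicator (F i) x)"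
      by (rule suminf_add[symmetric]) auto
    also have "(\<Sum>i. (\<integral>\<^sup>+y\<in>F i. ?g y \<partial>?L)) = (\<Sum>i. emeasure (density ?L ?g) (F i))"
      using F by (intro suminf_cong **) auto
    also have "\<dots> = emeasure (density ?L ?g) (\<Union> (range F))"
      using F d by (intro suminf_emeasure) auto
    also have "\<dots> = (\<integral>\<^sup>+y\<in>\<Union> (range F). ?g y \<partial>?L)"
      using F by (intro **[symmetric]) auto
    finally show "(\<Sum>i. ?f (F i)) = ?f (\<Union> (range F))"
      using * by simp
  qed
  show "sets ?L \<subseteq> Pow \<Omega>" using sets.space_closed[of ?L] by simp
  show "B \<in> sets (mh_kernel \<Omega> k p x)" using assms S by simp
qed (auto simp: positive_def)

lemma emeasure_restricted_kernel:
  assumes "sets (K x) = sets N" "A \<in> sets N" "B \<in> sets N" "B \<subseteq> A"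
  shows "emeasure (restricted_kernel N K A x) B
    = emeasure (K x) B + indicator B x * emeasure (K x) (space N - A)"
proof (rule emeasure_measure_of[OF restricted_kernel_def])
  let ?R = "restrict_space N A"
  have sp: "space ?R = A" using assms(2) by (simp add: space_restrict_space2)
  have S: "sets (restricted_kernel N K A x) = sets ?R"
    using sets.space_closed[of ?R] sets.sigma_sets_eq[of ?R]
    by (simp add: restricted_kernel_def sets_measure_of sp)
  have sub: "sets ?R \<subseteq> sets (K x)"
    using assms by (auto simp: sets_restrict_space)
  let ?f = "\<lambda>B. emeasure (K x) B + indicator B x * emeasure (K x) (space N - A)"
  show "countably_additive (sets (restricted_kernel N K A x)) ?f"
    unfolding countably_additive_def S
  proof (intro allI impI)
    fix F :: "nat \<Rightarrow> _"
    assume F: "range F \<subseteq> sets ?R" and d: "disjoint_family F" and "\<Union> (range F) \<in> sets ?R"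
    have *: "indicator (\<Union> (range F)) x * emeasure (K x) (space N - A)
        = (\<Sum>i. indicator (F i) x * emeasure (K x) (space N - A))"
      by (simp add: suminf_indicator[OF d])
    have "(\<Sum>i. ?f (F i)) = (\<Sum>i. emeasure (K x) (F i))
        + (\<Sum>i. indicator (F i) x * emeasure (K x) (space N - A))"
      by (rule suminf_add[symmetric]) auto
    also have "(\<Sum>i. emeasure (K x) (F i)) = emeasure (K x) (\<Union> (range F))"
      using F d sub by (intro suminf_emeasure) auto
    finally show "(\<Sum>i. ?f (F i)) = ?f (\<Union> (range F))"
      using * by simp
  qed
  show "sets ?R \<subseteq> Pow A" using sets.space_closed[of ?R] sp by simp
  show "B \<in> sets (restricted_kernel N K A x)"
    using assms unfolding S by (auto simp: sets_restrict_space)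
qed (auto simp: positive_def)

end

theory Submission
  imports Defs
begin

text \<open>
  Write \<open>E(f) = 1/2 \<integral>\<integral> (f(x) - f(y))\<^sup>2 P(x,dy) \<pi>(dx)\<close>. As the operator norm sees both ends of the spectrum, the gap
  is at least \<open>c\<close> iff, for mean-zero \<open>f\<close>, both \<open>E(f)\<close> and \<open>1/2 \<integral>\<integral> (f(x) + f(y))\<^sup>2 P(x,dy) \<pi>(dx)\<close> are
  at least \<open>c \<integral> f\<^sup>2 d\<pi>\<close>.

  Upper end, for any reversible kernel: split \<open>f\<close> into its block averages and the deviation from them.
  The deviation is controlled by the restricted kernels and the averages by \<open>P\<^sub>H\<close>; across blocks the
  difference of averages is the difference of \<open>f\<close> minus that of the deviations, and the two are
  balanced by a weighted Cauchy--Schwarz inequality.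

  Lower end: this fails for general reversible kernels (a flip of two points) and uses the translation
  invariance of the proposal. If \<open>1/2 \<integral>\<integral> (f(x) + f(y))\<^sup>2\<close> is small, then \<open>F = \<bar>f\<bar>\<close> has small energy and is
  small where proposals are rejected, so it behaves like a Dirichlet eigenfunction. As in Filonov's proof that
  Neumann eigenvalues are below Dirichlet eigenvalues, a combination of \<open>F\<close> with a plane wave
  \<open>exp(i \<xi> x)\<close>, where \<open>1 - E cos(\<xi> v)\<close> for a proposed step \<open>v\<close> is tuned to the energy of \<open>F\<close>, is a
  mean-zero function of small energy, against the bound for the upper end.
\<close>

section \<open>Reversible kernels and their gap\<close>

text \<open>Where the factor 1/2 comes from: the flows in \<open>P_H\<close> are halved, so the
  block energy is a quarter of the integrated squared differences of averages, and the weight in the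
  Cauchy--Schwarz step is set so that the energy inside blocks and the energy across blocks are both
  charged at most twice. This closes because deviations seen by pairs within one block are not
  charged again across blocks.

  The obstacle at the lower end is that a plane wave is an eigenfunction of the free proposal walk,
  not of \<open>P\<close>. Hence the stationary step is described on pairs of current state and
  proposal, where the free density splits into an accepted and a refused part. Passing from the
  accepted to all proposals costs twice a weighted square of F on the refused part, and this is
  exactly what the form with f(x) + f(y) provides there, since (f + f)^2 / 2 = 2 f^2. The target
  constant is at most 1/2, so the frequency comes from the intermediate value theorem once E cos is
  known to fall below 1/2 somewhere.\<close>

locale reversible_kernel = prob_space N for N :: "'a measure" +
  fixes K :: "'a \<Rightarrow> 'a measure"
  assumes kernel: "K \<in> N \<rightarrow>\<^sub>M prob_algebra N"
    and reversible: "\<And>A B. A \<in> sets N \<Longrightarrow> B \<in> sets N \<Longrightarrow>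
      (\<integral>\<^sup>+x\<in>A. emeasure (K x) B \<partial>N) = (\<integral>\<^sup>+x\<in>B. emeasure (K x) A \<partial>N)"
begin

lemma kernel_subprob [measurable]: "K \<in> N \<rightarrow>\<^sub>M subprob_algebra N"
  using kernel by (rule measurable_prob_algebraD)

lemma prob_space_kernel: "x \<in> space N \<Longrightarrow> prob_space (K x)"
  using measurable_space[OF kernel] by (simp add: space_prob_algebra)

lemma sets_kernel: "x \<in> space N \<Longrightarrow> sets (K x) = sets N"
  using measurable_space[OF kernel] by (simp add: space_prob_algebra)

lemma space_kernel: "x \<in> space N \<Longrightarrow> space (K x) = space N"
  using sets_kernel sets_eq_imp_space_eq by blast

lemma measurable_kernel_iff: "x \<in> space N \<Longrightarrow> f \<in> K x \<rightarrow>\<^sub>M M \<longleftrightarrow> f \<in> N \<rightarrow>\<^sub>M M"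
  by (simp add: measurable_cong_sets[OF sets_kernel refl])

text \<open>Law of two consecutive states of the stationary chain. Reversibility becomes invariance
  under the swap of coordinates, both marginals are \<open>N\<close>, and the energies are integrals
  against this one probability measure.\<close>

definition joint :: "('a \<times> 'a) measure" where
  "joint = N \<bind> (\<lambda>x. distr (K x) (N \<Otimes>\<^sub>M N) (Pair x))"

lemma joint_kernel: "(\<lambda>x. distr (K x) (N \<Otimes>\<^sub>M N) (Pair x)) \<in> N \<rightarrow>\<^sub>M subprob_algebra (N \<Otimes>\<^sub>M N)"
  by (rule measurable_distr2[of _ N N]) (auto simp: case_prod_Pair)

lemma sets_joint [measurable_cong]: "sets joint = sets (N \<Otimes>\<^sub>M N)"
  unfolding joint_def by (rule sets_bind) (auto simp: not_empty)

lemma space_joint: "space joint = space N \<times> space N"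
  using sets_eq_imp_space_eq[OF sets_joint] by (simp add: space_pair_measure)

lemma nn_integral_joint:
  assumes [measurable]: "g \<in> borel_measurable (N \<Otimes>\<^sub>M N)"
  shows "(\<integral>\<^sup>+z. g z \<partial>joint) = (\<integral>\<^sup>+x. \<integral>\<^sup>+y. g (x, y) \<partial>K x \<partial>N)"
proof -
  have "(\<integral>\<^sup>+z. g z \<partial>joint) = (\<integral>\<^sup>+x. \<integral>\<^sup>+z. g z \<partial>distr (K x) (N \<Otimes>\<^sub>M N) (Pair x) \<partial>N)"
    unfolding joint_def by (rule nn_integral_bind[OF assms joint_kernel])
  also have "\<dots> = (\<integral>\<^sup>+x. \<integral>\<^sup>+y. g (x, y) \<partial>K x \<partial>N)"
    by (intro nn_integral_cong nn_integral_distr)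
       (auto simp: measurable_kernel_iff)
  finally show ?thesis .
qed

lemma emeasure_joint_times:
  assumes "A \<in> sets N" "B \<in> sets N"
  shows "emeasure joint (A \<times> B) = (\<integral>\<^sup>+x\<in>A. emeasure (K x) B \<partial>N)"
proof -
  have "emeasure joint (A \<times> B) = (\<integral>\<^sup>+z. indicator (A \<times> B) z \<partial>joint)"
    using assms by (simp add: sets_joint)
  also have "\<dots> = (\<integral>\<^sup>+x. \<integral>\<^sup>+y. indicator (A \<times> B) (x, y) \<partial>K x \<partial>N)"
    using assms by (intro nn_integral_joint) auto
  also have "\<dots> = (\<integral>\<^sup>+x\<in>A. emeasure (K x) B \<partial>N)"
    using assms sets_kernel
    by (intro nn_integral_cong) (simp add: indicator_times nn_integral_cmult mult.commute)
  finally show ?thesis .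
qed

lemma prob_space_joint: "prob_space joint"
proof
  have "emeasure joint (space N \<times> space N) = (\<integral>\<^sup>+x. emeasure (K x) (space N) \<partial>N)"
    by (subst emeasure_joint_times) (auto intro!: nn_integral_cong)
  also have "\<dots> = (\<integral>\<^sup>+x. 1 \<partial>N)"
    by (intro nn_integral_cong) (metis prob_space.emeasure_space_1 prob_space_kernel space_kernel)
  finally show "emeasure joint (space joint) = 1"
    by (simp add: space_joint emeasure_space_1)
qed

sublocale joint: prob_space joint
  by (rule prob_space_joint)

text \<open>Rectangles form an intersection-stable generator of the product sigma-algebra, and on
  them the claim is exactly \<open>reversible\<close>.\<close>

lemma distr_joint_swap: "distr joint joint prod.swap = joint"
proof (rule measure_eqI_generator_eq[symmetric])
  let ?E = "{A \<times> B |A B. A \<in> sets N \<and> B \<in> sets N}"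
  show "Int_stable ?E" by (rule Int_stable_pair_measure_generator)
  show "?E \<subseteq> Pow (space N \<times> space N)" by (rule pair_measure_closed)
  show *: "sets joint = sigma_sets (space N \<times> space N) ?E"
    by (simp add: sets_joint sets_pair_measure)
  then show "sets (distr joint joint prod.swap) = sigma_sets (space N \<times> space N) ?E"
    by simp
  show "range (\<lambda>_. space N \<times> space N) \<subseteq> ?E" "(\<Union>i. (\<lambda>_::nat. space N \<times> space N) i) = space N \<times> space N"
    by auto
  show "emeasure joint (space N \<times> space N) \<noteq> \<infinity>" by simp
  have swap: "prod.swap \<in> joint \<rightarrow>\<^sub>M joint"
    by (simp add: prod.swap_def[abs_def] measurable_cong_sets[OF sets_joint sets_joint])
  fix X assume "X \<in> ?E"
  then obtain A B where X: "X = A \<times> B" "A \<in> sets N" "B \<in> sets N" by auto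
  then have "A \<subseteq> space N" "B \<subseteq> space N" by (auto dest: sets.sets_into_space)
  then have "prod.swap -` X \<inter> space joint = B \<times> A"
    by (auto simp: X space_joint)
  then have "emeasure (distr joint joint prod.swap) X = emeasure joint (B \<times> A)"
    using X by (subst emeasure_distr[OF swap]) (auto simp: sets_joint)
  then show "emeasure joint X = emeasure (distr joint joint prod.swap) X"
    using X reversible by (simp add: emeasure_joint_times)
qed

lemma swap_measurable: "prod.swap \<in> joint \<rightarrow>\<^sub>M joint"
  by (simp add: prod.swap_def[abs_def] measurable_cong_sets[OF sets_joint sets_joint])

lemma integral_joint_swap:
  fixes g :: "'a \<times> 'a \<Rightarrow> real"
  assumes "g \<in> borel_measurable joint"
  shows "(\<integral>z. g (prod.swap z) \<partial>joint) = (\<integral>z. g z \<partial>joint)"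
  using integral_distr[OF swap_measurable assms] distr_joint_swap by simp

lemma integrable_joint_swap:
  fixes g :: "'a \<times> 'a \<Rightarrow> real"
  assumes "integrable joint g"
  shows "integrable joint (\<lambda>z. g (prod.swap z))"
  using integrable_distr[OF swap_measurable, of g] assms distr_joint_swap by simp

lemma distr_joint_fst: "distr joint N fst = N"
proof (rule measure_eqI)
  fix A assume "A \<in> sets (distr joint N fst)"
  then have A: "A \<in> sets N" by simp
  then have "fst -` A \<inter> space joint = A \<times> space N"
    by (auto simp: space_joint dest: sets.sets_into_space)
  then have "emeasure (distr joint N fst) A = emeasure joint (A \<times> space N)"
    using A by (subst emeasure_distr) auto
  also have "\<dots> = (\<integral>\<^sup>+x\<in>A. 1 \<partial>N)"
    using A by (subst emeasure_joint_times, simp, simp)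
      (intro nn_integral_cong, metis prob_space.emeasure_space_1 prob_space_kernel space_kernel)
  finally show "emeasure (distr joint N fst) A = emeasure N A"
    using A by simp
qed simp

lemma distr_joint_snd: "distr joint N snd = N"
proof -
  have "distr joint N snd = distr (distr joint joint prod.swap) N fst"
    by (subst distr_distr[OF _ swap_measurable]) (auto simp: comp_def)
  then show ?thesis by (simp add: distr_joint_swap distr_joint_fst)
qed

lemma integral_joint_fst:
  fixes f :: "'a \<Rightarrow> real"
  assumes "f \<in> borel_measurable N"
  shows "(\<integral>z. f (fst z) \<partial>joint) = (\<integral>x. f x \<partial>N)"
  using integral_distr[of fst joint N f] assms distr_joint_fst by simp

lemma integrable_joint_fst:
  fixes f :: "'a \<Rightarrow> real"
  assumes "integrable N f"
  shows "integrable joint (\<lambda>z. f (fst z))"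
  using integrable_distr[of fst joint N f] assms distr_joint_fst by simp

lemma integral_joint_snd:
  fixes f :: "'a \<Rightarrow> real"
  assumes [measurable]: "f \<in> borel_measurable N"
  shows "(\<integral>z. f (snd z) \<partial>joint) = (\<integral>x. f x \<partial>N)"
  using integral_joint_swap[of "\<lambda>z. f (fst z)"] integral_joint_fst[OF assms] by simp

lemma integrable_joint_snd:
  fixes f :: "'a \<Rightarrow> real"
  assumes "integrable N f"
  shows "integrable joint (\<lambda>z. f (snd z))"
  using integrable_joint_swap[OF integrable_joint_fst[OF assms]] by simp

text \<open>Fubini for real integrands, obtained from \<open>nn_integral_joint\<close> through
  positive and negative parts. Inner integrability may fail on a null set, so the inner integral is
  compared with its two parts almost everywhere only.\<close>

lemma integral_joint:
  fixes g :: "'a \<times> 'a \<Rightarrow> real"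
  assumes g: "integrable joint g"
  shows "AE x in N. integrable (K x) (\<lambda>y. g (x, y))"
    and "integrable N (\<lambda>x. \<integral>y. g (x, y) \<partial>K x)"
    and "(\<integral>z. g z \<partial>joint) = (\<integral>x. \<integral>y. g (x, y) \<partial>K x \<partial>N)"
proof -
  have [measurable]: "g \<in> borel_measurable (N \<Otimes>\<^sub>M N)"
    using borel_measurable_integrable[OF g] by (simp add: measurable_cong_sets[OF sets_joint refl])
  have m: "(\<lambda>y. g (x, y)) \<in> borel_measurable (K x)" if "x \<in> space N" for x
    using that by (simp add: measurable_kernel_iff)
  define p where "p x = (\<integral>\<^sup>+y. ennreal (g (x, y)) \<partial>K x)" for x
  define q where "q x = (\<integral>\<^sup>+y. ennreal (- g (x, y)) \<partial>K x)" for x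
  have [measurable]: "p \<in> borel_measurable N" "q \<in> borel_measurable N"
    unfolding p_def q_def by (rule nn_integral_measurable_subprob_algebra2[where N=N]; measurable)+
  have P: "(\<integral>\<^sup>+x. p x \<partial>N) = (\<integral>\<^sup>+z. ennreal (g z) \<partial>joint)"
    and Q: "(\<integral>\<^sup>+x. q x \<partial>N) = (\<integral>\<^sup>+z. ennreal (- g z) \<partial>joint)"
    unfolding p_def q_def by (subst nn_integral_joint; simp)+
  have fin: "(\<integral>\<^sup>+x. p x \<partial>N) \<noteq> \<infinity>" "(\<integral>\<^sup>+x. q x \<partial>N) \<noteq> \<infinity>"
    using g unfolding P Q real_integrable_def by auto
  then have AE: "AE x in N. p x \<noteq> \<infinity>" "AE x in N. q x \<noteq> \<infinity>"
    by (auto intro!: nn_integral_PInf_AE simp del: infinity_ennreal_def)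
  have int: "integrable (K x) (\<lambda>y. g (x, y))" "(\<integral>y. g (x, y) \<partial>K x) = enn2real (p x) - enn2real (q x)"
    if "x \<in> space N" "p x \<noteq> \<infinity>" "q x \<noteq> \<infinity>" for x
  proof -
    show 1: "integrable (K x) (\<lambda>y. g (x, y))"
      using that m unfolding real_integrable_def p_def q_def by auto
    show "(\<integral>y. g (x, y) \<partial>K x) = enn2real (p x) - enn2real (q x)"
      using real_lebesgue_integral_def[OF 1] unfolding p_def q_def .
  qed
  show "AE x in N. integrable (K x) (\<lambda>y. g (x, y))"
    using AE AE_space by eventually_elim (use int in blast)
  \<comment> \<open>Stated for an arbitrary function, here again called \<open>p\<close>, so that it
    serves both the positive and the negative part.\<close>
  have ip: "integrable N (\<lambda>x. enn2real (p x))" "(\<integral>x. enn2real (p x) \<partial>N) = enn2real (\<integral>\<^sup>+x. p x \<partial>N)"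
    if "p \<in> borel_measurable N" "(\<integral>\<^sup>+x. p x \<partial>N) \<noteq> \<infinity>" for p
  proof -
    have "AE x in N. p x \<noteq> \<infinity>" using that by (auto intro!: nn_integral_PInf_AE simp del: infinity_ennreal_def)
    then have *: "(\<integral>\<^sup>+x. ennreal (enn2real (p x)) \<partial>N) = (\<integral>\<^sup>+x. p x \<partial>N)"
      by (intro nn_integral_cong_AE, eventually_elim) (auto simp: less_top)
    show "integrable N (\<lambda>x. enn2real (p x))"
      using that * by (intro integrableI_nonneg) (auto simp: less_top)
    show "(\<integral>x. enn2real (p x) \<partial>N) = enn2real (\<integral>\<^sup>+x. p x \<partial>N)"
      using that * by (subst integral_eq_nn_integral) auto
  qed
  have eq: "AE x in N. (\<integral>y. g (x, y) \<partial>K x) = enn2real (p x) - enn2real (q x)"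
    using AE AE_space by eventually_elim (use int in blast)
  \<comment> \<open>The integrand varies with \<open>x\<close>; the image of \<open>K x\<close>
    under \<open>Pair x\<close> turns this into the integral of the fixed function \<open>g\<close>
    against a measurable family of measures.\<close>
  have mg: "(\<lambda>x. \<integral>y. g (x, y) \<partial>K x) \<in> borel_measurable N"
  proof -
    have "(\<lambda>x. \<integral>z. g z \<partial>distr (K x) (N \<Otimes>\<^sub>M N) (Pair x)) \<in> borel_measurable N"
      by (rule measurable_compose[OF joint_kernel integral_measurable_subprob_algebra]) measurable
    moreover have "(\<integral>z. g z \<partial>distr (K x) (N \<Otimes>\<^sub>M N) (Pair x)) = (\<integral>y. g (x, y) \<partial>K x)"
      if "x \<in> space N" for x
      using that by (intro integral_distr) (auto simp: measurable_kernel_iff)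
    ultimately show ?thesis by (simp cong: measurable_cong)
  qed
  have id: "integrable N (\<lambda>x. enn2real (p x) - enn2real (q x))"
    using ip fin by simp
  show "integrable N (\<lambda>x. \<integral>y. g (x, y) \<partial>K x)"
    by (rule integrable_cong_AE_imp[OF id mg]) (use eq in auto)
  have "(\<integral>x. \<integral>y. g (x, y) \<partial>K x \<partial>N) = (\<integral>x. enn2real (p x) - enn2real (q x) \<partial>N)"
    by (rule integral_cong_AE[OF mg _ eq]) auto
  also have "\<dots> = enn2real (\<integral>\<^sup>+x. p x \<partial>N) - enn2real (\<integral>\<^sup>+x. q x \<partial>N)"
    using ip fin by simp
  also have "\<dots> = (\<integral>z. g z \<partial>joint)"
    using real_lebesgue_integral_def[OF g] P Q by simp
  finally show "(\<integral>z. g z \<partial>joint) = (\<integral>x. \<integral>y. g (x, y) \<partial>K x \<partial>N)" by simp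
qed

end

section \<open>Square-integrable functions and the Cauchy--Schwarz inequality\<close>

definition L2_fun :: "'b measure \<Rightarrow> ('b \<Rightarrow> real) set" where
  "L2_fun N = {f \<in> borel_measurable N. integrable N (\<lambda>x. (f x)\<^sup>2)}"

lemma L2_funD [measurable_dest]: "f \<in> L2_fun N \<Longrightarrow> f \<in> borel_measurable N"
  and L2_fun_integrable_square: "f \<in> L2_fun N \<Longrightarrow> integrable N (\<lambda>x. (f x)\<^sup>2)"
  by (auto simp: L2_fun_def)

lemma integrable_mult_L2_fun:
  assumes "f \<in> L2_fun N" "g \<in> L2_fun N"
  shows "integrable N (\<lambda>x. f x * g x)"
proof (rule Bochner_Integration.integrable_bound)
  show "integrable N (\<lambda>x. (f x)\<^sup>2 + (g x)\<^sup>2)"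
    using assms by (auto simp: L2_fun_def)
  have "\<bar>a * b\<bar> \<le> a\<^sup>2 + b\<^sup>2" for a b :: real
    using sum_squares_bound[of "\<bar>a\<bar>" "\<bar>b\<bar>"] zero_le_power2[of a] zero_le_power2[of b]
    unfolding abs_mult power2_abs by linarith
  then show "AE x in N. norm (f x * g x) \<le> norm ((f x)\<^sup>2 + (g x)\<^sup>2)"
    by simp
qed (use assms in \<open>auto simp: L2_fun_def\<close>)

lemma L2_fun_add: "f \<in> L2_fun N \<Longrightarrow> g \<in> L2_fun N \<Longrightarrow> (\<lambda>x. f x + g x) \<in> L2_fun N"
  using integrable_mult_L2_fun[of f N g] by (auto simp: L2_fun_def power2_sum mult.assoc)

lemma L2_fun_cmult: "f \<in> L2_fun N \<Longrightarrow> (\<lambda>x. c * f x) \<in> L2_fun N"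
  by (auto simp: L2_fun_def power_mult_distrib)

lemma L2_fun_diff: "f \<in> L2_fun N \<Longrightarrow> g \<in> L2_fun N \<Longrightarrow> (\<lambda>x. f x - g x) \<in> L2_fun N"
  using L2_fun_add[of f N "\<lambda>x. (-1) * g x"] L2_fun_cmult[of g N "-1"] by simp

lemma (in finite_measure) L2_fun_const: "(\<lambda>x. c) \<in> L2_fun M"
  by (auto simp: L2_fun_def)

lemma (in finite_measure) L2_fun_integrable: "f \<in> L2_fun M \<Longrightarrow> integrable M f"
  by (auto simp: L2_fun_def intro: square_integrable_imp_integrable)

lemma L2_zero_iff: "f \<in> L2_zero N \<longleftrightarrow> f \<in> L2_fun N \<and> (\<integral>x. f x \<partial>N) = 0"
  by (auto simp: L2_zero_def L2_fun_def)

lemma L2_norm_square: "(L2_norm N f)\<^sup>2 = (\<integral>x. (f x)\<^sup>2 \<partial>N)"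
  by (simp add: L2_norm_def)

lemma L2_norm_nonneg: "0 \<le> L2_norm N f"
  by (simp add: L2_norm_def)

lemma L2_norm_cmult: "L2_norm N (\<lambda>x. c * f x) = \<bar>c\<bar> * L2_norm N f"
  by (simp add: L2_norm_def power_mult_distrib real_sqrt_mult)

text \<open>The squared norm of f - t g is a nonnegative quadratic polynomial in t; its value at the
  minimizer is the claim.\<close>

lemma inner_le_L2_norm:
  assumes f: "f \<in> L2_fun N" and g: "g \<in> L2_fun N"
  shows "(\<integral>x. f x * g x \<partial>N) \<le> L2_norm N f * L2_norm N g"
proof -
  have sq: "0 \<le> (\<integral>x. (f x)\<^sup>2 \<partial>N) - 2 * t * (\<integral>x. f x * g x \<partial>N) + t\<^sup>2 * (\<integral>x. (g x)\<^sup>2 \<partial>N)" for t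
  proof -
    have "0 \<le> (\<integral>x. (f x - t * g x)\<^sup>2 \<partial>N)" by simp
    also have "(\<lambda>x. (f x - t * g x)\<^sup>2) = (\<lambda>x. (f x)\<^sup>2 - 2 * t * (f x * g x) + t\<^sup>2 * (g x)\<^sup>2)"
      by (auto simp: fun_eq_iff power2_eq_square algebra_simps)
    also have "(\<integral>x. (f x)\<^sup>2 - 2 * t * (f x * g x) + t\<^sup>2 * (g x)\<^sup>2 \<partial>N)
        = (\<integral>x. (f x)\<^sup>2 \<partial>N) - 2 * t * (\<integral>x. f x * g x \<partial>N) + t\<^sup>2 * (\<integral>x. (g x)\<^sup>2 \<partial>N)"
      using f g integrable_mult_L2_fun[OF f g] by (simp add: L2_fun_integrable_square)
    finally show ?thesis .
  qed
  have "(\<integral>x. f x * g x \<partial>N)\<^sup>2 \<le> (\<integral>x. (f x)\<^sup>2 \<partial>N) * (\<integral>x. (g x)\<^sup>2 \<partial>N)"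
  proof (cases "(\<integral>x. (g x)\<^sup>2 \<partial>N) = 0")
    case True
    have "(\<integral>x. f x * g x \<partial>N) = 0"
    proof (rule ccontr)
      let ?i = "\<integral>x. f x * g x \<partial>N" and ?f = "\<integral>x. (f x)\<^sup>2 \<partial>N"
      assume "?i \<noteq> 0"
      \<comment> \<open>For a null \<open>g\<close> the polynomial is affine in t, and at this t it
        would take the value -1.\<close>
      then have "2 * ((?f + 1) / (2 * ?i)) * ?i = ?f + 1" by simp
      with sq[of "(?f + 1) / (2 * ?i)"] True show False by simp
    qed
    then show ?thesis using True by simp
  next
    case False
    then have "0 < (\<integral>x. (g x)\<^sup>2 \<partial>N)" by (simp add: less_le)
    with sq[of "(\<integral>x. f x * g x \<partial>N) / (\<integral>x. (g x)\<^sup>2 \<partial>N)"] show ?thesis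
      by (simp add: field_simps power2_eq_square)
  qed
  then have "\<bar>\<integral>x. f x * g x \<partial>N\<bar> \<le> sqrt ((\<integral>x. (f x)\<^sup>2 \<partial>N) * (\<integral>x. (g x)\<^sup>2 \<partial>N))"
    by (metis real_sqrt_abs real_sqrt_le_iff)
  then show ?thesis by (simp add: L2_norm_def real_sqrt_mult)
qed

context reversible_kernel
begin

section \<open>The Markov operator, its two quadratic forms and its gap\<close>

lemma kernel_op_measurable [measurable]:
  "f \<in> borel_measurable N \<Longrightarrow> kernel_op K f \<in> borel_measurable N"
  unfolding kernel_op_def[abs_def]
  by (rule measurable_compose[OF kernel_subprob integral_measurable_subprob_algebra])

lemma L2_fun_joint:
  assumes "f \<in> L2_fun N"
  shows "(\<lambda>z. f (fst z)) \<in> L2_fun joint" "(\<lambda>z. f (snd z)) \<in> L2_fun joint"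
proof -
  have [measurable]: "f \<in> borel_measurable N" using assms by (rule L2_funD)
  show "(\<lambda>z. f (fst z)) \<in> L2_fun joint" "(\<lambda>z. f (snd z)) \<in> L2_fun joint"
    using integrable_joint_fst integrable_joint_snd L2_fun_integrable_square[OF assms]
    by (auto simp: L2_fun_def)
qed

text \<open>Jensen's inequality for each \<open>K x\<close>, followed by invariance of
  \<open>N\<close>, that is, the second marginal of \<open>joint\<close>.\<close>

lemma kernel_op_L2:
  assumes f: "f \<in> L2_fun N"
  shows "kernel_op K f \<in> L2_fun N" and "(\<integral>x. (kernel_op K f x)\<^sup>2 \<partial>N) \<le> (\<integral>x. (f x)\<^sup>2 \<partial>N)"
    and "(\<integral>x. kernel_op K f x \<partial>N) = (\<integral>x. f x \<partial>N)"
proof -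
  have [measurable]: "f \<in> borel_measurable N" using f by (rule L2_funD)
  have i2: "integrable joint (\<lambda>z. (f (snd z))\<^sup>2)"
    using L2_fun_joint(2)[OF f] by (rule L2_fun_integrable_square)
  note J = integral_joint[OF i2, simplified]
  have le: "AE x in N. (kernel_op K f x)\<^sup>2 \<le> (\<integral>y. (f y)\<^sup>2 \<partial>K x)"
    using J(1) AE_space
  proof eventually_elim
    case (elim x)
    interpret Kx: prob_space "K x" using elim by (intro prob_space_kernel)
    have "f \<in> L2_fun (K x)"
      using elim by (auto simp: L2_fun_def measurable_kernel_iff)
    \<comment> \<open>Cauchy--Schwarz against the constant equal to the mean bounds the squared mean
      by the norm times the absolute mean; one factor then cancels.\<close>
    from inner_le_L2_norm[OF this Kx.L2_fun_const[of "\<integral>y. f y \<partial>K x"]]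
    have "(\<integral>y. f y \<partial>K x)\<^sup>2 \<le> L2_norm (K x) f * \<bar>\<integral>y. f y \<partial>K x\<bar>"
      by (simp add: L2_norm_def power2_eq_square Kx.prob_space)
    then have "\<bar>\<integral>y. f y \<partial>K x\<bar> * \<bar>\<integral>y. f y \<partial>K x\<bar> \<le> L2_norm (K x) f * \<bar>\<integral>y. f y \<partial>K x\<bar>"
      by (simp add: power2_eq_square flip: abs_mult)
    then have "\<bar>\<integral>y. f y \<partial>K x\<bar> \<le> L2_norm (K x) f"
      by (metis L2_norm_nonneg abs_ge_zero less_le mult_right_le_imp_le)
    then show ?case
      unfolding kernel_op_def L2_norm_square[symmetric]
      by (metis L2_norm_nonneg abs_le_square_iff abs_of_nonneg)
  qed
  show K2: "kernel_op K f \<in> L2_fun N"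
    unfolding L2_fun_def using le
    by (auto intro!: Bochner_Integration.integrable_bound[OF J(2)])
  show "(\<integral>x. (kernel_op K f x)\<^sup>2 \<partial>N) \<le> (\<integral>x. (f x)\<^sup>2 \<partial>N)"
  proof -
    have "(\<integral>x. (kernel_op K f x)\<^sup>2 \<partial>N) \<le> (\<integral>x. (\<integral>y. (f y)\<^sup>2 \<partial>K x) \<partial>N)"
      using K2 J(2) le by (intro integral_mono_AE) (auto simp: L2_fun_def)
    also have "\<dots> = (\<integral>x. (f x)\<^sup>2 \<partial>N)"
      using J(3) by (simp add: integral_joint_snd[of "\<lambda>x. (f x)\<^sup>2"])
    finally show ?thesis .
  qed
  have "integrable joint (\<lambda>z. f (snd z))"
    using f by (intro integrable_joint_snd L2_fun_integrable)
  from integral_joint(3)[OF this] show "(\<integral>x. kernel_op K f x \<partial>N) = (\<integral>x. f x \<partial>N)"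
    by (simp add: kernel_op_def integral_joint_snd)
qed

lemma kernel_op_cmult: "kernel_op K (\<lambda>y. c * f y) = (\<lambda>x. c * kernel_op K f x)"
  by (simp add: kernel_op_def fun_eq_iff)

lemma integral_joint_mult:
  assumes u: "u \<in> L2_fun N" and f: "f \<in> L2_fun N"
  shows "(\<integral>z. u (fst z) * f (snd z) \<partial>joint) = (\<integral>x. u x * kernel_op K f x \<partial>N)"
  using integral_joint(3)[OF integrable_mult_L2_fun[OF L2_fun_joint(1)[OF u] L2_fun_joint(2)[OF f]]]
  by (simp add: kernel_op_def)

text \<open>The quadratic form of I - K (the Dirichlet form), while \<open>coenergy\<close> below is
  that of I + K; see \<open>energy_eq\<close>. Written as integrals of squares they can be estimated
  pair by pair.\<close>

definition energy :: "('a \<Rightarrow> real) \<Rightarrow> real" where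
  "energy f = (\<integral>z. (f (fst z) - f (snd z))\<^sup>2 \<partial>joint) / 2"

definition coenergy :: "('a \<Rightarrow> real) \<Rightarrow> real" where
  "coenergy f = (\<integral>z. (f (fst z) + f (snd z))\<^sup>2 \<partial>joint) / 2"

lemma energy_eq:
  assumes f: "f \<in> L2_fun N"
  shows "energy f = (\<integral>x. (f x)\<^sup>2 \<partial>N) - (\<integral>x. f x * kernel_op K f x \<partial>N)"
    and "coenergy f = (\<integral>x. (f x)\<^sup>2 \<partial>N) + (\<integral>x. f x * kernel_op K f x \<partial>N)"
proof -
  have m: "(\<lambda>x. (f x)\<^sup>2) \<in> borel_measurable N" using L2_funD[OF f] by measurable
  note [simp] = L2_fun_joint[OF f, THEN L2_fun_integrable_square]
    integrable_mult_L2_fun[OF L2_fun_joint(1)[OF f] L2_fun_joint(2)[OF f]]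
    integral_joint_mult[OF f f] integral_joint_fst[OF m] integral_joint_snd[OF m]
  show "energy f = (\<integral>x. (f x)\<^sup>2 \<partial>N) - (\<integral>x. f x * kernel_op K f x \<partial>N)"
    by (simp add: energy_def power2_diff mult.assoc)
  show "coenergy f = (\<integral>x. (f x)\<^sup>2 \<partial>N) + (\<integral>x. f x * kernel_op K f x \<partial>N)"
    by (simp add: coenergy_def power2_sum mult.assoc)
qed

lemma coenergy_nonneg: "0 \<le> coenergy f"
  by (simp add: coenergy_def)

lemma coenergy_cong_AE:
  assumes [measurable]: "f \<in> borel_measurable N" "g \<in> borel_measurable N" and eq: "AE x in N. f x = g x"
  shows "coenergy f = coenergy g"
proof -
  have "AE z in joint. f (fst z) = g (fst z)"
    by (rule AE_distrD[where M'=N]) (simp, subst distr_joint_fst, rule eq)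
  moreover have "AE z in joint. f (snd z) = g (snd z)"
    by (rule AE_distrD[where M'=N]) (simp, subst distr_joint_snd, rule eq)
  ultimately have "AE z in joint. (f (fst z) + f (snd z))\<^sup>2 = (g (fst z) + g (snd z))\<^sup>2"
    by eventually_elim simp
  then show ?thesis
    unfolding coenergy_def by (intro arg_cong2[where f="(/)"] integral_cong_AE refl) measurable
qed

lemma kernel_op_selfadjoint:
  assumes f: "f \<in> L2_fun N" and g: "g \<in> L2_fun N"
  shows "(\<integral>x. g x * kernel_op K f x \<partial>N) = (\<integral>x. f x * kernel_op K g x \<partial>N)"
proof -
  have [measurable]: "f \<in> borel_measurable N" "g \<in> borel_measurable N"
    using f g by (auto dest: L2_funD)
  show ?thesis
    using integral_joint_swap[of "\<lambda>z. g (fst z) * f (snd z)"]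
    by (simp add: integral_joint_mult[symmetric] f g mult.commute)
qed

lemma L2_norm_kernel_op_le: "f \<in> L2_fun N \<Longrightarrow> L2_norm N (kernel_op K f) \<le> L2_norm N f"
  unfolding L2_norm_def using kernel_op_L2(2) by simp

text \<open>A real supremum is meaningful only over a bounded set; contractivity of the kernel
  supplies the bound.\<close>

lemma op_norm_zero_upper:
  assumes "f \<in> L2_zero N" "L2_norm N f \<le> 1"
  shows "L2_norm N (kernel_op K f) \<le> op_norm_zero N K"
  unfolding op_norm_zero_def
proof (rule cSUP_upper)
  show "bdd_above ((\<lambda>f. L2_norm N (kernel_op K f)) ` {f \<in> L2_zero N. L2_norm N f \<le> 1})"
    by (rule bdd_aboveI[of _ 1]) (auto simp: L2_zero_iff dest: L2_norm_kernel_op_le)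
qed (use assms in auto)

lemma zero_in_L2_zero: "(\<lambda>_. 0) \<in> L2_zero N" "L2_norm N (\<lambda>_. 0) \<le> 1"
  by (auto simp: L2_zero_iff L2_fun_const L2_norm_def)

lemma Gap_le_1: "Gap N K \<le> 1"
  using op_norm_zero_upper[OF zero_in_L2_zero] L2_norm_nonneg[of N "kernel_op K (\<lambda>_. 0)"]
  by (simp add: Gap_def)

lemma op_norm_zero_least:
  assumes "\<And>f. f \<in> L2_zero N \<Longrightarrow> L2_norm N f \<le> 1 \<Longrightarrow> L2_norm N (kernel_op K f) \<le> b"
  shows "op_norm_zero N K \<le> b"
  unfolding op_norm_zero_def
  by (rule cSUP_least) (use assms zero_in_L2_zero in auto)

lemma Gap_nonneg: "0 \<le> Gap N K"
  using op_norm_zero_least[of 1] L2_norm_kernel_op_le by (fastforce simp: Gap_def L2_zero_iff)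

text \<open>The supremum runs over the unit ball, so \<open>f\<close> is normalized first; for
  \<open>f\<close> of norm zero contractivity gives the claim.\<close>

lemma L2_norm_kernel_op_le_op_norm:
  assumes f: "f \<in> L2_zero N"
  shows "L2_norm N (kernel_op K f) \<le> op_norm_zero N K * L2_norm N f"
proof (cases "L2_norm N f = 0")
  case True
  then show ?thesis using L2_norm_kernel_op_le[of f] f by (simp add: L2_zero_iff)
next
  case False
  define c where "c = 1 / L2_norm N f"
  have c: "0 < c" using False L2_norm_nonneg[of N f] by (simp add: c_def)
  have "(\<lambda>x. c * f x) \<in> L2_zero N"
    using f by (auto simp: L2_zero_iff L2_fun_cmult)
  from op_norm_zero_upper[OF this] have "c * L2_norm N (kernel_op K f) \<le> op_norm_zero N K"
    using c False by (simp add: kernel_op_cmult L2_norm_cmult) (simp add: c_def)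
  then show ?thesis
    using c False by (simp add: c_def field_simps)
qed

lemma Gap_le_energy_zero:
  assumes f: "f \<in> L2_zero N"
  shows "Gap N K * (\<integral>x. (f x)\<^sup>2 \<partial>N) \<le> energy f"
proof -
  have f': "f \<in> L2_fun N" using f by (simp add: L2_zero_iff)
  have "(\<integral>x. f x * kernel_op K f x \<partial>N) \<le> L2_norm N f * L2_norm N (kernel_op K f)"
    using f' kernel_op_L2(1) by (intro inner_le_L2_norm)
  also have "\<dots> \<le> L2_norm N f * (op_norm_zero N K * L2_norm N f)"
    by (intro mult_left_mono L2_norm_kernel_op_le_op_norm f L2_norm_nonneg)
  also have "\<dots> = op_norm_zero N K * (\<integral>x. (f x)\<^sup>2 \<partial>N)"
    unfolding L2_norm_square[symmetric] by (simp add: power2_eq_square)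
  finally show ?thesis
    by (simp add: energy_eq[OF f'] Gap_def algebra_simps)
qed

lemma Gap_le_energy:
  assumes f: "f \<in> L2_fun N"
  shows "Gap N K * (\<integral>x. (f x - (\<integral>y. f y \<partial>N))\<^sup>2 \<partial>N) \<le> energy f"
proof -
  have "(\<lambda>x. f x - (\<integral>y. f y \<partial>N)) \<in> L2_zero N"
    using f by (auto simp: L2_zero_iff prob_space L2_fun_integrable intro!: L2_fun_diff L2_fun_const)
  from Gap_le_energy_zero[OF this] show ?thesis by (simp add: energy_def)
qed

text \<open>The norm of a self-adjoint operator is governed by its quadratic form. The hypotheses
  bound the form of \<open>K\<close> by 1 - c from above and below, and polarization with the
  parallelogram law passes from the form to the norm.\<close>

lemma le_Gap:
  assumes E: "\<And>f. f \<in> L2_zero N \<Longrightarrow> c * (\<integral>x. (f x)\<^sup>2 \<partial>N) \<le> energy f"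
    and S: "\<And>f. f \<in> L2_zero N \<Longrightarrow> c * (\<integral>x. (f x)\<^sup>2 \<partial>N) \<le> coenergy f"
    and "c \<le> 1"
  shows "c \<le> Gap N K"
proof -
  have "L2_norm N (kernel_op K f) \<le> 1 - c" if f: "f \<in> L2_zero N" and f1: "L2_norm N f \<le> 1" for f
  proof (cases "L2_norm N (kernel_op K f) = 0")
    case True
    then show ?thesis using \<open>c \<le> 1\<close> by simp
  next
    case False
    define n where "n = L2_norm N (kernel_op K f)"
    have n: "0 < n" using False L2_norm_nonneg[of N] by (simp add: n_def less_le)
    have f': "f \<in> L2_fun N" using f by (simp add: L2_zero_iff)
    \<comment> \<open>The unit vector in the direction of K f: its inner product with K f is the
      norm \<open>n\<close> that is to be bounded.\<close>
    define h where "h x = (1 / n) * kernel_op K f x" for x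
    have h': "h \<in> L2_fun N" unfolding h_def using f' by (intro L2_fun_cmult kernel_op_L2)
    have h0: "h \<in> L2_zero N"
      using h' f kernel_op_L2(3)[OF f'] by (simp add: L2_zero_iff h_def[abs_def])
    have hn: "(\<integral>x. (h x)\<^sup>2 \<partial>N) = 1"
      using n by (simp add: h_def power_divide L2_norm_square[symmetric]) (simp add: n_def)
    have fn: "(\<integral>x. (f x)\<^sup>2 \<partial>N) \<le> 1"
      using f1 L2_norm_nonneg[of N f] by (simp add: L2_norm_square[symmetric] power_le_one)
    have plus: "(\<lambda>x. f x + h x) \<in> L2_zero N" and minus: "(\<lambda>x. f x - h x) \<in> L2_zero N"
      using f h0 f' h' by (auto simp: L2_zero_iff L2_fun_add L2_fun_diff L2_fun_integrable)
    note plus' = L2_fun_add[OF f' h'] and minus' = L2_fun_diff[OF f' h']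
    note i = integrable_mult_L2_fun[OF f' h'] L2_fun_integrable_square[OF f'] L2_fun_integrable_square[OF h']
    note k = kernel_op_L2(1)[OF f'] kernel_op_L2(1)[OF h']
    note j [simp] = integrable_mult_L2_fun[OF f' k(1)] integrable_mult_L2_fun[OF f' k(2)]
       integrable_mult_L2_fun[OF h' k(1)] integrable_mult_L2_fun[OF h' k(2)]
    let ?ip = "\<lambda>u v. \<integral>z. u (fst z) * v (snd z) \<partial>joint"
    have ij: "integrable joint (\<lambda>z. u (fst z) * v (snd z))" if "u \<in> L2_fun N" "v \<in> L2_fun N" for u v
      using that by (intro integrable_mult_L2_fun L2_fun_joint)
    have sym: "?ip h f = ?ip f h"
      using kernel_op_selfadjoint[OF f' h'] by (simp only: integral_joint_mult f' h')
    have P: "?ip (\<lambda>x. f x + h x) (\<lambda>x. f x + h x) = ?ip f f + 2 * ?ip h f + ?ip h h"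
      using ij[OF f' f'] ij[OF f' h'] ij[OF h' f'] ij[OF h' h'] sym
      by (simp add: algebra_simps)
    have M: "?ip (\<lambda>x. f x - h x) (\<lambda>x. f x - h x) = ?ip f f - 2 * ?ip h f + ?ip h h"
      using ij[OF f' f'] ij[OF f' h'] ij[OF h' f'] ij[OF h' h'] sym
      by (simp add: algebra_simps)
    have sq: "(\<integral>x. (f x + h x)\<^sup>2 \<partial>N) + (\<integral>x. (f x - h x)\<^sup>2 \<partial>N) = 2 * (\<integral>x. (f x)\<^sup>2 \<partial>N) + 2"
      using i hn by (simp add: power2_sum power2_diff mult.assoc)
    have "?ip h f = n"
    proof -
      have "?ip h f = (\<integral>x. (1 / n) * (kernel_op K f x)\<^sup>2 \<partial>N)"
        by (simp add: integral_joint_mult f' h') (simp add: h_def power2_eq_square)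
      also have "\<dots> = n"
        using n unfolding n_def
        by (simp only: integral_mult_right_zero L2_norm_square[symmetric]) (simp add: power2_eq_square)
      finally show ?thesis .
    qed
    moreover have "?ip (\<lambda>x. f x + h x) (\<lambda>x. f x + h x) \<le> (1 - c) * (\<integral>x. (f x + h x)\<^sup>2 \<partial>N)"
      using E[OF plus] unfolding energy_eq[OF plus'] integral_joint_mult[OF plus' plus']
      by (simp add: left_diff_distrib[of 1 c])
    moreover have "- ?ip (\<lambda>x. f x - h x) (\<lambda>x. f x - h x) \<le> (1 - c) * (\<integral>x. (f x - h x)\<^sup>2 \<partial>N)"
      using S[OF minus] unfolding energy_eq[OF minus'] integral_joint_mult[OF minus' minus']
      by (simp add: left_diff_distrib[of 1 c])
    \<comment> \<open>Polarization: \<open>P\<close> minus \<open>M\<close> is 4 n. The upper bound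
      is used at f + h and the lower one at f - h, and the squared norms of these two add up to at
      most 4.\<close>
    ultimately have "4 * n \<le> (1 - c) * ((\<integral>x. (f x + h x)\<^sup>2 \<partial>N) + (\<integral>x. (f x - h x)\<^sup>2 \<partial>N))"
      using P M by (simp add: distrib_left)
    also have "\<dots> \<le> (1 - c) * 4"
      unfolding sq using fn \<open>c \<le> 1\<close> by (intro mult_left_mono) auto
    finally show ?thesis by (simp add: n_def)
  qed
  then have "op_norm_zero N K \<le> 1 - c" by (rule op_norm_zero_least)
  then show ?thesis by (simp add: Gap_def)
qed

end

section \<open>Restricted kernels and matrices\<close>

lemma one_divide_ennreal: "0 < r \<Longrightarrow> 1 / ennreal r = ennreal (1 / r)"
  using divide_ennreal[of 1 r] by simp

section \<open>Conditioning the reference measure on a set\<close>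

lemma sets_cond_measure: "sets (cond_measure N A) = sets (restrict_space N A)"
  by (simp add: cond_measure_def)

lemma space_cond_measure: "A \<in> sets N \<Longrightarrow> space (cond_measure N A) = A"
  by (simp add: cond_measure_def space_scale_measure space_restrict_space2)

lemma measurable_cond_measure:
  "A \<in> sets N \<Longrightarrow> f \<in> N \<rightarrow>\<^sub>M M \<Longrightarrow> f \<in> cond_measure N A \<rightarrow>\<^sub>M M"
  by (simp add: measurable_cong_sets[OF sets_cond_measure refl] measurable_restrict_space1)

lemma nn_integral_cond_measure:
  assumes A: "A \<in> sets N" and f: "f \<in> borel_measurable (restrict_space N A)"
  shows "(\<integral>\<^sup>+x. f x \<partial>cond_measure N A) = 1 / emeasure N A * (\<integral>\<^sup>+x\<in>A. f x \<partial>N)"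
  using A by (simp add: cond_measure_def nn_integral_scale_measure[OF f] nn_integral_restrict_space)

context prob_space
begin

lemma prob_space_cond_measure:
  assumes A: "A \<in> sets M" "0 < measure M A"
  shows "prob_space (cond_measure M A)"
proof
  have "emeasure (cond_measure M A) (space (cond_measure M A)) = 1 / emeasure M A * emeasure M A"
    using A by (simp add: space_cond_measure) (simp add: cond_measure_def emeasure_restrict_space)
  also have "\<dots> = 1"
    using A by (simp add: emeasure_eq_measure one_divide_ennreal ennreal_mult'[symmetric])
  finally show "emeasure (cond_measure M A) (space (cond_measure M A)) = 1" .
qed

lemma integral_cond_measure:
  fixes f :: "'a \<Rightarrow> real"
  assumes A: "A \<in> sets M" "0 < measure M A" and f: "integrable M f"
  shows "integrable (cond_measure M A) f"
    and "(\<integral>x. f x \<partial>cond_measure M A) = (\<integral>x. indicator A x * f x \<partial>M) / measure M A"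
proof -
  \<comment> \<open>With the normalization written as a constant density, the integration rules for
    densities and restrictions apply.\<close>
  have d: "cond_measure M A = restrict_space (density M (\<lambda>x. ennreal (1 / measure M A))) A"
  proof (rule measure_eqI)
    show "sets (cond_measure M A) = sets (restrict_space (density M (\<lambda>x. ennreal (1 / measure M A))) A)"
      by (simp add: sets_cond_measure sets_restrict_space)
    fix X assume "X \<in> sets (cond_measure M A)"
    then have X: "X \<in> sets M" "X \<subseteq> A" using A by (auto simp: sets_cond_measure sets_restrict_space)
    show "emeasure (cond_measure M A) X
        = emeasure (restrict_space (density M (\<lambda>x. ennreal (1 / measure M A))) A) X"
      using X A by (simp add: cond_measure_def emeasure_restrict_space emeasure_density_const
        emeasure_eq_measure one_divide_ennreal)
  qed
  have i: "integrable M (\<lambda>x. indicator A x * f x)"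
    using integrable_mult_indicator[OF A(1) f] by simp
  show "integrable (cond_measure M A) f"
    using A i f unfolding d
    by (subst integrable_restrict_space) (auto simp: integrable_density)
  show "(\<integral>x. f x \<partial>cond_measure M A) = (\<integral>x. indicator A x * f x \<partial>M) / measure M A"
    using A i f unfolding d
    by (subst integral_restrict_space) (auto simp: integral_density)
qed

end

context reversible_kernel
begin

section \<open>Kernels restricted to a set\<close>

lemma emeasure_kernel_measurable [measurable]:
  "A \<in> sets N \<Longrightarrow> (\<lambda>x. emeasure (K x) A) \<in> borel_measurable N"
  by (rule measurable_compose[OF kernel_subprob measurable_emeasure_subprob_algebra])

text \<open>One step of \<open>K\<close> is made, and a move out of \<open>A\<close> is undone by
  resetting to \<open>x\<close>. As an image measure the kernel inherits measurability, total mass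
  and an integration rule.\<close>

lemma restricted_kernel_eq_distr:
  assumes A: "A \<in> sets N" and x: "x \<in> A"
  shows "restricted_kernel N K A x = distr (K x) (restrict_space N A) (\<lambda>y. if y \<in> A then y else x)"
proof (rule measure_eqI)
  have xN: "x \<in> space N" using A x sets.sets_into_space by auto
  have S: "sets (restricted_kernel N K A x) = sets (restrict_space N A)"
    using sets.space_closed[of "restrict_space N A"] sets.sigma_sets_eq[of "restrict_space N A"] A
    by (simp add: restricted_kernel_def sets_measure_of space_restrict_space2)
  then show "sets (restricted_kernel N K A x)
      = sets (distr (K x) (restrict_space N A) (\<lambda>y. if y \<in> A then y else x))" by simp
  have T: "(\<lambda>y. if y \<in> A then y else x) \<in> K x \<rightarrow>\<^sub>M restrict_space N A"
    using A x xN by (auto simp: measurable_kernel_iff intro!: measurable_restrict_space2 measurable_If_set)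
  fix B assume "B \<in> sets (restricted_kernel N K A x)"
  then have B: "B \<in> sets N" "B \<subseteq> A" "B \<in> sets (restrict_space N A)"
    using A unfolding S by (auto simp: sets_restrict_space)
  have "(\<lambda>y. if y \<in> A then y else x) -` B \<inter> space (K x) = B \<union> (if x \<in> B then space N - A else {})"
    using A B x sets.sets_into_space[OF B(1)] by (auto simp: space_kernel[OF xN] split: if_splits)
  then have "emeasure (distr (K x) (restrict_space N A) (\<lambda>y. if y \<in> A then y else x)) B
     = emeasure (K x) (B \<union> (if x \<in> B then space N - A else {}))"
    using B T by (simp add: emeasure_distr)
  also have "\<dots> = emeasure (K x) B + indicator B x * emeasure (K x) (space N - A)"
    using A B sets_kernel[OF xN]
    by (cases "x \<in> B") (auto intro!: plus_emeasure[symmetric])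
  also have "\<dots> = emeasure (restricted_kernel N K A x) B"
    using A B sets_kernel[OF xN] by (intro emeasure_restricted_kernel[symmetric]) auto
  finally show "emeasure (restricted_kernel N K A x) B
     = emeasure (distr (K x) (restrict_space N A) (\<lambda>y. if y \<in> A then y else x)) B" ..
qed

lemma measurable_reject_outside:
  assumes A: "A \<in> sets N"
  shows "(\<lambda>(x, y). if y \<in> A then y else x) \<in> cond_measure N A \<Otimes>\<^sub>M N \<rightarrow>\<^sub>M restrict_space N A"
proof -
  have c: "fst \<in> cond_measure N A \<Otimes>\<^sub>M N \<rightarrow>\<^sub>M restrict_space N A"
    using measurable_fst[of "cond_measure N A" N]
    by (simp add: measurable_cong_sets[OF refl sets_cond_measure])
  from measurable_restrict_space1[of "\<lambda>x. x" N N A]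
  have [measurable]: "fst \<in> cond_measure N A \<Otimes>\<^sub>M N \<rightarrow>\<^sub>M N"
    by (auto intro: measurable_compose[OF c])
  have "(\<lambda>z. if snd z \<in> A then snd z else fst z) \<in> cond_measure N A \<Otimes>\<^sub>M N \<rightarrow>\<^sub>M N"
    using A by measurable
  moreover have "(if snd z \<in> A then snd z else fst z) \<in> A" if "z \<in> space (cond_measure N A \<Otimes>\<^sub>M N)" for z
    using that A by (auto simp: space_pair_measure space_cond_measure)
  ultimately show ?thesis
    using A by (auto simp: split_beta' intro!: measurable_restrict_space2)
qed

lemma restricted_kernel_measurable:
  assumes A: "A \<in> sets N"
  shows "restricted_kernel N K A \<in> cond_measure N A \<rightarrow>\<^sub>M prob_algebra (cond_measure N A)"
proof -
  have "K \<in> cond_measure N A \<rightarrow>\<^sub>M prob_algebra N"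
    using A kernel by (rule measurable_cond_measure)
  from measurable_distr_prob_space2[OF this, of "\<lambda>x y. if y \<in> A then y else x" "restrict_space N A"]
  have "(\<lambda>x. distr (K x) (restrict_space N A) (\<lambda>y. if y \<in> A then y else x))
      \<in> cond_measure N A \<rightarrow>\<^sub>M prob_algebra (restrict_space N A)"
    using measurable_reject_outside[OF A] by simp
  moreover have "prob_algebra (restrict_space N A) = prob_algebra (cond_measure N A)"
    by (simp add: prob_algebra_def subprob_algebra_cong[OF sets_cond_measure])
  ultimately have "(\<lambda>x. distr (K x) (restrict_space N A) (\<lambda>y. if y \<in> A then y else x))
      \<in> cond_measure N A \<rightarrow>\<^sub>M prob_algebra (cond_measure N A)" by simp
  then show ?thesis
    by (rule measurable_cong[THEN iffD1, rotated])
       (use A in \<open>simp add: restricted_kernel_eq_distr space_cond_measure\<close>)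
qed

text \<open>Moves within \<open>A\<close> inherit reversibility from \<open>K\<close>; refused moves
  contribute a term that depends only on the intersection of the two sets, hence is
  symmetric.\<close>

lemma reversible_kernel_restricted:
  assumes A: "A \<in> sets N" "0 < measure N A"
  shows "reversible_kernel (cond_measure N A) (restricted_kernel N K A)"
proof (intro reversible_kernel.intro reversible_kernel_axioms.intro)
  show "prob_space (cond_measure N A)" using A by (rule prob_space_cond_measure)
  show mk: "restricted_kernel N K A \<in> cond_measure N A \<rightarrow>\<^sub>M prob_algebra (cond_measure N A)"
    using A by (intro restricted_kernel_measurable)
  fix B C assume "B \<in> sets (cond_measure N A)" "C \<in> sets (cond_measure N A)"
  then have B: "B \<in> sets N" "B \<subseteq> A" and C: "C \<in> sets N" "C \<subseteq> A"
    using A by (auto simp: sets_cond_measure sets_restrict_space)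
  let ?R = "\<lambda>B C. (\<integral>\<^sup>+x\<in>B. emeasure (K x) C \<partial>N) + (\<integral>\<^sup>+x\<in>B\<inter>C. emeasure (K x) (space N - A) \<partial>N)"
  have *: "(\<integral>\<^sup>+x\<in>B. emeasure (restricted_kernel N K A x) C \<partial>cond_measure N A)
      = 1 / emeasure N A * ?R B C"
    if B: "B \<in> sets N" "B \<subseteq> A" and C: "C \<in> sets N" "C \<subseteq> A" for B C
  proof -
    have C': "C \<in> sets (cond_measure N A)" and B': "B \<in> sets (cond_measure N A)"
      using A B C by (auto simp: sets_cond_measure sets_restrict_space_iff)
    have [measurable]: "restricted_kernel N K A \<in> cond_measure N A \<rightarrow>\<^sub>M subprob_algebra (cond_measure N A)"
      using mk by (rule measurable_prob_algebraD)
    have m: "(\<lambda>x. emeasure (restricted_kernel N K A x) C * indicator B x)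
        \<in> borel_measurable (restrict_space N A)"
    proof (subst measurable_cong_sets[OF sets_cond_measure[symmetric] refl])
      show "(\<lambda>x. emeasure (restricted_kernel N K A x) C * indicator B x) \<in> borel_measurable (cond_measure N A)"
        using B' C' by measurable
    qed
    have "(\<integral>\<^sup>+x\<in>B. emeasure (restricted_kernel N K A x) C \<partial>cond_measure N A)
        = 1 / emeasure N A * (\<integral>\<^sup>+x\<in>A. (emeasure (restricted_kernel N K A x) C * indicator B x) \<partial>N)"
      using A m by (subst nn_integral_cond_measure) auto
    also have "(\<integral>\<^sup>+x\<in>A. (emeasure (restricted_kernel N K A x) C * indicator B x) \<partial>N)
        = (\<integral>\<^sup>+x. emeasure (K x) C * indicator B x + emeasure (K x) (space N - A) * indicator (B \<inter> C) x \<partial>N)"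
      using A B C sets_kernel
      by (intro nn_integral_cong) (auto simp: emeasure_restricted_kernel indicator_def)
    also have "\<dots> = ?R B C"
      using A B C by (intro nn_integral_add) (auto intro!: borel_measurable_times_ennreal)
    finally show ?thesis .
  qed
  show "(\<integral>\<^sup>+x\<in>B. emeasure (restricted_kernel N K A x) C \<partial>cond_measure N A)
      = (\<integral>\<^sup>+x\<in>C. emeasure (restricted_kernel N K A x) B \<partial>cond_measure N A)"
    using *[OF B C] *[OF C B] reversible[OF B(1) C(1)] by (simp add: Int_commute)
qed

text \<open>A refused move leaves the state unchanged and contributes a zero difference, so only
  pairs inside \<open>A\<close> count.\<close>

lemma energy_restricted:
  assumes A: "A \<in> sets N" "0 < measure N A" and f: "f \<in> borel_measurable N"
  shows "reversible_kernel.energy (cond_measure N A) (restricted_kernel N K A) f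
    = (\<integral>z. indicator (A \<times> A) z * (f (fst z) - f (snd z))\<^sup>2 \<partial>joint) / (2 * measure N A)"
proof -
  interpret R: reversible_kernel "cond_measure N A" "restricted_kernel N K A"
    using A by (rule reversible_kernel_restricted)
  let ?g = "\<lambda>z. (f (fst z) - f (snd z))\<^sup>2"
  have AN: "x \<in> A \<Longrightarrow> x \<in> space N" for x using A sets.sets_into_space by auto
  have [measurable]: "f \<in> borel_measurable N" "f \<in> borel_measurable (cond_measure N A)" "A \<in> sets N"
    "f \<in> borel_measurable (restrict_space N A)"
    using A f by (auto intro: measurable_cond_measure measurable_restrict_space1)
  have gm: "(\<lambda>x. \<integral>\<^sup>+y. ennreal (?g (x, y)) \<partial>restricted_kernel N K A x) \<in> borel_measurable (restrict_space N A)"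
  proof (subst measurable_cong_sets[OF sets_cond_measure[symmetric] refl])
    show "(\<lambda>x. \<integral>\<^sup>+y. ennreal (?g (x, y)) \<partial>restricted_kernel N K A x) \<in> borel_measurable (cond_measure N A)"
      by (rule nn_integral_measurable_subprob_algebra2[where N="cond_measure N A"]; measurable)
  qed
  have inner: "(\<integral>\<^sup>+y. ennreal (?g (x, y)) \<partial>restricted_kernel N K A x)
      = (\<integral>\<^sup>+y. indicator A y * ennreal (?g (x, y)) \<partial>K x)" if x: "x \<in> A" for x
  proof -
    have "(\<lambda>y. if y \<in> A then y else x) \<in> K x \<rightarrow>\<^sub>M restrict_space N A"
      using A x AN by (auto simp: measurable_kernel_iff intro!: measurable_restrict_space2 measurable_If_set)
    then have "(\<integral>\<^sup>+y. ennreal (?g (x, y)) \<partial>restricted_kernel N K A x)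
       = (\<integral>\<^sup>+y. ennreal (?g (x, if y \<in> A then y else x)) \<partial>K x)"
      using A x by (simp add: restricted_kernel_eq_distr nn_integral_distr)
    also have "\<dots> = (\<integral>\<^sup>+y. indicator A y * ennreal (?g (x, y)) \<partial>K x)"
      by (intro nn_integral_cong) auto
    finally show ?thesis .
  qed
  have "(\<integral>\<^sup>+z. ennreal (?g z) \<partial>R.joint)
      = (\<integral>\<^sup>+x. \<integral>\<^sup>+y. ennreal (?g (x, y)) \<partial>restricted_kernel N K A x \<partial>cond_measure N A)"
    by (rule R.nn_integral_joint) measurable
  also have "\<dots> = 1 / emeasure N A * (\<integral>\<^sup>+x\<in>A. (\<integral>\<^sup>+y. ennreal (?g (x, y)) \<partial>restricted_kernel N K A x) \<partial>N)"
    using A(1) gm by (rule nn_integral_cond_measure)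
  also have "(\<integral>\<^sup>+x\<in>A. (\<integral>\<^sup>+y. ennreal (?g (x, y)) \<partial>restricted_kernel N K A x) \<partial>N)
      = (\<integral>\<^sup>+x. \<integral>\<^sup>+y. ennreal (indicator (A \<times> A) (x, y) * ?g (x, y)) \<partial>K x \<partial>N)"
    using inner by (intro nn_integral_cong) (auto simp: indicator_times split: split_indicator intro!: nn_integral_cong)
  also have "\<dots> = (\<integral>\<^sup>+z. ennreal (indicator (A \<times> A) z * ?g z) \<partial>joint)"
    by (rule nn_integral_joint[symmetric]) measurable
  finally have "(\<integral>z. ?g z \<partial>R.joint)
      = enn2real (1 / emeasure N A * (\<integral>\<^sup>+z. ennreal (indicator (A \<times> A) z * ?g z) \<partial>joint))"
    by (subst integral_eq_nn_integral) auto
  also have "\<dots> = (\<integral>z. indicator (A \<times> A) z * ?g z \<partial>joint) / measure N A"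
    using A by (subst integral_eq_nn_integral)
      (auto simp: enn2real_mult emeasure_eq_measure one_divide_ennreal)
  finally show ?thesis by (simp add: R.energy_def)
qed

end

section \<open>Finite chains given by a matrix\<close>

lemma reversible_kernel_matrix:
  assumes v: "\<And>i. i \<in> {1..m} \<Longrightarrow> 0 \<le> v i" "(\<Sum>i\<in>{1..m}. v i) = 1"
    and Q: "\<And>i j. i \<in> {1..m} \<Longrightarrow> j \<in> {1..m} \<Longrightarrow> 0 \<le> Q i j"
      "\<And>i. i \<in> {1..m} \<Longrightarrow> (\<Sum>j\<in>{1..m}. Q i j) = 1"
    and rev: "\<And>i j. i \<in> {1..m} \<Longrightarrow> j \<in> {1..m} \<Longrightarrow> v i * Q i j = v j * Q j i"
  shows "reversible_kernel (vector_measure m v) (matrix_kernel m Q)"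
proof (intro reversible_kernel.intro reversible_kernel_axioms.intro)
  have sp: "space (vector_measure m v) = {1..m}" "sets (vector_measure m v) = Pow {1..m}"
    by (auto simp: vector_measure_def space_point_measure sets_point_measure)
  show "prob_space (vector_measure m v)"
  proof
    show "emeasure (vector_measure m v) (space (vector_measure m v)) = 1"
      unfolding vector_measure_def using v(2) sum_ennreal[of "{1..m}" v, OF v(1)]
      by (simp add: emeasure_point_measure_finite space_point_measure)
  qed
  have p: "prob_space (matrix_kernel m Q i)" if "i \<in> {1..m}" for i
  proof
    show "emeasure (matrix_kernel m Q i) (space (matrix_kernel m Q i)) = 1"
      unfolding matrix_kernel_def using Q(2)[OF that] sum_ennreal[of "{1..m}" "Q i", OF Q(1)[OF that]]
      by (simp add: emeasure_point_measure_finite space_point_measure)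
  qed
  have eq: "sets (matrix_kernel m Q i) = sets (vector_measure m v)" for i
    by (simp add: matrix_kernel_def vector_measure_def sets_point_measure)
  show "matrix_kernel m Q \<in> vector_measure m v \<rightarrow>\<^sub>M prob_algebra (vector_measure m v)"
  proof (rule measurable_prob_algebraI)
    show "matrix_kernel m Q \<in> vector_measure m v \<rightarrow>\<^sub>M subprob_algebra (vector_measure m v)"
    proof (subst vector_measure_def, subst measurable_point_measure_eq1, rule Pi_I)
      fix i assume "i \<in> {1..m}"
      then show "matrix_kernel m Q i \<in> space (subprob_algebra (vector_measure m v))"
        using p eq by (simp add: space_subprob_algebra prob_space_imp_subprob_space)
    qed
  qed (use p sp in auto)
  fix A B assume "A \<in> sets (vector_measure m v)" "B \<in> sets (vector_measure m v)"
  then have A: "A \<subseteq> {1..m}" and B: "B \<subseteq> {1..m}" by (auto simp: sp)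
  have *: "(\<integral>\<^sup>+x\<in>A. emeasure (matrix_kernel m Q x) B \<partial>vector_measure m v)
      = ennreal (\<Sum>i\<in>A. \<Sum>j\<in>B. v i * Q i j)" if A: "A \<subseteq> {1..m}" and B: "B \<subseteq> {1..m}" for A B
  proof -
    have "(\<integral>\<^sup>+x\<in>A. emeasure (matrix_kernel m Q x) B \<partial>vector_measure m v)
       = (\<Sum>i\<in>{1..m}. ennreal (v i) * (emeasure (matrix_kernel m Q i) B * indicator A i))"
      by (simp add: vector_measure_def nn_integral_point_measure_finite)
    also have "\<dots> = (\<Sum>i\<in>A. ennreal (v i) * emeasure (matrix_kernel m Q i) B)"
      using A by (intro sum.mono_neutral_cong_right) auto
    also have "\<dots> = (\<Sum>i\<in>A. ennreal (\<Sum>j\<in>B. v i * Q i j))"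
    proof (intro sum.cong refl)
      fix i assume "i \<in> A"
      then have i: "i \<in> {1..m}" using A by auto
      have "emeasure (matrix_kernel m Q i) B = (\<Sum>j\<in>B. ennreal (Q i j))"
        unfolding matrix_kernel_def using B by (simp add: emeasure_point_measure_finite)
      also have "\<dots> = ennreal (\<Sum>j\<in>B. Q i j)"
        using B Q i by (intro sum_ennreal) auto
      finally show "ennreal (v i) * emeasure (matrix_kernel m Q i) B = ennreal (\<Sum>j\<in>B. v i * Q i j)"
        using v(1)[OF i] by (simp add: ennreal_mult'[symmetric] sum_distrib_left)
    qed
    also have "\<dots> = ennreal (\<Sum>i\<in>A. \<Sum>j\<in>B. v i * Q i j)"
      by (intro sum_ennreal sum_nonneg mult_nonneg_nonneg v(1) Q(1)) (use A B in blast)+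
    finally show ?thesis .
  qed
  have "(\<Sum>i\<in>A. \<Sum>j\<in>B. v i * Q i j) = (\<Sum>i\<in>A. \<Sum>j\<in>B. v j * Q j i)"
    by (intro sum.cong refl rev) (use A B in blast)+
  also have "\<dots> = (\<Sum>j\<in>B. \<Sum>i\<in>A. v j * Q j i)" by (rule sum.swap)
  finally show "(\<integral>\<^sup>+x\<in>A. emeasure (matrix_kernel m Q x) B \<partial>vector_measure m v)
      = (\<integral>\<^sup>+x\<in>B. emeasure (matrix_kernel m Q x) A \<partial>vector_measure m v)"
    by (simp add: *[OF A B] *[OF B A])
qed

lemma energy_matrix:
  assumes R: "reversible_kernel (vector_measure m v) (matrix_kernel m Q)"
    and v: "\<And>i. i \<in> {1..m} \<Longrightarrow> 0 \<le> v i"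
    and Q: "\<And>i j. i \<in> {1..m} \<Longrightarrow> j \<in> {1..m} \<Longrightarrow> 0 \<le> Q i j"
  shows "reversible_kernel.energy (vector_measure m v) (matrix_kernel m Q) f
    = (\<Sum>i\<in>{1..m}. \<Sum>j\<in>{1..m}. v i * Q i j * (f i - f j)\<^sup>2) / 2"
proof -
  interpret reversible_kernel "vector_measure m v" "matrix_kernel m Q" by (rule R)
  have [measurable]: "f \<in> borel_measurable (vector_measure m v)"
    by (simp add: vector_measure_def)
  have "(\<integral>\<^sup>+z. ennreal ((f (fst z) - f (snd z))\<^sup>2) \<partial>joint)
     = (\<integral>\<^sup>+i. \<integral>\<^sup>+j. ennreal ((f i - f j)\<^sup>2) \<partial>matrix_kernel m Q i \<partial>vector_measure m v)"
    by (subst nn_integral_joint) auto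
  also have "\<dots> = (\<Sum>i\<in>{1..m}. ennreal (v i) * (\<Sum>j\<in>{1..m}. ennreal (Q i j) * ennreal ((f i - f j)\<^sup>2)))"
    by (simp add: vector_measure_def matrix_kernel_def nn_integral_point_measure_finite)
  also have "\<dots> = (\<Sum>i\<in>{1..m}. ennreal (\<Sum>j\<in>{1..m}. v i * Q i j * (f i - f j)\<^sup>2))"
  proof (intro sum.cong refl)
    fix i assume i: "i \<in> {1..m}"
    have "(\<Sum>j\<in>{1..m}. ennreal (Q i j) * ennreal ((f i - f j)\<^sup>2)) = (\<Sum>j\<in>{1..m}. ennreal (Q i j * (f i - f j)\<^sup>2))"
      using i Q by (intro sum.cong refl) (simp add: ennreal_mult)
    also have "\<dots> = ennreal (\<Sum>j\<in>{1..m}. Q i j * (f i - f j)\<^sup>2)"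
      using i Q by (intro sum_ennreal) auto
    finally show "ennreal (v i) * (\<Sum>j\<in>{1..m}. ennreal (Q i j) * ennreal ((f i - f j)\<^sup>2))
       = ennreal (\<Sum>j\<in>{1..m}. v i * Q i j * (f i - f j)\<^sup>2)"
      using v[OF i] by (simp add: ennreal_mult'[symmetric] sum_distrib_left mult.assoc)
  qed
  also have "\<dots> = ennreal (\<Sum>i\<in>{1..m}. \<Sum>j\<in>{1..m}. v i * Q i j * (f i - f j)\<^sup>2)"
    using v Q by (intro sum_ennreal sum_nonneg) auto
  finally have "(\<integral>z. (f (fst z) - f (snd z))\<^sup>2 \<partial>joint)
      = enn2real (ennreal (\<Sum>i\<in>{1..m}. \<Sum>j\<in>{1..m}. v i * Q i j * (f i - f j)\<^sup>2))"
    by (subst integral_eq_nn_integral) auto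
  also have "\<dots> = (\<Sum>i\<in>{1..m}. \<Sum>j\<in>{1..m}. v i * Q i j * (f i - f j)\<^sup>2)"
    using v Q by (intro enn2real_ennreal sum_nonneg) auto
  finally show ?thesis by (simp add: energy_def)
qed

section \<open>Decomposition of the energy\<close>

lemma sum_indicator_partition:
  fixes c :: "'i \<Rightarrow> real"
  assumes "finite I" "disjoint_family_on A I" "i \<in> I" "x \<in> A i"
  shows "(\<Sum>j\<in>I. indicator (A j) x * c j) = c i"
proof -
  have "(\<Sum>j\<in>I. indicator (A j) x * c j) = (\<Sum>j\<in>I. if j = i then c i else 0)"
    using assms by (intro sum.cong refl) (auto simp: disjoint_family_on_def indicator_def)
  then show ?thesis using assms by simp
qed

text \<open>Young's inequality (a - b)^2 <= (1 + s) a^2 + (1 + 1/s) b^2 with s = (4 - g) / g,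
  multiplied by g, so that the coefficient of a^2 is the constant 4. Derived from a square without
  dividing by g, it includes g = 0.\<close>

lemma weighted_square_diff_le:
  fixes a b g :: real
  assumes "0 \<le> g" "g < 4"
  shows "g * (a - b)\<^sup>2 \<le> 4 * a\<^sup>2 + 4 * g / (4 - g) * b\<^sup>2"
proof -
  have "0 \<le> ((4 - g) * a + g * b)\<^sup>2" by simp
  then have "(4 - g) * (g * (a - b)\<^sup>2) \<le> 4 * (4 - g) * a\<^sup>2 + 4 * g * b\<^sup>2"
    by (simp add: power2_eq_square algebra_simps)
  also have "\<dots> = (4 - g) * (4 * a\<^sup>2 + 4 * g / (4 - g) * b\<^sup>2)"
    using assms by (simp add: field_simps)
  finally have "(4 - g) * (g * (a - b)\<^sup>2) \<le> (4 - g) * (4 * a\<^sup>2 + 4 * g / (4 - g) * b\<^sup>2)" .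
  then show ?thesis using assms by simp
qed

lemma square_diff_le_double:
  fixes a b :: real
  shows "(a - b)\<^sup>2 \<le> 2 * (a\<^sup>2 + b\<^sup>2)"
  using zero_le_power2[of "a + b"] by (simp add: power2_eq_square algebra_simps)

text \<open>\<open>V\<close> and \<open>Fb\<close> stand for the squared norms of the deviation and
  of the block averages, \<open>Ei\<close> and \<open>Ec\<close> for the energy inside and across
  blocks, \<open>B\<close> for the integrated squared differences of the averages. A quarter of
  \<open>B\<close> charges 2 Ec for the cross energy and at most Ei for the deviations; with the Ei
  that controls \<open>V\<close> this makes 2 (Ei + Ec), which dictates the weight 4. The term - Ei
  in the last hypothesis matters: for g > 0 the bound without it, 16 Ei / (4 - g), exceeds the
  admissible 4 Ei.\<close>

lemma decomposition_arith:
  fixes g H V Fb Ei Ec B :: real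
  assumes g: "0 \<le> g" "g \<le> 1" and H: "0 \<le> H" "H \<le> 1" and "0 \<le> Ei"
    and V: "g * V \<le> Ei" and Fb: "H * Fb \<le> B / 4"
    and B: "g * B \<le> 8 * Ec + 8 * g / (4 - g) * (2 * V - Ei)"
  shows "H * g * (V + Fb) \<le> 2 * (Ei + Ec)"
proof -
  have "H * (g * V) \<le> Ei"
    using V H \<open>0 \<le> Ei\<close> mult_left_mono[OF V H(1)] mult_right_mono[OF H(2) \<open>0 \<le> Ei\<close>] by linarith
  moreover have "g * (H * Fb) \<le> g * B / 4"
    using mult_left_mono[OF Fb g(1)] by simp
  moreover have "8 * g / (4 - g) * (2 * V - Ei) \<le> 4 * Ei"
  proof -
    have "8 * g * (2 * V - Ei) = 16 * (g * V) - 8 * (g * Ei)" by (simp add: algebra_simps)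
    also have "\<dots> \<le> 16 * Ei - 4 * (g * Ei)"
      using V mult_nonneg_nonneg[OF g(1) \<open>0 \<le> Ei\<close>] by linarith
    also have "\<dots> = (4 * Ei) * (4 - g)" by (simp add: algebra_simps)
    finally show ?thesis using g by (simp add: field_simps)
  qed
  ultimately show ?thesis using B by (simp add: algebra_simps)
qed

section \<open>Flows between blocks and the block chain\<close>

locale partitioned_kernel = reversible_kernel N K
  for N :: "'a measure" and K +
  fixes A :: "nat \<Rightarrow> 'a set" and m :: nat
  assumes A_sets: "\<And>i. i \<in> {1..m} \<Longrightarrow> A i \<in> sets N"
    and A_disjoint: "disjoint_family_on A {1..m}"
    and A_cover: "(\<Union>i\<in>{1..m}. A i) = space N"
    and A_pos: "\<And>i. i \<in> {1..m} \<Longrightarrow> 0 < measure N (A i)"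
begin

abbreviation block_weight :: "nat \<Rightarrow> real" where
  "block_weight i \<equiv> measure N (A i)"

lemma sum_indicator_block: "i \<in> {1..m} \<Longrightarrow> x \<in> A i \<Longrightarrow> (\<Sum>j\<in>{1..m}. indicator (A j) x * c j) = (c i :: real)"
  by (rule sum_indicator_partition) (use A_disjoint in auto)

lemma block_cases:
  assumes "x \<in> space N"
  obtains i where "i \<in> {1..m}" "x \<in> A i"
  using assms A_cover by blast

lemma measure_joint_commute:
  assumes "B \<in> sets N" "C \<in> sets N"
  shows "measure joint (B \<times> C) = measure joint (C \<times> B)"
  using assms reversible by (simp add: measure_def emeasure_joint_times)

lemma flow_eq:
  assumes "i \<in> {1..m}" "j \<in> {1..m}"
  shows "block_weight i * flow N K A i j = measure joint (A i \<times> A j) / 2"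
proof -
  have [measurable]: "A i \<in> sets N" "A j \<in> sets N" using A_sets assms by auto
  have m: "(\<lambda>x. measure (K x) (A j)) \<in> borel_measurable N"
    by (rule measurable_compose[OF kernel_subprob measurable_measure_subprob_algebra]) simp
  have fin: "emeasure (K x) (A j) = ennreal (measure (K x) (A j))" if "x \<in> space N" for x
  proof -
    interpret Kx: prob_space "K x" using that by (rule prob_space_kernel)
    show ?thesis by (rule Kx.emeasure_eq_measure)
  qed
  have "(\<integral>x\<in>A i. measure (K x) (A j) \<partial>N) = enn2real (\<integral>\<^sup>+x. ennreal (indicator (A i) x * measure (K x) (A j)) \<partial>N)"
    unfolding set_lebesgue_integral_def using m by (subst integral_eq_nn_integral) auto
  also have "(\<integral>\<^sup>+x. ennreal (indicator (A i) x * measure (K x) (A j)) \<partial>N)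
      = (\<integral>\<^sup>+x\<in>A i. emeasure (K x) (A j) \<partial>N)"
    using fin by (intro nn_integral_cong) (auto split: split_indicator)
  finally have "(\<integral>x\<in>A i. measure (K x) (A j) \<partial>N) = measure joint (A i \<times> A j)"
    by (simp add: measure_def emeasure_joint_times)
  then show ?thesis using A_pos[OF assms(1)] by (simp add: flow_def)
qed

lemma flow_nonneg: "0 \<le> flow N K A i j"
  unfolding flow_def set_lebesgue_integral_def by (auto intro!: mult_nonneg_nonneg Bochner_Integration.integral_nonneg)

text \<open>The rectangles \<open>A i \<times> A l\<close> are disjoint parts of a set of joint mass
  \<open>block_weight i\<close>. This makes the diagonal of \<open>P_H\<close> nonnegative; owing to
  the halved flows the sum is even at most 1/2.\<close>

lemma sum_flow_le:
  assumes i: "i \<in> {1..m}"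
  shows "(\<Sum>l\<in>{1..m} - {i}. flow N K A i l) \<le> 1"
proof -
  have "block_weight i * (\<Sum>l\<in>{1..m} - {i}. flow N K A i l)
      = (\<Sum>l\<in>{1..m} - {i}. measure joint (A i \<times> A l)) / 2"
    using i by (simp add: sum_distrib_left sum_divide_distrib flow_eq)
  also have "(\<Sum>l\<in>{1..m} - {i}. measure joint (A i \<times> A l))
      = measure joint (\<Union>l\<in>{1..m} - {i}. A i \<times> A l)"
  proof (rule joint.finite_measure_finite_Union[symmetric])
    show "(\<lambda>l. A i \<times> A l) ` ({1..m} - {i}) \<subseteq> sets joint"
      using i A_sets by (auto simp: sets_joint)
    show "disjoint_family_on (\<lambda>l. A i \<times> A l) ({1..m} - {i})"
      using A_disjoint by (auto simp: disjoint_family_on_def)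
  qed simp
  also have "\<dots> \<le> measure joint (A i \<times> space N)"
    using i A_sets A_cover
    by (intro joint.finite_measure_mono) (auto simp: sets_joint simp del: atLeastAtMost_iff)
  also have "\<dots> = measure (distr joint N fst) (A i)"
  proof (subst measure_distr)
    show "measure joint (A i \<times> space N) = measure joint (fst -` A i \<inter> space joint)"
      using sets.sets_into_space[OF A_sets[OF i]]
      by (auto simp: space_joint intro!: arg_cong[where f="measure joint"])
  qed (use i A_sets in auto)
  also have "\<dots> = block_weight i" by (simp add: distr_joint_fst)
  finally have "block_weight i * (\<Sum>l\<in>{1..m} - {i}. flow N K A i l) \<le> block_weight i * (1/2)"
    by simp
  then show ?thesis using A_pos[OF i] by simp
qed

lemma P_H_nonneg: "i \<in> {1..m} \<Longrightarrow> 0 \<le> P_H N K A m i j"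
  using sum_flow_le flow_nonneg by (simp add: P_H_def)

lemma P_H_sum: "i \<in> {1..m} \<Longrightarrow> (\<Sum>j\<in>{1..m}. P_H N K A m i j) = 1"
  by (subst sum.remove[of _ i]) (auto simp: P_H_def intro!: sum.cong)

lemma P_H_eq: "i \<in> {1..m} \<Longrightarrow> j \<in> {1..m} \<Longrightarrow> i \<noteq> j \<Longrightarrow>
    block_weight i * P_H N K A m i j = measure joint (A i \<times> A j) / 2"
  by (simp add: P_H_def flow_eq del: atLeastAtMost_iff)

lemma reversible_kernel_P_H:
  "reversible_kernel (vector_measure m block_weight) (matrix_kernel m (P_H N K A m))"
proof (rule reversible_kernel_matrix)
  show "(\<Sum>i\<in>{1..m}. block_weight i) = 1"
    using finite_measure_finite_Union[of "{1..m}" A, OF _ _ A_disjoint] A_sets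
    unfolding A_cover prob_space by (simp add: image_subset_iff)
  show "block_weight i * P_H N K A m i j = block_weight j * P_H N K A m j i"
    if "i \<in> {1..m}" "j \<in> {1..m}" for i j
    using that P_H_eq[of i j] P_H_eq[of j i] measure_joint_commute[of "A i" "A j"] A_sets
    by (cases "i = j") auto
qed (use P_H_nonneg P_H_sum in auto)

section \<open>Block averages and deviations\<close>

definition block_mean :: "('a \<Rightarrow> real) \<Rightarrow> nat \<Rightarrow> real" where
  "block_mean f i = (\<integral>x. f x \<partial>cond_measure N (A i))"

text \<open>The conditional expectation of \<open>f\<close> given the partition. As a finite
  combination of indicators it is square-integrable for every \<open>f\<close>.\<close>

definition block_average :: "('a \<Rightarrow> real) \<Rightarrow> 'a \<Rightarrow> real" where
  "block_average f x = (\<Sum>i\<in>{1..m}. indicator (A i) x * block_mean f i)"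

lemma block_average_eq: "i \<in> {1..m} \<Longrightarrow> x \<in> A i \<Longrightarrow> block_average f x = block_mean f i"
  unfolding block_average_def by (rule sum_indicator_block)

lemma block_mean_weight:
  assumes "i \<in> {1..m}" "integrable N f"
  shows "block_weight i * block_mean f i = (\<integral>x. indicator (A i) x * f x \<partial>N)"
  using assms A_sets A_pos[OF assms(1)] by (simp add: block_mean_def integral_cond_measure)

lemma block_average_L2: "block_average f \<in> L2_fun N"
proof -
  have 1: "(\<lambda>x. \<Sum>i\<in>J. indicator (A i) x * block_mean f i) \<in> L2_fun N" if "J \<subseteq> {1..m}" for J
    using finite_subset[OF that finite_atLeastAtMost] that
  proof (induction J rule: finite_induct)
    case empty
    then show ?case by (simp add: L2_fun_const)
  next
    case (insert i J)
    have "A i \<in> sets N" using insert A_sets by auto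
    then have "(\<lambda>x. indicator (A i) x) \<in> L2_fun N"
      by (auto simp: L2_fun_def)
         (auto intro!: integrable_const_bound[of _ 1] simp: indicator_def)
    from L2_fun_add[OF L2_fun_cmult[OF this, of "block_mean f i"] insert.IH] insert.prems
    have "(\<lambda>x. block_mean f i * indicator (A i) x + (\<Sum>i\<in>J. indicator (A i) x * block_mean f i)) \<in> L2_fun N"
      by (simp only: insert_subset simp_thms)
    moreover have "(\<lambda>x. block_mean f i * indicator (A i) x + (\<Sum>i\<in>J. indicator (A i) x * block_mean f i))
        = (\<lambda>x. \<Sum>i\<in>insert i J. indicator (A i) x * block_mean f i)"
      unfolding sum.insert[OF insert.hyps] by (simp only: mult.commute)
    ultimately show ?case using insert.prems by (simp only: insert_subset)
  qed
  show ?thesis using 1[OF subset_refl] by (simp only: block_average_def[abs_def])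
qed

lemma integral_split_blocks:
  fixes u :: "'a \<Rightarrow> real"
  assumes "integrable N u"
  shows "(\<integral>x. u x \<partial>N) = (\<Sum>i\<in>{1..m}. \<integral>x. indicator (A i) x * u x \<partial>N)"
proof -
  have i: "integrable N (\<lambda>x. indicator (A i) x * u x)" if "i \<in> {1..m}" for i
    using integrable_mult_indicator[OF A_sets[OF that] assms] by simp
  have "(\<integral>x. u x \<partial>N) = (\<integral>x. (\<Sum>i\<in>{1..m}. indicator (A i) x * u x) \<partial>N)"
  proof (rule Bochner_Integration.integral_cong[OF refl])
    fix x assume "x \<in> space N"
    then obtain i where "i \<in> {1..m}" "x \<in> A i" by (rule block_cases)
    then show "u x = (\<Sum>i\<in>{1..m}. indicator (A i) x * u x)"
      by (simp only: sum_indicator_block)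
  qed
  also have "\<dots> = (\<Sum>i\<in>{1..m}. \<integral>x. indicator (A i) x * u x \<partial>N)"
    using i by (intro Bochner_Integration.integral_sum)
  finally show ?thesis .
qed

lemma integral_block_deviation:
  assumes "f \<in> L2_fun N" "i \<in> {1..m}"
  shows "(\<integral>x. indicator (A i) x * (f x - block_average f x) \<partial>N) = 0"
proof -
  have i: "integrable N f" using assms by (intro L2_fun_integrable)
  have ii: "integrable N (\<lambda>x. indicator (A i) x * f x)" "integrable N (indicator (A i) :: _ \<Rightarrow> real)"
    using integrable_mult_indicator[OF A_sets[OF assms(2)] i] A_sets[OF assms(2)]
    by (auto intro!: integrable_const_bound[of _ 1] simp: indicator_def)
  have "(\<integral>x. indicator (A i) x * (f x - block_average f x) \<partial>N)
      = (\<integral>x. indicator (A i) x * f x - indicator (A i) x * block_mean f i \<partial>N)"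
    using block_average_eq[OF assms(2)]
    by (intro Bochner_Integration.integral_cong) (auto simp: indicator_def)
  also have "\<dots> = 0"
    using ii block_mean_weight[OF assms(2) i] A_sets[OF assms(2)] by (simp add: mult.commute)
  finally show ?thesis .
qed

text \<open>On each block the average is constant and the deviation has mean zero, so the two are
  orthogonal.\<close>

lemma pythagoras_blocks:
  assumes f: "f \<in> L2_fun N"
  shows "(\<integral>x. (f x)\<^sup>2 \<partial>N)
    = (\<integral>x. (f x - block_average f x)\<^sup>2 \<partial>N) + (\<integral>x. (block_average f x)\<^sup>2 \<partial>N)"
proof -
  let ?h = "\<lambda>x. f x - block_average f x"
  have h: "?h \<in> L2_fun N" using f block_average_L2 by (rule L2_fun_diff)
  note i = integrable_mult_L2_fun[OF h block_average_L2[of f]]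
  have "(\<integral>x. ?h x * block_average f x \<partial>N)
     = (\<Sum>i\<in>{1..m}. \<integral>x. indicator (A i) x * (?h x * block_average f x) \<partial>N)"
    using i by (rule integral_split_blocks)
  also have "\<dots> = (\<Sum>i\<in>{1..m}. \<integral>x. block_mean f i * (indicator (A i) x * ?h x) \<partial>N)"
    using block_average_eq
    by (intro sum.cong refl Bochner_Integration.integral_cong)
       (auto simp: indicator_def simp del: atLeastAtMost_iff)
  also have "\<dots> = 0"
    using integral_block_deviation[OF f] by (intro sum.neutral) simp
  finally have "(\<integral>x. ?h x * block_average f x \<partial>N) = 0" .
  moreover have "(\<integral>x. (f x)\<^sup>2 \<partial>N)
     = (\<integral>x. (?h x)\<^sup>2 + 2 * (?h x * block_average f x) + (block_average f x)\<^sup>2 \<partial>N)"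
    by (intro Bochner_Integration.integral_cong refl) (simp add: power2_eq_square algebra_simps)
  ultimately show ?thesis
    using i L2_fun_integrable_square[OF h] L2_fun_integrable_square[OF block_average_L2[of f]]
    by simp
qed

text \<open>The indicator of pairs lying in one common block; the form as a sum lets integrals split
  over the blocks.\<close>

definition same_block :: "'a \<times> 'a \<Rightarrow> real" where
  "same_block z = (\<Sum>i\<in>{1..m}. indicator (A i \<times> A i) z)"

lemma same_block_eq:
  assumes "i \<in> {1..m}" "j \<in> {1..m}" "x \<in> A i" "y \<in> A j"
  shows "same_block (x, y) = (if i = j then 1 else 0)"
proof -
  have "same_block (x, y) = (\<Sum>l\<in>{1..m}. indicator (A l) x * indicator (A l) y)"
    by (simp add: same_block_def indicator_times)
  also have "\<dots> = indicator (A i) y"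
    using assms(1,3) by (rule sum_indicator_block)
  also have "\<dots> = (if i = j then 1 else 0)"
    using assms disjoint_family_onD[OF A_disjoint assms(1,2)] by (auto simp: indicator_def)
  finally show ?thesis .
qed

lemma integral_same_block:
  fixes u :: "'a \<times> 'a \<Rightarrow> real"
  assumes "integrable joint u"
  shows "integrable joint (\<lambda>z. same_block z * u z)"
    and "(\<integral>z. same_block z * u z \<partial>joint) = (\<Sum>i\<in>{1..m}. \<integral>z. indicator (A i \<times> A i) z * u z \<partial>joint)"
proof -
  have i: "integrable joint (\<lambda>z. indicator (A i \<times> A i) z * u z)" if "i \<in> {1..m}" for i
    using integrable_mult_indicator[OF _ assms, of "A i \<times> A i"] A_sets[OF that] by (simp add: sets_joint)
  show "integrable joint (\<lambda>z. same_block z * u z)"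
    unfolding same_block_def sum_distrib_right using i by (intro Bochner_Integration.integrable_sum)
  show "(\<integral>z. same_block z * u z \<partial>joint) = (\<Sum>i\<in>{1..m}. \<integral>z. indicator (A i \<times> A i) z * u z \<partial>joint)"
    unfolding same_block_def sum_distrib_right using i by (intro Bochner_Integration.integral_sum)
qed

lemma L2_fun_joint_diff: "f \<in> L2_fun N \<Longrightarrow> integrable joint (\<lambda>z. (f (fst z) - f (snd z))\<^sup>2)"
  by (intro L2_fun_integrable_square L2_fun_diff L2_fun_joint)

text \<open>Inside a block \<open>f\<close> minus its average is \<open>f\<close> centred for the
  conditioned measure, so the Poincare inequality of the restricted chain applies. The normalizing
  weights cancel and the blocks add up.\<close>

lemma restricted_gap_le:
  assumes f: "f \<in> L2_fun N"
    and g: "\<And>i. i \<in> {1..m} \<Longrightarrow> g \<le> Gap (cond_measure N (A i)) (restricted_kernel N K (A i))"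
  shows "g * (\<integral>x. (f x - block_average f x)\<^sup>2 \<partial>N)
    \<le> (\<integral>z. same_block z * (f (fst z) - f (snd z))\<^sup>2 \<partial>joint) / 2"
proof -
  let ?h = "\<lambda>x. f x - block_average f x"
  have h: "?h \<in> L2_fun N" using f block_average_L2 by (rule L2_fun_diff)
  have le: "g * (\<integral>x. indicator (A i) x * (?h x)\<^sup>2 \<partial>N)
      \<le> (\<integral>z. indicator (A i \<times> A i) z * (f (fst z) - f (snd z))\<^sup>2 \<partial>joint) / 2" if i: "i \<in> {1..m}" for i
  proof -
    note Ai = A_sets[OF i] A_pos[OF i]
    interpret R: reversible_kernel "cond_measure N (A i)" "restricted_kernel N K (A i)"
      using Ai by (rule reversible_kernel_restricted)
    have fi: "f \<in> L2_fun (cond_measure N (A i))"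
      using f Ai by (auto simp: L2_fun_def integral_cond_measure measurable_cond_measure)
    have fm: "(\<lambda>x. f x - block_mean f i) \<in> L2_fun N"
      using f L2_fun_const by (rule L2_fun_diff)
    have "(\<integral>x. (f x - block_mean f i)\<^sup>2 \<partial>cond_measure N (A i))
       = (\<integral>x. indicator (A i) x * (f x - block_mean f i)\<^sup>2 \<partial>N) / block_weight i"
      using Ai L2_fun_integrable_square[OF fm] by (rule integral_cond_measure)
    also have "(\<integral>x. indicator (A i) x * (f x - block_mean f i)\<^sup>2 \<partial>N)
        = (\<integral>x. indicator (A i) x * (?h x)\<^sup>2 \<partial>N)"
      using block_average_eq[OF i] by (intro Bochner_Integration.integral_cong) (auto simp: indicator_def)
    finally have v: "(\<integral>x. (f x - block_mean f i)\<^sup>2 \<partial>cond_measure N (A i))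
        = (\<integral>x. indicator (A i) x * (?h x)\<^sup>2 \<partial>N) / block_weight i" .
    have "g * (\<integral>x. (f x - block_mean f i)\<^sup>2 \<partial>cond_measure N (A i)) \<le> R.energy f"
    proof (rule order_trans)
      show "g * (\<integral>x. (f x - block_mean f i)\<^sup>2 \<partial>cond_measure N (A i))
        \<le> Gap (cond_measure N (A i)) (restricted_kernel N K (A i))
          * (\<integral>x. (f x - block_mean f i)\<^sup>2 \<partial>cond_measure N (A i))"
        using g[OF i] by (intro mult_right_mono) simp_all
    qed (unfold block_mean_def, rule R.Gap_le_energy[OF fi])
    then show ?thesis
      using Ai f unfolding v energy_restricted[OF Ai L2_funD[OF f]]
      by (simp add: field_simps)
  qed
  have "g * (\<integral>x. (?h x)\<^sup>2 \<partial>N) = (\<Sum>i\<in>{1..m}. g * (\<integral>x. indicator (A i) x * (?h x)\<^sup>2 \<partial>N))"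
    using integral_split_blocks[OF L2_fun_integrable_square[OF h]] by (simp add: sum_distrib_left)
  also have "\<dots> \<le> (\<Sum>i\<in>{1..m}. (\<integral>z. indicator (A i \<times> A i) z * (f (fst z) - f (snd z))\<^sup>2 \<partial>joint) / 2)"
    using le by (intro sum_mono)
  also have "\<dots> = (\<integral>z. same_block z * (f (fst z) - f (snd z))\<^sup>2 \<partial>joint) / 2"
    using integral_same_block(2)[OF L2_fun_joint_diff[OF f]] by (simp add: sum_divide_distrib)
  finally show ?thesis .
qed

text \<open>The block means, viewed as a function of the index, have mean zero for the block
  weights, so the Poincare inequality of the block chain applies. The 4 is one factor 2 from the
  energy and one from the halved flows.\<close>

lemma block_gap_le:
  assumes f: "f \<in> L2_zero N"
  shows "Gap (vector_measure m block_weight) (matrix_kernel m (P_H N K A m)) * (\<integral>x. (block_average f x)\<^sup>2 \<partial>N)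
    \<le> (\<integral>z. (block_average f (fst z) - block_average f (snd z))\<^sup>2 \<partial>joint) / 4"
proof -
  interpret H: reversible_kernel "vector_measure m block_weight" "matrix_kernel m (P_H N K A m)"
    by (rule reversible_kernel_P_H)
  let ?v = "vector_measure m block_weight" and ?\<mu> = "block_mean f"
  have f': "f \<in> L2_fun N" and fi: "integrable N f"
    using f by (auto simp: L2_zero_iff L2_fun_integrable)
  have iv: "(\<integral>i. u i \<partial>?v) = (\<Sum>i\<in>{1..m}. block_weight i * u i)" for u :: "nat \<Rightarrow> real"
    unfolding vector_measure_def by (subst lebesgue_integral_point_measure_finite) auto
  have \<mu>0: "?\<mu> \<in> L2_zero ?v"
  proof -
    have "(\<integral>i. ?\<mu> i \<partial>?v) = (\<integral>x. f x \<partial>N)"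
      using fi by (simp add: iv block_mean_weight integral_split_blocks[OF fi] del: atLeastAtMost_iff)
    moreover have "integrable ?v (\<lambda>i. (?\<mu> i)\<^sup>2)"
      unfolding vector_measure_def by (rule integrable_point_measure_finite) auto
    ultimately show ?thesis
      using f by (auto simp: L2_zero_iff L2_fun_def) (simp add: vector_measure_def)
  qed
  have b2: "(\<integral>x. (block_average f x)\<^sup>2 \<partial>N) = (\<integral>i. (?\<mu> i)\<^sup>2 \<partial>?v)"
  proof -
    have "(\<integral>x. (block_average f x)\<^sup>2 \<partial>N)
       = (\<Sum>i\<in>{1..m}. \<integral>x. indicator (A i) x * (block_average f x)\<^sup>2 \<partial>N)"
      by (intro integral_split_blocks L2_fun_integrable_square block_average_L2)
    also have "\<dots> = (\<Sum>i\<in>{1..m}. \<integral>x. indicator (A i) x * (?\<mu> i)\<^sup>2 \<partial>N)"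
      using block_average_eq by (intro sum.cong refl Bochner_Integration.integral_cong)
         (auto simp: indicator_def simp del: atLeastAtMost_iff)
    also have "\<dots> = (\<Sum>i\<in>{1..m}. block_weight i * (?\<mu> i)\<^sup>2)"
      using A_sets sets.sets_into_space by (intro sum.cong refl) (simp add: Int_absorb2 del: atLeastAtMost_iff)
    finally show ?thesis by (simp add: iv)
  qed
  have "(\<integral>z. (block_average f (fst z) - block_average f (snd z))\<^sup>2 \<partial>joint)
     = (\<integral>z. (\<Sum>i\<in>{1..m}. \<Sum>j\<in>{1..m}. indicator (A i \<times> A j) z * (?\<mu> i - ?\<mu> j)\<^sup>2) \<partial>joint)"
  proof (rule Bochner_Integration.integral_cong[OF refl])
    fix z assume "z \<in> space joint"
    then obtain i j where ij: "i \<in> {1..m}" "j \<in> {1..m}" "fst z \<in> A i" "snd z \<in> A j"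
      by (auto simp: space_joint elim!: block_cases)
    have "(\<Sum>i\<in>{1..m}. \<Sum>j\<in>{1..m}. indicator (A i \<times> A j) z * (?\<mu> i - ?\<mu> j)\<^sup>2)
       = (\<Sum>i\<in>{1..m}. indicator (A i) (fst z) * (\<Sum>j\<in>{1..m}. indicator (A j) (snd z) * (?\<mu> i - ?\<mu> j)\<^sup>2))"
      by (cases z) (simp only: indicator_times sum_distrib_left mult.assoc fst_conv snd_conv)
    also have "\<dots> = (?\<mu> i - ?\<mu> j)\<^sup>2"
      using ij by (simp only: sum_indicator_block)
    finally show "(block_average f (fst z) - block_average f (snd z))\<^sup>2
       = (\<Sum>i\<in>{1..m}. \<Sum>j\<in>{1..m}. indicator (A i \<times> A j) z * (?\<mu> i - ?\<mu> j)\<^sup>2)"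
      using block_average_eq[OF ij(1,3)] block_average_eq[OF ij(2,4)] by simp
  qed
  also have "\<dots> = (\<Sum>i\<in>{1..m}. \<Sum>j\<in>{1..m}. measure joint (A i \<times> A j) * (?\<mu> i - ?\<mu> j)\<^sup>2)"
  proof -
    have m: "A i \<times> A j \<in> sets joint" if "i \<in> {1..m}" "j \<in> {1..m}" for i j
      using A_sets that by (simp add: sets_joint)
    have i: "integrable joint (\<lambda>z. indicator (A i \<times> A j) z * (?\<mu> i - ?\<mu> j)\<^sup>2)"
      if "i \<in> {1..m}" "j \<in> {1..m}" for i j
      using m[OF that]
      by (intro integrable_mult_left) (auto intro!: joint.integrable_const_bound[of _ 1] simp: indicator_def)
    have "(\<integral>z. (\<Sum>i\<in>{1..m}. \<Sum>j\<in>{1..m}. indicator (A i \<times> A j) z * (?\<mu> i - ?\<mu> j)\<^sup>2) \<partial>joint)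
        = (\<Sum>i\<in>{1..m}. \<integral>z. (\<Sum>j\<in>{1..m}. indicator (A i \<times> A j) z * (?\<mu> i - ?\<mu> j)\<^sup>2) \<partial>joint)"
      by (intro Bochner_Integration.integral_sum Bochner_Integration.integrable_sum i)
    also have "\<dots> = (\<Sum>i\<in>{1..m}. \<Sum>j\<in>{1..m}. \<integral>z. indicator (A i \<times> A j) z * (?\<mu> i - ?\<mu> j)\<^sup>2 \<partial>joint)"
      by (intro sum.cong refl Bochner_Integration.integral_sum i)
    also have "\<dots> = (\<Sum>i\<in>{1..m}. \<Sum>j\<in>{1..m}. measure joint (A i \<times> A j) * (?\<mu> i - ?\<mu> j)\<^sup>2)"
    proof (intro sum.cong refl)
      fix i j assume ij: "i \<in> {1..m}" "j \<in> {1..m}"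
      show "(\<integral>z. indicator (A i \<times> A j) z * (?\<mu> i - ?\<mu> j)\<^sup>2 \<partial>joint)
        = measure joint (A i \<times> A j) * (?\<mu> i - ?\<mu> j)\<^sup>2"
        using sets.sets_into_space[OF m[OF ij]] by (simp add: Int_absorb2)
    qed
    finally show ?thesis .
  qed
  also have "\<dots> = (\<Sum>i\<in>{1..m}. \<Sum>j\<in>{1..m}. 2 * (block_weight i * P_H N K A m i j * (?\<mu> i - ?\<mu> j)\<^sup>2))"
  proof (intro sum.cong refl)
    fix i j assume "i \<in> {1..m}" "j \<in> {1..m}"
    then show "measure joint (A i \<times> A j) * (?\<mu> i - ?\<mu> j)\<^sup>2
        = 2 * (block_weight i * P_H N K A m i j * (?\<mu> i - ?\<mu> j)\<^sup>2)"
      using P_H_eq[of i j] by (cases "i = j") simp_all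
  qed
  also have "\<dots> = 4 * H.energy ?\<mu>"
    by (subst energy_matrix[OF reversible_kernel_P_H]) (auto simp: P_H_nonneg sum_distrib_left[symmetric])
  finally show ?thesis
    using H.Gap_le_energy_zero[OF \<mu>0] b2 by simp
qed

theorem decomposition_energy:
  assumes f: "f \<in> L2_zero N"
    and g: "\<And>i. i \<in> {1..m} \<Longrightarrow> g \<le> Gap (cond_measure N (A i)) (restricted_kernel N K (A i))"
      "0 \<le> g" "g \<le> 1"
  shows "Gap (vector_measure m block_weight) (matrix_kernel m (P_H N K A m)) * g * (\<integral>x. (f x)\<^sup>2 \<partial>N)
    \<le> 2 * energy f"
proof -
  interpret H: reversible_kernel "vector_measure m block_weight" "matrix_kernel m (P_H N K A m)"
    by (rule reversible_kernel_P_H)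
  let ?b = "block_average f" and ?h = "\<lambda>x. f x - block_average f x"
  have f': "f \<in> L2_fun N" using f by (simp add: L2_zero_iff)
  have h: "?h \<in> L2_fun N" using f' block_average_L2 by (rule L2_fun_diff)
  let ?df = "\<lambda>z. (f (fst z) - f (snd z))\<^sup>2" and ?db = "\<lambda>z. (?b (fst z) - ?b (snd z))\<^sup>2"
    and ?hh = "\<lambda>z. (?h (fst z))\<^sup>2 + (?h (snd z))\<^sup>2"
  define V where "V = (\<integral>x. (?h x)\<^sup>2 \<partial>N)"
  define Ei where "Ei = (\<integral>z. same_block z * ?df z \<partial>joint) / 2"
  define Ec where "Ec = energy f - Ei"
  have idf: "integrable joint ?df" and idb: "integrable joint ?db"
    using f' block_average_L2 by (auto intro: L2_fun_joint_diff)
  have ihh: "integrable joint ?hh"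
    using L2_fun_joint[OF h] by (auto dest: L2_fun_integrable_square)
  have hh: "(\<integral>z. ?hh z \<partial>joint) = 2 * V"
  proof -
    have m: "(\<lambda>x. (?h x)\<^sup>2) \<in> borel_measurable N" using L2_funD[OF h] by measurable
    show ?thesis
      using L2_fun_joint[OF h, THEN L2_fun_integrable_square] integral_joint_fst[OF m] integral_joint_snd[OF m]
      by (simp add: V_def)
  qed
  note s = integral_same_block(1)[OF idf] integral_same_block(1)[OF ihh]
  \<comment> \<open>On a pair in one block the averages cancel and the difference of
    \<open>f\<close> is that of the deviations. So at least Ei of the total mass 2 V of
    \<open>?hh\<close> sits on such pairs and is not charged across blocks.\<close>
  have same: "2 * Ei \<le> 2 * (\<integral>z. same_block z * ?hh z \<partial>joint)"
  proof -
    have "(\<integral>z. same_block z * ?df z \<partial>joint) \<le> (\<integral>z. 2 * (same_block z * ?hh z) \<partial>joint)"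
    proof (rule integral_mono)
      fix z assume "z \<in> space joint"
      then obtain i j where ij: "i \<in> {1..m}" "j \<in> {1..m}" "fst z \<in> A i" "snd z \<in> A j"
        by (auto simp: space_joint elim!: block_cases)
      show "same_block z * ?df z \<le> 2 * (same_block z * ?hh z)"
        using same_block_eq[OF ij] block_average_eq[OF ij(1,3)] block_average_eq[OF ij(2,4)]
          square_diff_le_double[of "?h (fst z)" "?h (snd z)"]
        by (cases "i = j") auto
    qed (use s in auto)
    then show ?thesis by (simp add: Ei_def)
  qed
  define r where "r = 4 * g / (4 - g)"
  have r: "0 \<le> r" using g by (simp add: r_def)
  have cross: "g * (\<integral>z. ?db z \<partial>joint) \<le> 8 * Ec + 2 * r * (2 * V - (\<integral>z. same_block z * ?hh z \<partial>joint))"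
  proof -
    have "(\<integral>z. g * ?db z \<partial>joint)
      \<le> (\<integral>z. 4 * (?df z - same_block z * ?df z) + 2 * r * (?hh z - same_block z * ?hh z) \<partial>joint)"
    proof (rule integral_mono)
      fix z assume "z \<in> space joint"
      then obtain i j where ij: "i \<in> {1..m}" "j \<in> {1..m}" "fst z \<in> A i" "snd z \<in> A j"
        by (auto simp: space_joint elim!: block_cases)
      show "g * ?db z \<le> 4 * (?df z - same_block z * ?df z) + 2 * r * (?hh z - same_block z * ?hh z)"
      proof (cases "i = j")
        case True
        then show ?thesis
          using same_block_eq[OF ij] block_average_eq[OF ij(1,3)] block_average_eq[OF ij(2,4)] by simp
      next
        case False
        let ?a = "f (fst z) - f (snd z)" and ?c = "?h (fst z) - ?h (snd z)"
        have "g * ?db z = g * (?a - ?c)\<^sup>2" by simp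
        also have "\<dots> \<le> 4 * ?a\<^sup>2 + r * ?c\<^sup>2"
          unfolding r_def using g by (intro weighted_square_diff_le) auto
        also have "\<dots> \<le> 4 * ?a\<^sup>2 + r * (2 * ?hh z)"
          by (intro add_left_mono mult_left_mono square_diff_le_double r)
        finally show ?thesis using same_block_eq[OF ij] False by (simp add: algebra_simps)
      qed
    qed (use idb idf ihh s in auto)
    also have "\<dots> = 4 * (2 * energy f - 2 * Ei) + 2 * r * (2 * V - (\<integral>z. same_block z * ?hh z \<partial>joint))"
    proof -
      have lin: "(\<integral>z. 4 * (a z - b z) + q * (c z - d z) \<partial>joint)
          = 4 * ((\<integral>z. a z \<partial>joint) - (\<integral>z. b z \<partial>joint)) + q * ((\<integral>z. c z \<partial>joint) - (\<integral>z. d z \<partial>joint))"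
        if "integrable joint a" "integrable joint b" "integrable joint c" "integrable joint d"
        for a b c d :: "'a \<times> 'a \<Rightarrow> real" and q
        using that by simp
      show ?thesis
        unfolding lin[OF idf s(1) ihh s(2)] hh by (simp add: energy_def Ei_def)
    qed
    finally show ?thesis by (simp add: Ec_def)
  qed
  have "2 * r * (2 * V - (\<integral>z. same_block z * ?hh z \<partial>joint)) \<le> 2 * r * (2 * V - Ei)"
    using same r by (intro mult_left_mono) auto
  with cross have B: "g * (\<integral>z. ?db z \<partial>joint) \<le> 8 * Ec + 8 * g / (4 - g) * (2 * V - Ei)"
    by (simp add: r_def)
  have "Gap (vector_measure m block_weight) (matrix_kernel m (P_H N K A m)) * g * (V + (\<integral>x. (?b x)\<^sup>2 \<partial>N))
      \<le> 2 * (Ei + Ec)"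
  proof (rule decomposition_arith[OF g(2,3) H.Gap_nonneg H.Gap_le_1 _ _ block_gap_le[OF f] B])
    show "g * V \<le> Ei"
      unfolding V_def Ei_def using f' g(1) by (rule restricted_gap_le)
    show "0 \<le> Ei"
      unfolding Ei_def same_block_def
      by (intro divide_nonneg_nonneg Bochner_Integration.integral_nonneg mult_nonneg_nonneg sum_nonneg) auto
  qed
  then show ?thesis
    using pythagoras_blocks[OF f'] by (simp add: V_def Ec_def)
qed

end

section \<open>The Metropolis--Hastings kernel\<close>

text \<open>The rejection part of the Metropolis--Hastings kernel is an atom at the current state;
  induction over measurable functions carries the formula from sets to integrals.\<close>

lemma nn_integral_plus_point_mass:
  assumes f: "f \<in> borel_measurable M" and sets: "sets N = sets M" and x: "x \<in> space M"
    and em: "\<And>B. B \<in> sets M \<Longrightarrow> emeasure N B = emeasure M B + c * indicator B x"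
  shows "(\<integral>\<^sup>+y. f y \<partial>N) = (\<integral>\<^sup>+y. f y \<partial>M) + c * f x"
  using f
proof (induction rule: borel_measurable_induct)
  case (cong f g)
  have "integral\<^sup>N N f = integral\<^sup>N N g"
    using cong sets_eq_imp_space_eq[OF sets] by (intro nn_integral_cong) auto
  moreover have "integral\<^sup>N M f = integral\<^sup>N M g"
    using cong by (intro nn_integral_cong) auto
  ultimately show ?case using cong x by simp
next
  case (set A)
  then show ?case using sets em by simp
next
  case (mult u a)
  have [measurable]: "u \<in> borel_measurable N" "u \<in> borel_measurable M"
    using mult by (auto simp: measurable_cong_sets[OF sets refl])
  show ?case using mult by (simp add: nn_integral_cmult distrib_left mult.left_commute)
next
  case (add u v)
  have [measurable]: "u \<in> borel_measurable N" "v \<in> borel_measurable N"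
    using add by (auto simp: measurable_cong_sets[OF sets refl])
  show ?case using add by (simp add: nn_integral_add distrib_left add_ac)
next
  case (seq U)
  have m: "U i \<in> borel_measurable N" for i
    using seq by (auto simp: measurable_cong_sets[OF sets refl])
  have inc: "incseq (\<lambda>i. integral\<^sup>N M (U i))" "incseq (\<lambda>i. c * U i x)"
    using seq(3) by (auto simp: incseq_def le_fun_def intro!: nn_integral_mono mult_left_mono)
  have sup: "(SUP i. U i) = (\<lambda>y. SUP i. U i y)"
    by (simp add: fun_eq_iff image_image)
  have "(\<integral>\<^sup>+y. (SUP i. U i) y \<partial>N) = (SUP i. integral\<^sup>N N (U i))"
    unfolding sup using seq(3) m by (rule nn_integral_monotone_convergence_SUP)
  also have "\<dots> = (SUP i. integral\<^sup>N M (U i) + c * U i x)"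
    using seq by simp
  also have "\<dots> = (SUP i. integral\<^sup>N M (U i)) + (SUP i. c * U i x)"
    using inc by (rule ennreal_SUP_add)
  also have "\<dots> = (\<integral>\<^sup>+y. (SUP i. U i) y \<partial>M) + c * (SUP i. U i) x"
    unfolding sup using seq nn_integral_monotone_convergence_SUP[of U M] by (simp add: SUP_mult_left_ennreal)
  finally show ?case .
qed

locale metropolis_hastings =
  fixes \<Omega> :: "(real^'n) set" and p :: "real^'n \<Rightarrow> real" and k :: "real \<Rightarrow> real"
  assumes convex: "convex \<Omega>"
    and p_meas: "p \<in> borel_measurable (leb_on \<Omega>)"
    and p_nonneg: "\<And>x. x \<in> \<Omega> \<Longrightarrow> 0 \<le> p x"
    and prob_target: "prob_space (target \<Omega> p)"
    and proposal: "proposal_density TYPE('n) k"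
begin

abbreviation "\<pi> \<equiv> target \<Omega> p"
abbreviation "P \<equiv> mh_kernel \<Omega> k p"

text \<open>The target density as a Borel function on the whole space. A convex set differs from its
  interior by a null set, so no mass is lost, and the value 0 outside encodes that proposals leaving
  \<Omega> are rejected.\<close>

definition q :: "real^'n \<Rightarrow> real" where "q x = (if x \<in> interior \<Omega> then p x else 0)"

definition \<kappa> :: "real^'n \<Rightarrow> real" where "\<kappa> v = k (norm v)"

lemma \<kappa>_nonneg [simp]: "0 \<le> \<kappa> v"
  using proposal by (simp add: \<kappa>_def proposal_density_def)

lemma \<kappa>_minus: "\<kappa> (x - y) = \<kappa> (y - x)"
  by (simp add: \<kappa>_def norm_minus_commute)

lemma \<kappa>_measurable [measurable]: "\<kappa> \<in> borel_measurable borel"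
proof -
  have [measurable]: "k \<in> borel_measurable borel" using proposal by (simp add: proposal_density_def)
  show ?thesis unfolding \<kappa>_def[abs_def] by measurable
qed

lemma nn_integral_\<kappa>_diff: "(\<integral>\<^sup>+y. ennreal (\<kappa> (x - y)) \<partial>lborel) = 1"
  using proposal by (simp add: \<kappa>_def proposal_density_def)

lemma q_nonneg [simp]: "0 \<le> q x"
  using p_nonneg interior_subset[of \<Omega>] by (auto simp: q_def)

section \<open>Reduction to Lebesgue measure on the interior\<close>

lemma borel_measurable_leb_onI: "f \<in> borel \<rightarrow>\<^sub>M M \<Longrightarrow> f \<in> leb_on \<Omega> \<rightarrow>\<^sub>M M"
  by (subst measurable_cong_sets[OF sets_leb_on refl]) (rule measurable_restrict_space1)

lemma borel_measurable_leb_on_interior: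
  fixes f :: "real^'n \<Rightarrow> real"
  assumes "f \<in> borel_measurable (leb_on \<Omega>)"
  shows "(\<lambda>x. if x \<in> interior \<Omega> then f x else 0) \<in> borel_measurable borel"
proof -
  have "f \<in> borel_measurable (restrict_space borel \<Omega>)"
    using assms by (simp add: measurable_cong_sets[OF sets_leb_on refl])
  then have "f \<in> borel_measurable (restrict_space borel (interior \<Omega>))"
    by (rule measurable_restrict_mono[OF _ interior_subset])
  then have "(\<lambda>x. indicator (interior \<Omega>) x *\<^sub>R f x) \<in> borel_measurable borel"
    by (subst (asm) borel_measurable_restrict_space_iff) auto
  moreover have "(\<lambda>x. indicator (interior \<Omega>) x *\<^sub>R f x) = (\<lambda>x. if x \<in> interior \<Omega> then f x else 0)"
    by auto
  ultimately show ?thesis by simp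
qed

lemma q_measurable [measurable]: "q \<in> borel_measurable borel"
  unfolding q_def[abs_def] using p_meas by (rule borel_measurable_leb_on_interior)

lemma sets_interior:
  assumes "S \<in> sets (leb_on \<Omega>)"
  shows "S \<inter> interior \<Omega> \<in> sets borel"
proof -
  obtain C where "C \<in> sets borel" "S = \<Omega> \<inter> C"
    using assms by (auto simp: sets_leb_on sets_restrict_space)
  moreover from this have "S \<inter> interior \<Omega> = C \<inter> interior \<Omega>"
    using interior_subset[of \<Omega>] by auto
  ultimately show ?thesis by simp
qed

lemma measurable_id_interior: "(\<lambda>x. x) \<in> restrict_space lborel (interior \<Omega>) \<rightarrow>\<^sub>M leb_on \<Omega>"
proof -
  have "(\<lambda>x. x) \<in> restrict_space lborel (interior \<Omega>) \<rightarrow>\<^sub>M restrict_space lborel \<Omega>"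
    using interior_subset[of \<Omega>]
    by (intro measurable_restrict_space2 measurable_restrict_space1) (auto simp: space_restrict_space)
  also have "restrict_space lborel (interior \<Omega>) \<rightarrow>\<^sub>M restrict_space lborel \<Omega>
      = restrict_space lborel (interior \<Omega>) \<rightarrow>\<^sub>M leb_on \<Omega>"
    by (rule measurable_cong_sets) (auto simp: sets_leb_on sets_restrict_space)
  finally show ?thesis .
qed

text \<open>Convexity makes \<Omega> minus its interior negligible. \<Omega> itself may fail to be
  Borel, so Lebesgue measure on the open interior is carried over by the identity, which is
  measurable into the sigma-algebra of \<open>leb_on \<Omega>\<close>.\<close>

lemma leb_on_eq_distr: "leb_on \<Omega> = distr (restrict_space lborel (interior \<Omega>)) (leb_on \<Omega>) (\<lambda>x. x)"
proof (rule measure_eqI)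
  note id = measurable_id_interior
  fix B assume B: "B \<in> sets (leb_on \<Omega>)"
  have BI: "B \<inter> interior \<Omega> \<in> sets borel" using B by (rule sets_interior)
  have "negligible (\<Omega> - interior \<Omega>)"
    by (rule negligible_subset[OF negligible_convex_frontier[OF convex]])
       (use closure_subset in \<open>auto simp: frontier_def\<close>)
  moreover have sub: "B - interior \<Omega> \<subseteq> \<Omega> - interior \<Omega>"
    using sets.sets_into_space[OF B] by auto
  ultimately have "negligible (B - interior \<Omega>)" by (rule negligible_subset)
  then have N: "B - interior \<Omega> \<in> null_sets lebesgue" by (simp add: negligible_iff_null_sets)
  have "emeasure lebesgue B = emeasure lebesgue (B \<inter> interior \<Omega> \<union> (B - interior \<Omega>))"
    by (simp add: Int_Diff_Un)
  also have "\<dots> = emeasure lebesgue (B \<inter> interior \<Omega>)"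
    using N BI by (intro emeasure_Un_null_set) (auto simp: sets_completionI_sets)
  also have "\<dots> = emeasure lborel (B \<inter> interior \<Omega>)" using BI by simp
  also have "\<dots> = emeasure (restrict_space lborel (interior \<Omega>)) (B \<inter> interior \<Omega>)"
    using BI by (intro emeasure_restrict_space[symmetric]) auto
  also have "\<dots> = emeasure (distr (restrict_space lborel (interior \<Omega>)) (leb_on \<Omega>) (\<lambda>x. x)) B"
    using B id by (subst emeasure_distr) (auto simp: space_restrict_space)
  finally show "emeasure (leb_on \<Omega>) B
      = emeasure (distr (restrict_space lborel (interior \<Omega>)) (leb_on \<Omega>) (\<lambda>x. x)) B"
    using emeasure_leb_on[OF convex B] by simp
qed simp

lemma nn_integral_leb_on:
  assumes f: "f \<in> borel_measurable (leb_on \<Omega>)"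
  shows "(\<integral>\<^sup>+x. f x \<partial>leb_on \<Omega>) = (\<integral>\<^sup>+x\<in>interior \<Omega>. f x \<partial>lborel)"
proof -
  note id = measurable_id_interior
  have "(\<integral>\<^sup>+x. f x \<partial>leb_on \<Omega>) = (\<integral>\<^sup>+x. f x \<partial>restrict_space lborel (interior \<Omega>))"
    by (subst leb_on_eq_distr) (simp add: nn_integral_distr[OF id] f)
  then show ?thesis by (simp add: nn_integral_restrict_space)
qed

lemma sets_target [simp]: "sets \<pi> = sets (leb_on \<Omega>)"
  and space_target [simp]: "space \<pi> = \<Omega>"
  by (simp_all add: target_def)

lemma measurable_target: "f \<in> \<pi> \<rightarrow>\<^sub>M M \<longleftrightarrow> f \<in> leb_on \<Omega> \<rightarrow>\<^sub>M M"
  by (simp add: measurable_cong_sets[OF sets_target refl])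

lemma nn_integral_target:
  assumes f: "f \<in> borel_measurable (leb_on \<Omega>)"
  shows "(\<integral>\<^sup>+x. f x \<partial>\<pi>) = (\<integral>\<^sup>+x. ennreal (q x) * f x \<partial>lborel)"
proof -
  have "(\<integral>\<^sup>+x. f x \<partial>\<pi>) = (\<integral>\<^sup>+x. ennreal (p x) * f x \<partial>leb_on \<Omega>)"
    unfolding target_def using f p_meas by (intro nn_integral_density) auto
  also have "\<dots> = (\<integral>\<^sup>+x\<in>interior \<Omega>. ennreal (p x) * f x \<partial>lborel)"
    using f p_meas by (intro nn_integral_leb_on) auto
  also have "\<dots> = (\<integral>\<^sup>+x. ennreal (q x) * f x \<partial>lborel)"
    by (intro nn_integral_cong) (auto simp: q_def)
  finally show ?thesis .
qed

text \<open>\<open>q\<close> in the numerator extends the density by 0 to proposals outside the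
  interior. The denominator stays \<open>p\<close>, because the kernel is also defined at boundary
  points \<open>x\<close>, where \<open>p\<close> and \<open>q\<close> may differ.\<close>

definition accept_density :: "real^'n \<Rightarrow> real^'n \<Rightarrow> real" where
  "accept_density x y = min (q y / p x) 1 * \<kappa> (x - y)"

lemma accept_density_nonneg: "x \<in> \<Omega> \<Longrightarrow> 0 \<le> accept_density x y"
  by (simp add: accept_density_def p_nonneg)

lemma accept_density_le: "accept_density x y \<le> \<kappa> (x - y)"
  using mult_right_mono[of "min (q y / p x) 1" 1 "\<kappa> (x - y)"] by (simp add: accept_density_def)

lemma accept_density_measurable [measurable]:
  "(\<lambda>(x, y). accept_density x y) \<in> borel_measurable (leb_on \<Omega> \<Otimes>\<^sub>M lborel)"
proof -
  have [measurable]: "p \<in> borel_measurable (leb_on \<Omega>)" by (rule p_meas)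
  have [measurable]: "(\<lambda>x. x) \<in> leb_on \<Omega> \<rightarrow>\<^sub>M borel" by (rule borel_measurable_leb_onI) simp
  have 1: "(\<lambda>z. fst z - snd z) \<in> leb_on \<Omega> \<Otimes>\<^sub>M lborel \<rightarrow>\<^sub>M (borel :: (real^'n) measure)"
    by measurable
  have [measurable]: "(\<lambda>z. \<kappa> (fst z - snd z)) \<in> borel_measurable (leb_on \<Omega> \<Otimes>\<^sub>M lborel)"
    by (rule measurable_compose[OF 1 \<kappa>_measurable])
  show ?thesis unfolding accept_density_def split_beta' by measurable
qed

lemma accept_density_measurable1 [measurable]: "accept_density x \<in> borel_measurable borel"
  unfolding accept_density_def[abs_def] by measurable

lemma mh_accept_measurable:
  "(\<lambda>y. mh_accept p x y * k (norm (x - y))) \<in> borel_measurable (leb_on \<Omega>)"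
proof -
  have [measurable]: "p \<in> borel_measurable (leb_on \<Omega>)" by (rule p_meas)
  have [measurable]: "(\<lambda>y. \<kappa> (x - y)) \<in> borel_measurable (leb_on \<Omega>)"
    by (rule borel_measurable_leb_onI) measurable
  show ?thesis unfolding mh_accept_def \<kappa>_def[symmetric] by measurable
qed

lemma nn_integral_accept:
  assumes g: "g \<in> borel_measurable (leb_on \<Omega>)"
  shows "(\<integral>\<^sup>+y. ennreal (mh_accept p x y * k (norm (x - y))) * g y \<partial>leb_on \<Omega>)
    = (\<integral>\<^sup>+y. ennreal (accept_density x y) * g y \<partial>lborel)"
proof -
  have "(\<integral>\<^sup>+y. ennreal (mh_accept p x y * k (norm (x - y))) * g y \<partial>leb_on \<Omega>)
      = (\<integral>\<^sup>+y\<in>interior \<Omega>. ennreal (mh_accept p x y * k (norm (x - y))) * g y \<partial>lborel)"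
    using g mh_accept_measurable by (intro nn_integral_leb_on) auto
  also have "\<dots> = (\<integral>\<^sup>+y. ennreal (accept_density x y) * g y \<partial>lborel)"
    by (intro nn_integral_cong) (auto simp: mh_accept_def accept_density_def q_def \<kappa>_def)
  finally show ?thesis .
qed

lemma nn_integral_accept_le: "(\<integral>\<^sup>+y. ennreal (accept_density x y) \<partial>lborel) \<le> 1"
proof -
  have "(\<integral>\<^sup>+y. ennreal (accept_density x y) \<partial>lborel) \<le> (\<integral>\<^sup>+y. ennreal (\<kappa> (x - y)) \<partial>lborel)"
    by (intro nn_integral_mono ennreal_leI accept_density_le)
  then show ?thesis by (simp add: nn_integral_\<kappa>_diff)
qed

lemma mh_reject_eq:
  assumes "x \<in> \<Omega>"
  shows "ennreal (mh_reject \<Omega> k p x) = 1 - (\<integral>\<^sup>+y. ennreal (accept_density x y) \<partial>lborel)"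
proof -
  have "(\<integral>y. mh_accept p x y * k (norm (x - y)) \<partial>leb_on \<Omega>)
      = enn2real (\<integral>\<^sup>+y. ennreal (mh_accept p x y * k (norm (x - y))) \<partial>leb_on \<Omega>)"
  proof (rule integral_eq_nn_integral)
    show "(\<lambda>y. mh_accept p x y * k (norm (x - y))) \<in> borel_measurable (leb_on \<Omega>)"
      by (rule mh_accept_measurable)
    show "AE y in leb_on \<Omega>. 0 \<le> mh_accept p x y * k (norm (x - y))"
      using assms \<kappa>_nonneg by (auto simp: mh_accept_def p_nonneg \<kappa>_def[symmetric])
  qed
  also have "(\<integral>\<^sup>+y. ennreal (mh_accept p x y * k (norm (x - y))) \<partial>leb_on \<Omega>)
      = (\<integral>\<^sup>+y. ennreal (accept_density x y) \<partial>lborel)"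
    using nn_integral_accept[of "\<lambda>_. 1" x] by simp
  finally have r: "mh_reject \<Omega> k p x = 1 - enn2real (\<integral>\<^sup>+y. ennreal (accept_density x y) \<partial>lborel)"
    by (simp add: mh_reject_def)
  have "(\<integral>\<^sup>+y. ennreal (accept_density x y) \<partial>lborel) < \<top>"
    using nn_integral_accept_le[of x] by (rule le_less_trans) simp
  then show ?thesis
    unfolding r by (simp add: ennreal_minus[symmetric])
qed

lemma sets_mh [simp]: "sets (P x) = sets (leb_on \<Omega>)"
  using sets.space_closed[of "leb_on \<Omega>"] sets.sigma_sets_eq[of "leb_on \<Omega>"]
  by (simp add: mh_kernel_def sets_measure_of)

lemma emeasure_mh:
  assumes "x \<in> \<Omega>" "B \<in> sets (leb_on \<Omega>)"
  shows "emeasure (P x) B = (\<integral>\<^sup>+y. ennreal (accept_density x y) * indicator B y \<partial>lborel)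
    + (1 - (\<integral>\<^sup>+y. ennreal (accept_density x y) \<partial>lborel)) * indicator B x"
  using assms proposal
  by (subst emeasure_mh_kernel) (auto simp: p_meas proposal_density_def mh_reject_eq nn_integral_accept)

lemma nn_integral_mh:
  assumes x: "x \<in> \<Omega>" and g: "g \<in> borel_measurable (leb_on \<Omega>)"
  shows "(\<integral>\<^sup>+y. g y \<partial>P x) = (\<integral>\<^sup>+y. ennreal (accept_density x y) * g y \<partial>lborel)
    + (1 - (\<integral>\<^sup>+y. ennreal (accept_density x y) \<partial>lborel)) * g x"
proof -
  let ?a = "\<lambda>y. ennreal (mh_accept p x y * k (norm (x - y)))"
  have a: "?a \<in> borel_measurable (leb_on \<Omega>)" using mh_accept_measurable by measurable
  have "(\<integral>\<^sup>+y. g y \<partial>P x) = (\<integral>\<^sup>+y. g y \<partial>density (leb_on \<Omega>) ?a)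
      + (1 - (\<integral>\<^sup>+y. ennreal (accept_density x y) \<partial>lborel)) * g x"
    using x g a
    by (intro nn_integral_plus_point_mass) (auto simp: emeasure_mh emeasure_density nn_integral_accept)
  also have "(\<integral>\<^sup>+y. g y \<partial>density (leb_on \<Omega>) ?a) = (\<integral>\<^sup>+y. ennreal (accept_density x y) * g y \<partial>lborel)"
    using g a by (simp add: nn_integral_density nn_integral_accept)
  finally show ?thesis .
qed

lemma prob_space_mh:
  assumes x: "x \<in> \<Omega>"
  shows "prob_space (P x)"
proof
  have sp: "space (P x) = \<Omega>" using sets_eq_imp_space_eq[OF sets_mh[of x]] by simp
  have "emeasure (P x) \<Omega> = (\<integral>\<^sup>+y. 1 \<partial>P x)" by (simp add: sp)
  also have "\<dots> = 1"
    using x nn_integral_accept_le[of x] by (subst nn_integral_mh) (auto simp: add_diff_inverse_ennreal)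
  finally show "emeasure (P x) (space (P x)) = 1" by (simp add: sp)
qed

lemma mh_measurable: "P \<in> \<pi> \<rightarrow>\<^sub>M prob_algebra \<pi>"
proof (rule measurable_prob_algebraI)
  show "P \<in> \<pi> \<rightarrow>\<^sub>M subprob_algebra \<pi>"
  proof (rule measurable_subprob_algebra)
    fix B assume "B \<in> sets \<pi>"
    then have B [measurable]: "B \<in> sets (leb_on \<Omega>)" by simp
    \<comment> \<open>\<open>B\<close> may fail to be Borel; its trace on the interior is Borel and
      carries all of the accepted mass in \<open>B\<close>.\<close>
    have [measurable]: "B \<inter> interior \<Omega> \<in> sets borel" using B by (rule sets_interior)
    have [measurable]: "(\<lambda>(x, y). ennreal (accept_density x y)) \<in> borel_measurable (leb_on \<Omega> \<Otimes>\<^sub>M lborel)"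
      unfolding split_beta' by measurable
    have "(\<lambda>x. (\<integral>\<^sup>+y. ennreal (accept_density x y) * indicator (B \<inter> interior \<Omega>) y \<partial>lborel)
        + (1 - (\<integral>\<^sup>+y. ennreal (accept_density x y) \<partial>lborel)) * indicator B x) \<in> borel_measurable (leb_on \<Omega>)"
      by measurable
    moreover have "(\<integral>\<^sup>+y. ennreal (accept_density x y) * indicator (B \<inter> interior \<Omega>) y \<partial>lborel)
        = (\<integral>\<^sup>+y. ennreal (accept_density x y) * indicator B y \<partial>lborel)" for x
      by (intro nn_integral_cong) (auto simp: accept_density_def q_def indicator_def)
    ultimately have "(\<lambda>x. (\<integral>\<^sup>+y. ennreal (accept_density x y) * indicator B y \<partial>lborel)
        + (1 - (\<integral>\<^sup>+y. ennreal (accept_density x y) \<partial>lborel)) * indicator B x) \<in> borel_measurable (leb_on \<Omega>)"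
      by simp
    then have "(\<lambda>x. emeasure (P x) B) \<in> borel_measurable (leb_on \<Omega>)"
      by (rule measurable_cong[THEN iffD1, rotated]) (use B in \<open>simp add: emeasure_mh\<close>)
    then show "(\<lambda>x. emeasure (P x) B) \<in> borel_measurable \<pi>" by (simp add: measurable_target)
  qed (auto simp: prob_space_mh prob_space_imp_subprob_space)
qed (simp add: prob_space_mh)

text \<open>The Lebesgue density of accepted moves in the joint law. Multiplying \<open>q x\<close>
  by the acceptance probability leaves a minimum, whence the symmetry.\<close>

definition flow_density :: "real^'n \<Rightarrow> real^'n \<Rightarrow> real" where
  "flow_density x y = min (q x) (q y) * \<kappa> (x - y)"

text \<open>The density of pairs of current state and refused proposal. It includes proposals
  outside \<Omega>, where \<open>flow_density\<close> vanishes.\<close>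

definition reject_density :: "real^'n \<Rightarrow> real^'n \<Rightarrow> real" where
  "reject_density x y = q x * \<kappa> (x - y) - flow_density x y"

lemma flow_density_nonneg [simp]: "0 \<le> flow_density x y"
  by (simp add: flow_density_def)

lemma flow_density_commute: "flow_density x y = flow_density y x"
  by (simp add: flow_density_def min.commute \<kappa>_minus[of x y])

lemma flow_density_le: "flow_density x y \<le> q x * \<kappa> (x - y)"
  by (simp add: flow_density_def mult_right_mono)

lemma reject_density_nonneg [simp]: "0 \<le> reject_density x y"
  using flow_density_le[of x y] by (simp add: reject_density_def)

text \<open>If \<open>q x = 0\<close>, both sides vanish whatever the quotient is; otherwise
  \<open>p x = q x > 0\<close> and the factor moves into the minimum.\<close>

lemma q_accept: "q x * accept_density x y = flow_density x y"
proof (cases "q x = 0")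
  case True
  then show ?thesis by (simp add: flow_density_def)
next
  case False
  then have "p x = q x" "0 < q x" by (auto simp: q_def less_le split: if_splits intro: p_nonneg interior_subset[THEN subsetD])
  then show ?thesis
    by (simp add: accept_density_def flow_density_def min_mult_distrib_left flip: mult.assoc) (simp add: min.commute)
qed

lemma flow_density_measurable [measurable]:
  "(\<lambda>z. flow_density (fst z) (snd z)) \<in> borel_measurable (borel \<Otimes>\<^sub>M borel)"
  "flow_density x \<in> borel_measurable borel"
  unfolding flow_density_def[abs_def] by measurable

lemma reject_density_measurable [measurable]:
  "(\<lambda>z. reject_density (fst z) (snd z)) \<in> borel_measurable (borel \<Otimes>\<^sub>M borel)"
  "reject_density x \<in> borel_measurable borel"
  unfolding reject_density_def[abs_def] by measurable

lemma nn_integral_reject_density: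
  assumes "x \<in> \<Omega>"
  shows "(\<integral>\<^sup>+y. ennreal (reject_density x y) \<partial>lborel)
    = ennreal (q x) * (1 - (\<integral>\<^sup>+y. ennreal (accept_density x y) \<partial>lborel))"
proof -
  have c: "ennreal (flow_density x y) = ennreal (q x) * ennreal (accept_density x y)" for y
    using accept_density_nonneg[OF assms] by (simp add: q_accept[symmetric] ennreal_mult)
  have "(\<integral>\<^sup>+y. ennreal (reject_density x y) \<partial>lborel)
     = (\<integral>\<^sup>+y. ennreal (q x) * ennreal (\<kappa> (x - y)) - ennreal (flow_density x y) \<partial>lborel)"
    by (intro nn_integral_cong) (simp add: reject_density_def ennreal_minus ennreal_mult[symmetric])
  also have "\<dots> = (\<integral>\<^sup>+y. ennreal (q x) * ennreal (\<kappa> (x - y)) \<partial>lborel) - (\<integral>\<^sup>+y. ennreal (flow_density x y) \<partial>lborel)"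
  proof (rule nn_integral_diff)
    show "(\<integral>\<^sup>+y. ennreal (flow_density x y) \<partial>lborel) \<noteq> \<infinity>"
      using nn_integral_accept_le[of x]
      by (auto simp: c nn_integral_cmult ennreal_mult_eq_top_iff top_unique)
    show "AE y in lborel. ennreal (flow_density x y) \<le> ennreal (q x) * ennreal (\<kappa> (x - y))"
      by (intro AE_I2) (simp add: ennreal_mult[symmetric] flow_density_le ennreal_leI)
  qed measurable
  also have "\<dots> = ennreal (q x) * (1 - (\<integral>\<^sup>+y. ennreal (accept_density x y) \<partial>lborel))"
    by (simp add: c nn_integral_cmult nn_integral_\<kappa>_diff ennreal_right_diff_distrib)
  finally show ?thesis .
qed

text \<open>The joint law resolved by the proposal y: an accepted y is evaluated at (x, y), a
  refused one at (x, x). Keeping the refused y as an integration variable allows the two densities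
  to be recombined into that of the free step.\<close>

lemma nn_integral_mh_joint:
  assumes G [measurable]: "G \<in> borel_measurable (borel \<Otimes>\<^sub>M borel)"
  shows "(\<integral>\<^sup>+x. \<integral>\<^sup>+y. G (x, y) \<partial>P x \<partial>\<pi>)
    = (\<integral>\<^sup>+x. \<integral>\<^sup>+y. ennreal (flow_density x y) * G (x, y) + ennreal (reject_density x y) * G (x, x) \<partial>lborel \<partial>lborel)"
proof -
  have [measurable]: "(\<lambda>x. x) \<in> leb_on \<Omega> \<rightarrow>\<^sub>M borel" by (rule borel_measurable_leb_onI) simp
  have "(\<lambda>x. \<integral>\<^sup>+y. G (x, y) \<partial>P x) \<in> borel_measurable \<pi>"
  proof (rule nn_integral_measurable_subprob_algebra2)
    show "P \<in> \<pi> \<rightarrow>\<^sub>M subprob_algebra (leb_on \<Omega>)"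
      using measurable_prob_algebraD[OF mh_measurable] by (simp add: subprob_algebra_cong[OF sets_target])
    have [measurable]: "(\<lambda>x. x) \<in> \<pi> \<rightarrow>\<^sub>M borel" by (simp add: measurable_target)
    show "(\<lambda>(x, y). G (x, y)) \<in> borel_measurable (\<pi> \<Otimes>\<^sub>M leb_on \<Omega>)"
      by measurable
  qed
  then have "(\<integral>\<^sup>+x. \<integral>\<^sup>+y. G (x, y) \<partial>P x \<partial>\<pi>) = (\<integral>\<^sup>+x. ennreal (q x) * (\<integral>\<^sup>+y. G (x, y) \<partial>P x) \<partial>lborel)"
    by (intro nn_integral_target) (simp add: measurable_target)
  also have "\<dots> = (\<integral>\<^sup>+x. \<integral>\<^sup>+y. ennreal (flow_density x y) * G (x, y) + ennreal (reject_density x y) * G (x, x) \<partial>lborel \<partial>lborel)"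
  proof (intro nn_integral_cong)
    fix x :: "real^'n"
    show "ennreal (q x) * (\<integral>\<^sup>+y. G (x, y) \<partial>P x)
      = (\<integral>\<^sup>+y. ennreal (flow_density x y) * G (x, y) + ennreal (reject_density x y) * G (x, x) \<partial>lborel)"
    proof (cases "x \<in> \<Omega>")
      case False
      then have "q x = 0" using interior_subset[of \<Omega>] by (auto simp: q_def)
      then show ?thesis by (simp add: reject_density_def flow_density_def)
    next
      case True
      have "(\<integral>\<^sup>+y. ennreal (flow_density x y) * G (x, y) + ennreal (reject_density x y) * G (x, x) \<partial>lborel)
         = (\<integral>\<^sup>+y. ennreal (flow_density x y) * G (x, y) \<partial>lborel)
          + (\<integral>\<^sup>+y. ennreal (reject_density x y) \<partial>lborel) * G (x, x)"
        by (subst nn_integral_add) (auto simp: nn_integral_multc)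
      also have "(\<integral>\<^sup>+y. ennreal (flow_density x y) * G (x, y) \<partial>lborel)
          = ennreal (q x) * (\<integral>\<^sup>+y. ennreal (accept_density x y) * G (x, y) \<partial>lborel)"
        using accept_density_nonneg[OF True]
        by (subst nn_integral_cmult[symmetric]) (auto simp: q_accept[symmetric] ennreal_mult mult.assoc)
      finally show ?thesis
        using True by (subst nn_integral_mh) (auto simp: nn_integral_reject_density distrib_left mult.assoc)
    qed
  qed
  finally show ?thesis .
qed

text \<open>In the joint law the flow part is symmetric, and the rejection part lives on the
  diagonal.\<close>

lemma reversible_kernel_mh: "reversible_kernel \<pi> P"
proof (intro reversible_kernel.intro reversible_kernel_axioms.intro prob_target mh_measurable)
  fix A B assume "A \<in> sets \<pi>" "B \<in> sets \<pi>"
  then obtain A' B' where A: "A = \<Omega> \<inter> A'" "A' \<in> sets borel" and B: "B = \<Omega> \<inter> B'" "B' \<in> sets borel"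
    by (auto simp: sets_leb_on sets_restrict_space)
  have *: "(\<integral>\<^sup>+x\<in>A. emeasure (P x) B \<partial>\<pi>)
      = (\<integral>\<^sup>+x. \<integral>\<^sup>+y. ennreal (flow_density x y) * (indicator A' x * indicator B' y) \<partial>lborel \<partial>lborel)
        + (\<integral>\<^sup>+x. \<integral>\<^sup>+y. ennreal (reject_density x y) * (indicator A' x * indicator B' x) \<partial>lborel \<partial>lborel)"
    if A: "A = \<Omega> \<inter> A'" "A' \<in> sets borel" and B: "B = \<Omega> \<inter> B'" "B' \<in> sets borel" for A A' B B'
  proof -
    have [measurable]: "A' \<in> sets borel" "B' \<in> sets borel" using A B by auto
    have "(\<integral>\<^sup>+x\<in>A. emeasure (P x) B \<partial>\<pi>) = (\<integral>\<^sup>+x. \<integral>\<^sup>+y. indicator A' x * indicator B' y \<partial>P x \<partial>\<pi>)"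
    proof (intro nn_integral_cong)
      fix x assume "x \<in> space \<pi>"
      have sp: "space (P x) = \<Omega>" using sets_eq_imp_space_eq[OF sets_mh[of x]] by simp
      have [measurable]: "B \<in> sets (P x)" using B by (auto simp: sets_leb_on sets_restrict_space)
      have "(\<integral>\<^sup>+y. indicator A' x * indicator B' y \<partial>P x) = (\<integral>\<^sup>+y. indicator A' x * indicator B y \<partial>P x)"
        by (intro nn_integral_cong) (auto simp: sp B indicator_def)
      also have "\<dots> = emeasure (P x) B * indicator A x"
        using \<open>x \<in> space \<pi>\<close> \<open>B \<in> sets (P x)\<close>
        by (subst nn_integral_cmult_indicator) (auto simp: A indicator_def)
      finally show "emeasure (P x) B * indicator A x = (\<integral>\<^sup>+y. indicator A' x * indicator B' y \<partial>P x)" ..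
    qed
    also have "\<dots> = (\<integral>\<^sup>+x. \<integral>\<^sup>+y. ennreal (flow_density x y) * (indicator A' x * indicator B' y)
          + ennreal (reject_density x y) * (indicator A' x * indicator B' x) \<partial>lborel \<partial>lborel)"
      using nn_integral_mh_joint[of "\<lambda>z. indicator A' (fst z) * indicator B' (snd z)"] by simp
    also have "\<dots> = (\<integral>\<^sup>+x. (\<integral>\<^sup>+y. ennreal (flow_density x y) * (indicator A' x * indicator B' y) \<partial>lborel)
          + (\<integral>\<^sup>+y. ennreal (reject_density x y) * (indicator A' x * indicator B' x) \<partial>lborel) \<partial>lborel)"
      by (intro nn_integral_cong nn_integral_add) auto
    also have "\<dots> = (\<integral>\<^sup>+x. \<integral>\<^sup>+y. ennreal (flow_density x y) * (indicator A' x * indicator B' y) \<partial>lborel \<partial>lborel)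
        + (\<integral>\<^sup>+x. \<integral>\<^sup>+y. ennreal (reject_density x y) * (indicator A' x * indicator B' x) \<partial>lborel \<partial>lborel)"
      by (intro nn_integral_add lborel.borel_measurable_nn_integral) (auto simp: split_beta')
    finally show ?thesis .
  qed
  have [measurable]: "A' \<in> sets borel" "B' \<in> sets borel" using A B by auto
  have "(\<integral>\<^sup>+x. \<integral>\<^sup>+y. ennreal (flow_density x y) * (indicator A' x * indicator B' y) \<partial>lborel \<partial>lborel)
      = (\<integral>\<^sup>+y. \<integral>\<^sup>+x. ennreal (flow_density x y) * (indicator A' x * indicator B' y) \<partial>lborel \<partial>lborel)"
    by (rule lborel_pair.Fubini'[symmetric]) (auto simp: split_beta')
  also have "\<dots> = (\<integral>\<^sup>+x. \<integral>\<^sup>+y. ennreal (flow_density x y) * (indicator B' x * indicator A' y) \<partial>lborel \<partial>lborel)"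
    by (simp add: flow_density_commute mult.commute)
  finally show "(\<integral>\<^sup>+x\<in>A. emeasure (P x) B \<partial>\<pi>) = (\<integral>\<^sup>+x\<in>B. emeasure (P x) A \<partial>\<pi>)"
    unfolding *[OF A B] *[OF B A] by (simp add: mult.commute)
qed

sublocale reversible_kernel \<pi> P
  by (rule reversible_kernel_mh)

end

section \<open>The lower end of the spectrum\<close>

lemma (in prob_space) isCont_integral_cos:
  fixes X :: "'a \<Rightarrow> real"
  assumes [measurable]: "X \<in> borel_measurable M"
  shows "isCont (\<lambda>s. \<integral>v. cos (s * X v) \<partial>M) t"
  unfolding continuous_at_sequentially
proof safe
  fix S assume S: "S \<longlonglongrightarrow> t"
  show "((\<lambda>s. \<integral>v. cos (s * X v) \<partial>M) \<circ> S) \<longlonglongrightarrow> (\<integral>v. cos (t * X v) \<partial>M)"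
    unfolding comp_def
    by (rule integral_dominated_convergence[where w="\<lambda>_. 1"]) (auto intro!: tendsto_intros S)
qed

text \<open>The Dirichlet kernel: the factor 2 sin(x/2) makes the sum of cosines telescope.\<close>

lemma sum_cos_multiples:
  fixes x :: real
  shows "2 * sin (x / 2) * (\<Sum>j<n. cos (real j * x)) = sin ((real n - 1 / 2) * x) + sin (x / 2)"
proof (induction n)
  case 0
  have "(real 0 - 1 / 2) * x = - (x / 2)" by simp
  then show ?case by (simp only: sin_minus) simp
next
  case (Suc n)
  have "2 * sin (x / 2) * cos (real n * x) = sin (real n * x + x / 2) - sin (real n * x - x / 2)"
    by (simp add: sin_add sin_diff)
  moreover have "real n * x + x / 2 = (real (Suc n) - 1 / 2) * x" "real n * x - x / 2 = (real n - 1 / 2) * x"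
    by (simp_all add: field_simps)
  ultimately show ?case using Suc by (simp add: distrib_left)
qed

lemma tendsto_mean_cos:
  fixes x :: real
  assumes "sin (x / 2) \<noteq> 0"
  shows "(\<lambda>n. (\<Sum>j<n. cos (real j * x)) / real n) \<longlonglongrightarrow> 0"
proof (rule tendsto_rabs_zero_cancel, rule tendsto_sandwich[OF _ _ tendsto_const])
  have s: "0 < \<bar>sin (x / 2)\<bar>" using assms by simp
  have "\<bar>\<Sum>j<n. cos (real j * x)\<bar> \<le> 1 / \<bar>sin (x / 2)\<bar>" for n
  proof -
    have "2 * \<bar>sin (x / 2)\<bar> * \<bar>\<Sum>j<n. cos (real j * x)\<bar> = \<bar>sin ((real n - 1 / 2) * x) + sin (x / 2)\<bar>"
      by (metis sum_cos_multiples abs_mult abs_numeral)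
    also have "\<dots> \<le> 1 + 1"
      by (rule order_trans[OF abs_triangle_ineq add_mono]) (rule abs_sin_le_one)+
    finally show ?thesis using s by (simp add: field_simps)
  qed
  then show "\<forall>\<^sub>F n in sequentially. \<bar>(\<Sum>j<n. cos (real j * x)) / real n\<bar> \<le> 1 / \<bar>sin (x / 2)\<bar> / real n"
    by (intro always_eventually allI) (simp add: abs_divide divide_right_mono del: divide_divide_eq_left)
  show "(\<lambda>n. 1 / \<bar>sin (x / 2)\<bar> / real n) \<longlonglongrightarrow> 0"
    by (rule lim_const_over_n)
qed simp

text \<open>A weak form of the Riemann--Lebesgue lemma, obtained from Cesaro means.\<close>

lemma (in prob_space) exists_integral_cos_less:
  fixes X :: "'a \<Rightarrow> real"
  assumes [measurable]: "X \<in> borel_measurable M" and X: "AE v in M. sin (X v / 2) \<noteq> 0" and "0 < \<epsilon>"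
  shows "\<exists>j::nat. (\<integral>v. cos (real j * X v) \<partial>M) < \<epsilon>"
proof (rule ccontr)
  assume "\<not> ?thesis"
  then have ge: "\<epsilon> \<le> (\<integral>v. cos (real j * X v) \<partial>M)" for j by (simp add: not_less)
  have ic: "integrable M (\<lambda>v. cos (real j * X v))" for j
    by (rule integrable_const_bound[of _ 1]) auto
  \<comment> \<open>The averages over j < n tend to 0 pointwise almost everywhere and are bounded by
    1; if every mean cosine were at least \<epsilon>, so would be the integrals of these
    averages.\<close>
  have "(\<lambda>n. \<integral>v. (\<Sum>j<n. cos (real j * X v)) / real n \<partial>M) \<longlonglongrightarrow> (\<integral>v. 0 \<partial>M)"
  proof (rule integral_dominated_convergence[where w="\<lambda>_. 1"])
    show "AE v in M. (\<lambda>n. (\<Sum>j<n. cos (real j * X v)) / real n) \<longlonglongrightarrow> 0"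
      using X by eventually_elim (rule tendsto_mean_cos)
    fix n
    have "\<bar>\<Sum>j<n. cos (real j * X v)\<bar> \<le> real n" for v
      using sum_mono[of "{..<n}" "\<lambda>j. \<bar>cos (real j * X v)\<bar>" "\<lambda>_. 1"]
      by (intro order_trans[OF sum_abs]) simp
    then show "AE v in M. norm ((\<Sum>j<n. cos (real j * X v)) / real n) \<le> 1"
      by (auto simp: divide_le_eq_1)
  qed auto
  moreover have "\<epsilon> \<le> (\<integral>v. (\<Sum>j<n. cos (real j * X v)) / real n \<partial>M)" if "1 \<le> n" for n
  proof -
    have "real n * \<epsilon> \<le> (\<Sum>j<n. \<integral>v. cos (real j * X v) \<partial>M)"
      using sum_mono[of "{..<n}" "\<lambda>_. \<epsilon>" "\<lambda>j. \<integral>v. cos (real j * X v) \<partial>M"] ge by simp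
    then show ?thesis
      using that by (simp add: Bochner_Integration.integral_sum[OF ic] field_simps)
  qed
  ultimately have "\<epsilon> \<le> 0"
    by (intro tendsto_lowerbound[where F=sequentially]) (auto simp: eventually_sequentially)
  then show False using \<open>0 < \<epsilon>\<close> by simp
qed

lemma lborel_integral_reflect:
  fixes f :: "'a::euclidean_space \<Rightarrow> real"
  assumes "f \<in> borel_measurable borel"
  shows "(\<integral>v. f (x - v) \<partial>lborel) = (\<integral>y. f y \<partial>lborel)"
proof -
  have "lborel = distr lborel borel (\<lambda>v. x - v)"
    using lborel_affine[of "-1" x] by (simp add: density_1)
  then have "(\<integral>y. f y \<partial>lborel) = (\<integral>y. f y \<partial>distr lborel borel (\<lambda>v. x - v))" by simp
  also have "\<dots> = (\<integral>v. f (x - v) \<partial>lborel)"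
    using assms by (intro integral_distr) auto
  finally show ?thesis by simp
qed

context metropolis_hastings
begin

text \<open>The law of one proposed increment of the free walk, regardless of \<Omega> and of
  acceptance.\<close>

definition step_law :: "(real^'n) measure" where
  "step_law = density lborel (\<lambda>v. ennreal (\<kappa> v))"

lemma prob_space_step_law: "prob_space step_law"
proof
  have "emeasure step_law (space step_law) = (\<integral>\<^sup>+v. ennreal (\<kappa> v) \<partial>lborel)"
    by (simp add: step_law_def emeasure_density)
  also have "\<dots> = 1" using nn_integral_\<kappa>_diff[of 0] \<kappa>_minus[of 0] by simp
  finally show "emeasure step_law (space step_law) = 1" .
qed

sublocale step: prob_space step_law
  by (rule prob_space_step_law)

lemma sets_step_law [simp, measurable_cong]: "sets step_law = sets borel"
  by (simp add: step_law_def)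

lemma integral_step_law:
  fixes g :: "real^'n \<Rightarrow> real"
  assumes [measurable]: "g \<in> borel_measurable borel"
  shows "(\<integral>v. g v \<partial>step_law) = (\<integral>v. \<kappa> v * g v \<partial>lborel)"
  unfolding step_law_def by (subst integral_density) auto

text \<open>The characteristic function of the step law, which is real because the law is
  symmetric.\<close>

definition step_cos :: "real^'n \<Rightarrow> real" where
  "step_cos \<xi> = (\<integral>v. cos (\<xi> \<bullet> v) \<partial>step_law)"

lemma integral_step_law_reflect:
  fixes g :: "real^'n \<Rightarrow> real"
  assumes [measurable]: "g \<in> borel_measurable borel"
  shows "(\<integral>v. g (- v) \<partial>step_law) = (\<integral>v. g v \<partial>step_law)"
proof -
  have "(\<integral>v. \<kappa> (- v) * g (- v) \<partial>lborel) = (\<integral>v. \<kappa> v * g v \<partial>lborel)"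
    using lborel_integral_reflect[of "\<lambda>v. \<kappa> v * g v" 0] by simp
  then show ?thesis by (simp add: integral_step_law \<kappa>_def)
qed

text \<open>Plane waves are eigenfunctions of convolution with \<kappa>: the addition theorem leaves
  a cosine mean and a sine mean, and the latter vanishes by symmetry of the step law.\<close>

lemma integral_\<kappa>_cos:
  "(\<integral>y. \<kappa> (x - y) * cos (\<xi> \<bullet> y + \<phi>) \<partial>lborel) = step_cos \<xi> * cos (\<xi> \<bullet> x + \<phi>)"
proof -
  have "(\<integral>y. \<kappa> (x - y) * cos (\<xi> \<bullet> y + \<phi>) \<partial>lborel)
      = (\<integral>v. \<kappa> v * cos (\<xi> \<bullet> (x - v) + \<phi>) \<partial>lborel)"
    using lborel_integral_reflect[of "\<lambda>y. \<kappa> (x - y) * cos (\<xi> \<bullet> y + \<phi>)" x] by simp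
  also have "\<dots> = (\<integral>v. cos (\<xi> \<bullet> (x - v) + \<phi>) \<partial>step_law)"
    by (rule integral_step_law[symmetric]) measurable
  also have "\<dots> = (\<integral>v. cos (\<xi> \<bullet> x + \<phi>) * cos (\<xi> \<bullet> v) + sin (\<xi> \<bullet> x + \<phi>) * sin (\<xi> \<bullet> v) \<partial>step_law)"
  proof (intro Bochner_Integration.integral_cong refl)
    fix v
    have eq: "\<xi> \<bullet> (x - v) + \<phi> = (\<xi> \<bullet> x + \<phi>) - \<xi> \<bullet> v" by (simp add: inner_diff_right)
    show "cos (\<xi> \<bullet> (x - v) + \<phi>) = cos (\<xi> \<bullet> x + \<phi>) * cos (\<xi> \<bullet> v) + sin (\<xi> \<bullet> x + \<phi>) * sin (\<xi> \<bullet> v)"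
      unfolding eq by (rule cos_diff)
  qed
  also have "\<dots> = cos (\<xi> \<bullet> x + \<phi>) * step_cos \<xi> + sin (\<xi> \<bullet> x + \<phi>) * (\<integral>v. sin (\<xi> \<bullet> v) \<partial>step_law)"
  proof -
    have "integrable step_law (\<lambda>v. cos (\<xi> \<bullet> v))" "integrable step_law (\<lambda>v. sin (\<xi> \<bullet> v))"
      by (auto intro!: step.integrable_const_bound[of _ 1])
    then show ?thesis by (simp add: step_cos_def)
  qed
  also have "(\<integral>v. sin (\<xi> \<bullet> v) \<partial>step_law) = 0"
    using integral_step_law_reflect[of "\<lambda>v. sin (\<xi> \<bullet> v)"] by simp
  finally show ?thesis by simp
qed

text \<open>Along a coordinate direction the mean cosine is continuous in the frequency, equals 1 at
  frequency 0 and falls below 1/2 somewhere, so it takes every value in between.\<close>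

lemma exists_step_cos_eq:
  assumes "1 / 2 < b" "b < 1"
  shows "\<exists>\<xi>. step_cos \<xi> = b"
proof -
  obtain e :: "real^'n" where e: "e \<in> Basis" using nonempty_Basis by blast
  \<comment> \<open>These countably many hyperplanes are the zeros of sin((e . v) / 2); they are
    Lebesgue null, hence null for the step law, which has a density.\<close>
  have "AE v in lborel. \<forall>i::int. v \<bullet> e \<noteq> 2 * pi * of_int i"
    unfolding AE_all_countable using e by (intro allI AE_lborel_inner_neq)
  then have "AE v in lborel. 0 < ennreal (\<kappa> v) \<longrightarrow> sin ((e \<bullet> v) / 2) \<noteq> 0"
    by eventually_elim (auto simp: sin_zero_iff_int2 inner_commute field_simps)
  then have "AE v in step_law. sin ((e \<bullet> v) / 2) \<noteq> 0"
    unfolding step_law_def by (subst AE_density) auto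
  from step.exists_integral_cos_less[OF _ this, of "1/2"]
  obtain j :: nat where "(\<integral>v. cos (real j * (e \<bullet> v)) \<partial>step_law) < 1 / 2" by auto
  moreover have "\<exists>s\<ge>0. s \<le> real j \<and> (\<integral>v. cos (s * (e \<bullet> v)) \<partial>step_law) = b"
    if "(\<integral>v. cos (real j * (e \<bullet> v)) \<partial>step_law) < 1 / 2"
  proof (rule IVT2)
    show "\<forall>s. 0 \<le> s \<and> s \<le> real j \<longrightarrow> isCont (\<lambda>s. \<integral>v. cos (s * (e \<bullet> v)) \<partial>step_law) s"
      by (intro allI impI step.isCont_integral_cos) measurable
  qed (use assms that in \<open>auto simp: step.prob_space\<close>)
  ultimately obtain s where "(\<integral>v. cos (s * (e \<bullet> v)) \<partial>step_law) = b" by auto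
  then have "step_cos (s *\<^sub>R e) = b" by (simp add: step_cos_def)
  then show ?thesis ..
qed

section \<open>Target and joint law as Lebesgue integrals\<close>

lemma measurable_target_borel: "f \<in> borel \<rightarrow>\<^sub>M M \<Longrightarrow> f \<in> \<pi> \<rightarrow>\<^sub>M M"
  by (simp add: measurable_target borel_measurable_leb_onI)

lemma distr_target: "distr \<pi> borel (\<lambda>x. x) = density lborel (\<lambda>x. ennreal (q x))"
proof (rule measure_eqI)
  have id: "(\<lambda>x. x) \<in> \<pi> \<rightarrow>\<^sub>M borel" by (rule measurable_target_borel) simp
  fix B assume "B \<in> sets (distr \<pi> borel (\<lambda>x. x))"
  then have [measurable]: "B \<in> sets borel" by simp
  have "emeasure (distr \<pi> borel (\<lambda>x. x)) B = (\<integral>\<^sup>+x. indicator B x \<partial>distr \<pi> borel (\<lambda>x. x))"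
    by simp
  also have "\<dots> = (\<integral>\<^sup>+x. indicator B x \<partial>\<pi>)"
    by (rule nn_integral_distr[OF id]) simp
  also have "\<dots> = (\<integral>\<^sup>+x. ennreal (q x) * indicator B x \<partial>lborel)"
    by (intro nn_integral_target borel_measurable_leb_onI) simp
  finally show "emeasure (distr \<pi> borel (\<lambda>x. x)) B = emeasure (density lborel (\<lambda>x. ennreal (q x))) B"
    by (simp add: emeasure_density)
qed simp

lemma integrable_target:
  fixes f :: "real^'n \<Rightarrow> real"
  assumes [measurable]: "f \<in> borel_measurable borel"
  shows "integrable \<pi> f \<longleftrightarrow> integrable lborel (\<lambda>x. q x * f x)"
proof -
  have id: "(\<lambda>x. x) \<in> \<pi> \<rightarrow>\<^sub>M borel" by (rule measurable_target_borel) simp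
  have "integrable \<pi> f \<longleftrightarrow> integrable (distr \<pi> borel (\<lambda>x. x)) f"
    using integrable_distr_eq[OF id, of f] by simp
  also have "\<dots> \<longleftrightarrow> integrable lborel (\<lambda>x. q x * f x)"
    unfolding distr_target by (subst integrable_density) auto
  finally show ?thesis .
qed

lemma integral_target:
  fixes f :: "real^'n \<Rightarrow> real"
  assumes [measurable]: "f \<in> borel_measurable borel"
  shows "(\<integral>x. f x \<partial>\<pi>) = (\<integral>x. q x * f x \<partial>lborel)"
proof -
  have id: "(\<lambda>x. x) \<in> \<pi> \<rightarrow>\<^sub>M borel" by (rule measurable_target_borel) simp
  have "(\<integral>x. f x \<partial>\<pi>) = (\<integral>x. f x \<partial>distr \<pi> borel (\<lambda>x. x))"
    using integral_distr[OF id, of f] by simp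
  also have "\<dots> = (\<integral>x. q x * f x \<partial>lborel)"
    unfolding distr_target by (subst integral_density) auto
  finally show ?thesis .
qed

lemma integral_joint_mh:
  fixes G :: "(real^'n) \<times> (real^'n) \<Rightarrow> real"
  assumes [measurable]: "G \<in> borel_measurable (borel \<Otimes>\<^sub>M borel)" and nn: "\<And>z. 0 \<le> G z"
  shows "(\<integral>z. G z \<partial>joint) = (\<integral>z. flow_density (fst z) (snd z) * G z
    + reject_density (fst z) (snd z) * G (fst z, fst z) \<partial>(lborel \<Otimes>\<^sub>M lborel))"
proof -
  have [measurable]: "(\<lambda>x. x) \<in> \<pi> \<rightarrow>\<^sub>M borel" by (rule measurable_target_borel) simp
  have "(\<lambda>z. (fst z, snd z)) \<in> \<pi> \<Otimes>\<^sub>M \<pi> \<rightarrow>\<^sub>M borel \<Otimes>\<^sub>M (borel :: (real^'n) measure)"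
    by measurable
  from measurable_compose[OF this assms(1)] have Gm: "G \<in> borel_measurable (\<pi> \<Otimes>\<^sub>M \<pi>)"
    by simp
  have "(\<integral>z. G z \<partial>joint) = enn2real (\<integral>\<^sup>+z. ennreal (G z) \<partial>joint)"
    using Gm nn by (intro integral_eq_nn_integral) (auto simp: measurable_cong_sets[OF sets_joint refl])
  also have "(\<integral>\<^sup>+z. ennreal (G z) \<partial>joint) = (\<integral>\<^sup>+x. \<integral>\<^sup>+y. ennreal (G (x, y)) \<partial>P x \<partial>\<pi>)"
    by (rule nn_integral_joint[OF measurable_compose[OF Gm measurable_ennreal]])
  also have "\<dots> = (\<integral>\<^sup>+x. \<integral>\<^sup>+y. ennreal (flow_density x y) * ennreal (G (x, y))
      + ennreal (reject_density x y) * ennreal (G (x, x)) \<partial>lborel \<partial>lborel)"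
    using nn_integral_mh_joint[of "\<lambda>z. ennreal (G z)"] by simp
  also have "\<dots> = (\<integral>\<^sup>+x. \<integral>\<^sup>+y. ennreal (flow_density x y * G (x, y)
      + reject_density x y * G (x, x)) \<partial>lborel \<partial>lborel)"
    by (simp add: nn ennreal_mult)
  also have "\<dots> = (\<integral>\<^sup>+z. ennreal (flow_density (fst z) (snd z) * G z
      + reject_density (fst z) (snd z) * G (fst z, fst z)) \<partial>(lborel \<Otimes>\<^sub>M lborel))"
    by (subst lborel.nn_integral_fst[symmetric]) auto
  also have "enn2real \<dots> = (\<integral>z. flow_density (fst z) (snd z) * G z
      + reject_density (fst z) (snd z) * G (fst z, fst z) \<partial>(lborel \<Otimes>\<^sub>M lborel))"
    by (intro integral_eq_nn_integral[symmetric]) (auto simp: nn)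
  finally show ?thesis .
qed

text \<open>Integrating out the proposal uses the total mass 1 of \<kappa>. Since accepted and
  refused densities are both at most that of the free step, this yields dominating functions for
  them.\<close>

lemma integrable_q_\<kappa>:
  fixes w :: "real^'n \<Rightarrow> real"
  assumes [measurable]: "w \<in> borel_measurable borel" and w: "integrable lborel (\<lambda>x. q x * w x)"
  shows "integrable (lborel \<Otimes>\<^sub>M lborel) (\<lambda>z. q (fst z) * \<kappa> (fst z - snd z) * w (fst z))"
proof (rule integrableI_bounded)
  have "(\<integral>\<^sup>+z. ennreal (norm (q (fst z) * \<kappa> (fst z - snd z) * w (fst z))) \<partial>(lborel \<Otimes>\<^sub>M lborel))
     = (\<integral>\<^sup>+x. \<integral>\<^sup>+y. ennreal (norm (q x * \<kappa> (x - y) * w x)) \<partial>lborel \<partial>lborel)"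
    by (subst lborel.nn_integral_fst[symmetric]) auto
  also have "\<dots> = (\<integral>\<^sup>+x. ennreal (norm (q x * w x)) \<partial>lborel)"
  proof (intro nn_integral_cong)
    fix x :: "real^'n"
    have "(\<integral>\<^sup>+y. ennreal (norm (q x * \<kappa> (x - y) * w x)) \<partial>lborel)
        = (\<integral>\<^sup>+y. ennreal (norm (q x * w x)) * ennreal (\<kappa> (x - y)) \<partial>lborel)"
      by (intro nn_integral_cong) (simp add: ennreal_mult[symmetric] abs_mult mult_ac)
    then show "(\<integral>\<^sup>+y. ennreal (norm (q x * \<kappa> (x - y) * w x)) \<partial>lborel) = ennreal (norm (q x * w x))"
      by (simp add: nn_integral_cmult nn_integral_\<kappa>_diff)
  qed
  also have "\<dots> < \<infinity>" using w by (simp add: integrable_iff_bounded)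
  finally show "(\<integral>\<^sup>+z. ennreal (norm (q (fst z) * \<kappa> (fst z - snd z) * w (fst z))) \<partial>(lborel \<Otimes>\<^sub>M lborel)) < \<infinity>" .
qed measurable


text \<open>If the claim fails, F = |f| has a quotient (energy plus rejection penalty, over squared
  norm) below some l < c, and there is a plane wave with quotient exactly l for the free walk.
  Neither has to have mean zero, but a suitable combination does, and its energy is too small for
  \<open>E\<close>. The bound c <= 1/2 keeps 1 - l within reach of
  \<open>exists_step_cos_eq\<close>.\<close>

lemma coenergy_lower_bound:
  assumes f: "f \<in> L2_zero \<pi>" and c: "c \<le> 1 / 2"
    and E: "\<And>u. u \<in> L2_zero \<pi> \<Longrightarrow> c * (\<integral>x. (u x)\<^sup>2 \<partial>\<pi>) \<le> energy u"
  shows "c * (\<integral>x. (f x)\<^sup>2 \<partial>\<pi>) \<le> coenergy f"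
proof (rule ccontr)
  let ?LL = "lborel \<Otimes>\<^sub>M lborel :: ((real^'n) \<times> (real^'n)) measure"
  let ?c = "\<lambda>z. flow_density (fst z) (snd z)" and ?d = "\<lambda>z. reject_density (fst z) (snd z)"
    and ?qk = "\<lambda>z. q (fst z) * \<kappa> (fst z - snd z)"
  \<comment> \<open>A Borel representative of \<open>f\<close> on the whole space, equal to it off a
    null set of the target.\<close>
  define h where "h x = (if x \<in> interior \<Omega> then f x else 0)" for x
  define F where "F x = \<bar>h x\<bar>" for x
  have fm: "f \<in> borel_measurable (leb_on \<Omega>)" and f2: "f \<in> L2_fun \<pi>"
    using f by (auto simp: L2_zero_iff L2_fun_def measurable_target)
  have [measurable]: "h \<in> borel_measurable borel"
    unfolding h_def[abs_def] using fm by (rule borel_measurable_leb_on_interior)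
  have [measurable]: "F \<in> borel_measurable borel" unfolding F_def[abs_def] by measurable
  have hm: "h \<in> borel_measurable \<pi>" by (rule measurable_target_borel) measurable
  have "AE x in \<pi>. f x = h x"
  proof (rule AE_I)
    show "{x \<in> space \<pi>. f x \<noteq> h x} \<subseteq> \<Omega> - interior \<Omega>" by (auto simp: h_def)
    have sets: "\<Omega> - interior \<Omega> \<in> sets (leb_on \<Omega>)"
      by (auto simp: sets_leb_on sets_restrict_space intro!: image_eqI[of _ _ "- interior \<Omega>"])
    then have "emeasure \<pi> (\<Omega> - interior \<Omega>) = (\<integral>\<^sup>+x. ennreal (q x) * indicator (\<Omega> - interior \<Omega>) x \<partial>lborel)"
      by (subst nn_integral_target[symmetric]) auto
    also have "\<dots> = (\<integral>\<^sup>+x. 0 \<partial>(lborel :: (real^'n) measure))"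
      by (intro nn_integral_cong) (auto simp: q_def)
    finally show "emeasure \<pi> (\<Omega> - interior \<Omega>) = 0" by simp
    show "\<Omega> - interior \<Omega> \<in> sets \<pi>" using sets by simp
  qed
  then have fh: "coenergy f = coenergy h" "(\<integral>x. (f x)\<^sup>2 \<partial>\<pi>) = (\<integral>x. (h x)\<^sup>2 \<partial>\<pi>)" "integrable \<pi> (\<lambda>x. (h x)\<^sup>2)"
  proof -
    assume ae: "AE x in \<pi>. f x = h x"
    have f_m [measurable]: "f \<in> borel_measurable \<pi>" using fm by (simp add: measurable_target)
    note hm [measurable]
    have ae2: "AE x in \<pi>. (f x)\<^sup>2 = (h x)\<^sup>2" using ae by eventually_elim simp
    show "coenergy f = coenergy h" using f_m hm ae by (rule coenergy_cong_AE)
    show "(\<integral>x. (f x)\<^sup>2 \<partial>\<pi>) = (\<integral>x. (h x)\<^sup>2 \<partial>\<pi>)"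
      by (rule integral_cong_AE[OF _ _ ae2]) measurable
    show "integrable \<pi> (\<lambda>x. (h x)\<^sup>2)"
      by (rule integrable_cong_AE_imp[OF L2_fun_integrable_square[OF f2] _ ae2]) measurable
  qed
  define n2 where "n2 = (\<integral>x. q x * (h x)\<^sup>2 \<partial>lborel)"
  have n2: "(\<integral>x. (f x)\<^sup>2 \<partial>\<pi>) = n2" unfolding fh(2) n2_def by (rule integral_target) measurable
  have n2_nonneg: "0 \<le> n2" unfolding n2_def by simp
  define S where "S = coenergy h"
  have S0: "0 \<le> S" unfolding S_def by (rule coenergy_nonneg)
  assume "\<not> c * (\<integral>x. (f x)\<^sup>2 \<partial>\<pi>) \<le> coenergy f"
  then have Sc: "S < c * n2" unfolding fh(1) n2 S_def by simp
  have n2_pos: "0 < n2" using Sc S0 n2_nonneg by (cases "n2 = 0") auto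
  \<comment> \<open>The midpoint of S / n2 and c: both gaps, c - l and l n2 - S, have to be strictly
    positive in the final inequality.\<close>
  define l where "l = (S / n2 + c) / 2"
  have l: "0 < l" "l < 1 / 2" "l < c" "S < l * n2"
  proof -
    have "0 \<le> S / n2" "S / n2 < c" using Sc S0 n2_pos by (simp_all add: divide_less_eq)
    moreover have "0 < (s + c) / 2 \<and> (s + c) / 2 < 1 / 2 \<and> (s + c) / 2 < c \<and> s < (s + c) / 2"
      if "0 \<le> s" "s < c" for s
      using that c by auto
    ultimately have "0 < l \<and> l < 1 / 2 \<and> l < c \<and> S / n2 < l" unfolding l_def by blast
    then show "0 < l" "l < 1 / 2" "l < c" "S < l * n2"
      using pos_divide_less_eq[OF n2_pos, of S l] by simp_all
  qed
  obtain \<xi> where \<xi>: "step_cos \<xi> = 1 - l" using exists_step_cos_eq[of "1 - l"] l by auto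

  have iq: "integrable lborel q"
    using integrable_target[of "\<lambda>_. 1"] by simp
  have q1: "(\<integral>x. q x \<partial>lborel) = 1"
    using integral_target[of "\<lambda>_. 1"] prob_space by simp
  have iF2: "integrable lborel (\<lambda>x. q x * (F x)\<^sup>2)"
    using fh(3) by (simp add: F_def integrable_target)
  have iq_bounded: "integrable lborel (\<lambda>x. q x * g x)"
    if [measurable]: "g \<in> borel_measurable borel" and b: "\<And>x. \<bar>g x\<bar> \<le> 1" for g
    by (rule Bochner_Integration.integrable_bound[OF iq])
       (auto simp: abs_mult intro!: mult_left_le b)
  have iF_bounded: "integrable lborel (\<lambda>x. q x * (F x * g x))"
    if [measurable]: "g \<in> borel_measurable borel" and b: "\<And>x. \<bar>g x\<bar> \<le> 1" for g
  proof (rule Bochner_Integration.integrable_bound)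
    show "integrable lborel (\<lambda>x. q x + q x * (F x)\<^sup>2)" using iq iF2 by simp
    have "\<bar>q x * (F x * g x)\<bar> \<le> q x + q x * (F x)\<^sup>2" for x
    proof -
      have "\<bar>F x * g x\<bar> \<le> \<bar>F x\<bar>" using b[of x] by (simp add: abs_mult mult_left_le)
      also have "\<dots> \<le> 1 + (F x)\<^sup>2"
        using zero_le_power2[of "\<bar>F x\<bar> - 1"] zero_le_power2[of "F x"] by (simp add: power2_diff)
      finally show ?thesis
        using mult_left_mono[of "\<bar>F x * g x\<bar>" "1 + (F x)\<^sup>2" "q x"] by (simp add: abs_mult distrib_left)
    qed
    then show "AE x in lborel. norm (q x * (F x * g x)) \<le> norm (q x + q x * (F x)\<^sup>2)" by simp
  qed measurable

  \<comment> \<open>The phase is chosen so that the sine has mean zero.\<close>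
  obtain r a where polar: "(\<integral>x. q x * cos (\<xi> \<bullet> x) \<partial>lborel) = r * cos a" "(\<integral>x. q x * sin (\<xi> \<bullet> x) \<partial>lborel) = r * sin a"
    using polar_Ex by blast
  define C where "C x = cos (\<xi> \<bullet> x + (- a))" for x
  define D where "D x = sin (\<xi> \<bullet> x + (- a))" for x
  have [measurable]: "C \<in> borel_measurable borel" "D \<in> borel_measurable borel"
    unfolding C_def[abs_def] D_def[abs_def] by measurable
  have C1: "\<bar>C x\<bar> \<le> 1" and D1: "\<bar>D x\<bar> \<le> 1" for x by (auto simp: C_def D_def)
  have D0: "(\<integral>x. q x * D x \<partial>lborel) = 0"
  proof -
    have "(\<integral>x. q x * D x \<partial>lborel) = (\<integral>x. q x * sin (\<xi> \<bullet> x) * cos a - q x * cos (\<xi> \<bullet> x) * sin a \<partial>lborel)"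
      by (intro Bochner_Integration.integral_cong refl) (simp add: D_def sin_diff algebra_simps)
    also have "\<dots> = r * sin a * cos a - r * cos a * sin a"
      using iq_bounded[of "\<lambda>x. sin (\<xi> \<bullet> x)"] iq_bounded[of "\<lambda>x. cos (\<xi> \<bullet> x)"] polar by simp
    finally show ?thesis by simp
  qed
  \<comment> \<open>The squared modulus of the difference of the wave at two points; it depends on
    the step x - y alone.\<close>
  have CD: "(C x - C y)\<^sup>2 + (D x - D y)\<^sup>2 = 2 * (1 - cos (\<xi> \<bullet> (x - y)))" for x y
  proof -
    have eq: "\<xi> \<bullet> (x - y) = (\<xi> \<bullet> x + (- a)) - (\<xi> \<bullet> y + (- a))" by (simp add: inner_diff_right)
    have "cos (\<xi> \<bullet> (x - y)) = C x * C y + D x * D y"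
      unfolding eq C_def D_def by (rule cos_diff)
    moreover have "(C x)\<^sup>2 + (D x)\<^sup>2 = 1" "(C y)\<^sup>2 + (D y)\<^sup>2 = 1"
      by (simp_all add: C_def D_def)
    ultimately show ?thesis by (simp add: power2_diff)
  qed

  \<comment> \<open>\<tau> and \<open>t\<close> are the means of \<open>C\<close> and
    \<open>F\<close>; used crosswise as coefficients in \<open>w\<close> they make its mean t \<tau>
    - \<tau> t vanish. \<open>m\<close> is the correlation of \<open>F\<close> and
    \<open>C\<close>.\<close>
  define \<tau> where "\<tau> = (\<integral>x. q x * C x \<partial>lborel)"
  define t where "t = (\<integral>x. q x * F x \<partial>lborel)"
  define m where "m = (\<integral>x. q x * (F x * C x) \<partial>lborel)"
  have iF: "integrable lborel (\<lambda>x. q x * F x)" using iF_bounded[of "\<lambda>_. 1"] by simp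
  have t_pos: "0 < t"
  proof -
    have "0 \<le> t" unfolding t_def by (intro Bochner_Integration.integral_nonneg) (simp add: F_def)
    moreover have "t \<noteq> 0"
    proof
      assume "t = 0"
      then have "AE x in lborel. q x * F x = 0"
        unfolding t_def using iF by (subst (asm) integral_nonneg_eq_0_iff_AE) (auto simp: F_def)
      then have "AE x in lborel. q x * (h x)\<^sup>2 = 0"
        by eventually_elim (auto simp: F_def)
      then have "n2 = 0"
        unfolding n2_def by (intro integral_eq_zero_AE)
      then show False using n2_pos by simp
    qed
    ultimately show ?thesis by simp
  qed

  \<comment> \<open>The trial functions: the combination \<open>w\<close> of \<open>\<bar>f\<bar>\<close> and a plane wave, and a multiple \<open>v\<close> of the wave a quarter period out of phase.\<close>
  define w where "w x = \<tau> * F x - t * C x" for x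
  define v where "v x = t * D x" for x
  have [measurable]: "w \<in> borel_measurable borel" "v \<in> borel_measurable borel"
    unfolding w_def[abs_def] v_def[abs_def] by measurable
  have iC2: "integrable lborel (\<lambda>x. q x * (C x)\<^sup>2)" and iD2: "integrable lborel (\<lambda>x. q x * (D x)\<^sup>2)"
    using C1 D1 by (auto intro!: iq_bounded simp: power_le_one abs_square_le_1)
  have w2: "q x * (w x)\<^sup>2 = \<tau>\<^sup>2 * (q x * (F x)\<^sup>2) - 2 * \<tau> * t * (q x * (F x * C x)) + t\<^sup>2 * (q x * (C x)\<^sup>2)"
    and v2: "q x * (v x)\<^sup>2 = t\<^sup>2 * (q x * (D x)\<^sup>2)" for x
    by (simp_all add: w_def v_def power2_eq_square algebra_simps)
  note i4 = iF2 iF_bounded[of C, OF _ C1] iC2 iD2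
  have wL: "w \<in> L2_zero \<pi>"
  proof -
    have "integrable \<pi> (\<lambda>x. (w x)\<^sup>2)"
      by (subst integrable_target) (use i4 in \<open>simp_all add: w2\<close>)
    moreover have "(\<integral>x. w x \<partial>\<pi>) = 0"
    proof -
      have "(\<integral>x. w x \<partial>\<pi>) = (\<integral>x. \<tau> * (q x * F x) - t * (q x * C x) \<partial>lborel)"
        by (subst integral_target) (auto intro!: Bochner_Integration.integral_cong simp: w_def algebra_simps)
      also have "\<dots> = 0"
        using iF iq_bounded[of C] C1 by (simp add: \<tau>_def[symmetric] t_def[symmetric])
      finally show ?thesis .
    qed
    ultimately show ?thesis
      by (auto simp: L2_zero_iff L2_fun_def intro: measurable_target_borel)
  qed
  have vL: "v \<in> L2_zero \<pi>"
  proof -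
    have "integrable \<pi> (\<lambda>x. (v x)\<^sup>2)"
      by (subst integrable_target) (use i4 in \<open>simp_all add: v2\<close>)
    moreover have "(\<integral>x. v x \<partial>\<pi>) = 0"
    proof -
      have "(\<integral>x. v x \<partial>\<pi>) = (\<integral>x. t * (q x * D x) \<partial>lborel)"
        by (subst integral_target) (auto intro!: Bochner_Integration.integral_cong simp: v_def algebra_simps)
      then show ?thesis by (simp add: D0)
    qed
    ultimately show ?thesis
      by (auto simp: L2_zero_iff L2_fun_def intro: measurable_target_borel)
  qed
  \<comment> \<open>\<open>w\<close> and -\<open>v\<close> are the real and imaginary parts of
    \<tau> F - t exp(i(\<xi> x - a)). Only the sum of their squared norms is explicit, through C^2 +
    D^2 = 1; the same holds for the energies, through \<open>CD\<close>.\<close>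
  define norm_tot where "norm_tot = (\<integral>x. (w x)\<^sup>2 \<partial>\<pi>) + (\<integral>x. (v x)\<^sup>2 \<partial>\<pi>)"
  have norm_tot: "norm_tot = \<tau>\<^sup>2 * n2 - 2 * \<tau> * t * m + t\<^sup>2"
  proof -
    have "(\<integral>x. (w x)\<^sup>2 \<partial>\<pi>) = \<tau>\<^sup>2 * n2 - 2 * \<tau> * t * m + t\<^sup>2 * (\<integral>x. q x * (C x)\<^sup>2 \<partial>lborel)"
      by (subst integral_target) (use i4 in \<open>simp_all add: w2 n2_def m_def F_def\<close>)
    moreover have "(\<integral>x. (v x)\<^sup>2 \<partial>\<pi>) = t\<^sup>2 * (\<integral>x. q x * (D x)\<^sup>2 \<partial>lborel)"
      by (subst integral_target) (use i4 in \<open>simp_all add: v2\<close>)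
    moreover have "(\<integral>x. q x * (C x)\<^sup>2 \<partial>lborel) + (\<integral>x. q x * (D x)\<^sup>2 \<partial>lborel) = 1"
    proof -
      have "(\<integral>x. q x * (C x)\<^sup>2 \<partial>lborel) + (\<integral>x. q x * (D x)\<^sup>2 \<partial>lborel)
          = (\<integral>x. q x * (C x)\<^sup>2 + q x * (D x)\<^sup>2 \<partial>lborel)"
        using i4 by simp
      also have "\<dots> = (\<integral>x. q x \<partial>lborel)"
        by (intro Bochner_Integration.integral_cong refl)
           (simp add: C_def D_def flip: distrib_left)
      finally show ?thesis by (simp add: q1)
    qed
    then have "t\<^sup>2 * (\<integral>x. q x * (C x)\<^sup>2 \<partial>lborel) + t\<^sup>2 * (\<integral>x. q x * (D x)\<^sup>2 \<partial>lborel) = t\<^sup>2"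
      by (simp only: distrib_left[symmetric] mult_1_right)
    ultimately show ?thesis
      unfolding norm_tot_def by linarith
  qed
  have norm_nonneg: "0 \<le> norm_tot" by (simp add: norm_tot_def)

  \<comment> \<open>Integrability on pairs of current state and proposal\<close>
  have qk: "integrable ?LL ?qk"
    using integrable_q_\<kappa>[of "\<lambda>_. 1"] iq by simp
  have qkF2: "integrable ?LL (\<lambda>z. ?qk z * (F (fst z))\<^sup>2)"
    by (rule integrable_q_\<kappa>[OF _ iF2]) measurable
  have cm [measurable]: "?c \<in> borel_measurable ?LL" "?d \<in> borel_measurable ?LL" "?qk \<in> borel_measurable ?LL"
    by measurable
  have c_le: "?c z \<le> ?qk z" and d_le: "?d z \<le> ?qk z" for z
    using flow_density_le[of "fst z" "snd z"] flow_density_nonneg[of "fst z" "snd z"]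
    by (simp_all add: reject_density_def)
  have swap_int: "integrable ?LL (\<lambda>z. g (snd z, fst z))" if "integrable ?LL g" for g :: "_ \<Rightarrow> real"
    using lborel_pair.integrable_product_swap[OF that] by (simp add: split_beta')
  have swap_eq: "(\<integral>z. g (snd z, fst z) \<partial>?LL) = (\<integral>z. g z \<partial>?LL)"
    if "g \<in> borel_measurable ?LL" for g :: "_ \<Rightarrow> real"
    using lborel_pair.integral_product_swap[OF that] by (simp add: split_beta')
  have dom: "integrable ?LL g" if "g \<in> borel_measurable ?LL" "integrable ?LL b" "\<And>z. \<bar>g z\<bar> \<le> b z" for g b :: "_ \<Rightarrow> real"
  proof (rule Bochner_Integration.integrable_bound[OF that(2,1)])
    show "AE z in ?LL. norm (g z) \<le> norm (b z)"
      using that(3) by (intro AE_I2) (metis abs_ge_self order_trans real_norm_def)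
  qed
  have cF2: "integrable ?LL (\<lambda>z. ?c z * (F (fst z))\<^sup>2)"
    by (rule dom[OF _ qkF2]) (auto intro: mult_right_mono flow_density_le)
  have dF2: "integrable ?LL (\<lambda>z. ?d z * (F (fst z))\<^sup>2)"
    by (rule dom[OF _ qkF2]) (use d_le in \<open>auto intro: mult_right_mono\<close>)
  have cF2': "integrable ?LL (\<lambda>z. ?c z * (F (snd z))\<^sup>2)"
    using swap_int[OF cF2] by (simp add: flow_density_commute)

  \<comment> \<open>\<open>Y\<close> is the cross term between \<open>F\<close> and the wave over
    accepted moves; \<open>U\<close> is the same over all proposals, where the wave is an
    eigenfunction and the integral is explicit.\<close>
  define Y where "Y z = ?c z * (F (fst z) * (C (fst z) - C (snd z)))" for z
  define U where "U z = ?qk z * (F (fst z) * (C (fst z) - C (snd z)))" for z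
  let ?cos = "\<lambda>z. 1 - cos (\<xi> \<bullet> (fst z - snd z))"
  have [measurable]: "Y \<in> borel_measurable ?LL" "U \<in> borel_measurable ?LL" "?cos \<in> borel_measurable ?LL"
    unfolding Y_def[abs_def] U_def[abs_def] by measurable
  have FC: "\<bar>F (fst z) * (C (fst z) - C (snd z))\<bar> \<le> 2 * (1 + (F (fst z))\<^sup>2)" for z
  proof -
    have "\<bar>C (fst z) - C (snd z)\<bar> \<le> 2" using C1[of "fst z"] C1[of "snd z"] by linarith
    then have "\<bar>F (fst z) * (C (fst z) - C (snd z))\<bar> \<le> \<bar>F (fst z)\<bar> * 2"
      unfolding abs_mult by (intro mult_left_mono) auto
    also have "\<dots> \<le> 2 * (1 + (F (fst z))\<^sup>2)"
      using zero_le_power2[of "\<bar>F (fst z)\<bar> - 1"] zero_le_power2[of "F (fst z)"] by (simp add: power2_diff)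
    finally show ?thesis .
  qed
  have iU: "integrable ?LL U"
  proof (rule dom)
    show "integrable ?LL (\<lambda>z. 2 * (?qk z + ?qk z * (F (fst z))\<^sup>2))" using qk qkF2 by simp
    show "\<bar>U z\<bar> \<le> 2 * (?qk z + ?qk z * (F (fst z))\<^sup>2)" for z
    proof -
      have "\<bar>U z\<bar> = ?qk z * \<bar>F (fst z) * (C (fst z) - C (snd z))\<bar>"
        by (simp add: U_def abs_mult)
      also have "\<dots> \<le> ?qk z * (2 * (1 + (F (fst z))\<^sup>2))"
        by (intro mult_left_mono FC) simp
      finally show ?thesis by (simp add: algebra_simps)
    qed
  qed measurable
  have iY: "integrable ?LL Y"
  proof (rule dom)
    show "integrable ?LL (\<lambda>z. \<bar>U z\<bar>)" using iU by simp
    show "\<bar>Y z\<bar> \<le> \<bar>U z\<bar>" for z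
      using mult_right_mono[OF c_le[of z], of "\<bar>F (fst z) * (C (fst z) - C (snd z))\<bar>"]
      by (simp add: Y_def U_def abs_mult)
  qed measurable
  have iqcos: "integrable ?LL (\<lambda>z. ?qk z * ?cos z)"
  proof (rule dom)
    show "integrable ?LL (\<lambda>z. ?qk z * 2)" using qk by simp
    have "\<bar>?cos z\<bar> \<le> 2" for z
      using cos_le_one[of "\<xi> \<bullet> (fst z - snd z)"] cos_ge_minus_one[of "\<xi> \<bullet> (fst z - snd z)"] by linarith
    then show "\<bar>?qk z * ?cos z\<bar> \<le> ?qk z * 2" for z
      using mult_left_mono[of "\<bar>?cos z\<bar>" 2 "?qk z"] by (simp add: abs_mult)
  qed measurable
  have iccos: "integrable ?LL (\<lambda>z. ?c z * ?cos z)"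
    by (rule dom[OF _ iqcos]) (auto simp: abs_mult intro: mult_right_mono flow_density_le)
  have iD: "integrable ?LL (\<lambda>z. ?c z * (D (fst z) - D (snd z))\<^sup>2)"
  proof (rule dom)
    show "integrable ?LL (\<lambda>z. 2 * (?c z * ?cos z))" using iccos by simp
    show "\<bar>?c z * (D (fst z) - D (snd z))\<^sup>2\<bar> \<le> 2 * (?c z * ?cos z)" for z
    proof -
      have "(D (fst z) - D (snd z))\<^sup>2 \<le> 2 * ?cos z"
        using CD[of "fst z" "snd z"] zero_le_power2[of "C (fst z) - C (snd z)"] by linarith
      then have "?c z * (D (fst z) - D (snd z))\<^sup>2 \<le> ?c z * (2 * ?cos z)"
        by (intro mult_left_mono) simp_all
      then show ?thesis by (simp add: abs_mult algebra_simps)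
    qed
  qed measurable
  have iFF: "integrable ?LL (\<lambda>z. ?c z * (F (fst z) - F (snd z))\<^sup>2)"
  proof (rule dom)
    show "integrable ?LL (\<lambda>z. 2 * (?c z * (F (fst z))\<^sup>2 + ?c z * (F (snd z))\<^sup>2))" using cF2 cF2' by simp
    show "\<bar>?c z * (F (fst z) - F (snd z))\<^sup>2\<bar> \<le> 2 * (?c z * (F (fst z))\<^sup>2 + ?c z * (F (snd z))\<^sup>2)" for z
      using mult_left_mono[OF square_diff_le_double[of "F (fst z)" "F (snd z)"], of "?c z"]
      by (simp add: abs_mult algebra_simps)
  qed measurable

  \<comment> \<open>For the free walk C(y) averages to (1 - l) C(x), so the difference C(x) - C(y)
    averages to l C(x).\<close>
  have intU: "(\<integral>z. U z \<partial>?LL) = l * m"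
  proof -
    have "(\<integral>z. U z \<partial>?LL) = (\<integral>x. \<integral>y. U (x, y) \<partial>lborel \<partial>lborel)"
      by (rule lborel_pair.integral_fst'[OF iU, symmetric])
    also have "\<dots> = (\<integral>x. l * (q x * (F x * C x)) \<partial>lborel)"
    proof (intro Bochner_Integration.integral_cong refl)
      fix x :: "real^'n"
      have i1: "integrable lborel (\<lambda>y. \<kappa> (x - y))"
        using nn_integral_\<kappa>_diff[of x] by (intro integrableI_nonneg) auto
      have i2: "integrable lborel (\<lambda>y. \<kappa> (x - y) * C y)"
        by (rule Bochner_Integration.integrable_bound[OF i1]) (auto simp: abs_mult intro!: mult_left_le C1)
      have "(\<integral>y. \<kappa> (x - y) \<partial>lborel) = 1"
        using nn_integral_\<kappa>_diff[of x] by (subst integral_eq_nn_integral) auto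
      moreover have "(\<integral>y. \<kappa> (x - y) * C y \<partial>lborel) = (1 - l) * C x"
        unfolding C_def integral_\<kappa>_cos \<xi> ..
      moreover have "(\<integral>y. U (x, y) \<partial>lborel) = (\<integral>y. q x * F x * (C x * \<kappa> (x - y) - \<kappa> (x - y) * C y) \<partial>lborel)"
        by (intro Bochner_Integration.integral_cong refl) (simp add: U_def algebra_simps)
      moreover have "(\<integral>y. q x * F x * (C x * \<kappa> (x - y) - \<kappa> (x - y) * C y) \<partial>lborel)
          = q x * F x * (C x * (\<integral>y. \<kappa> (x - y) \<partial>lborel) - (\<integral>y. \<kappa> (x - y) * C y \<partial>lborel))"
        using i1 i2 by simp
      ultimately have "(\<integral>y. U (x, y) \<partial>lborel) = q x * F x * (C x * 1 - (1 - l) * C x)"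
        by (simp only:)
      then show "(\<integral>y. U (x, y) \<partial>lborel) = l * (q x * (F x * C x))"
        by (simp add: algebra_simps)
    qed
    finally show ?thesis by (simp add: m_def)
  qed
  have intcos: "(\<integral>z. ?qk z * ?cos z \<partial>?LL) = l"
  proof -
    have "(\<integral>z. ?qk z * ?cos z \<partial>?LL) = (\<integral>x. \<integral>y. q x * \<kappa> (x - y) * (1 - cos (\<xi> \<bullet> (x - y))) \<partial>lborel \<partial>lborel)"
      using lborel_pair.integral_fst'[OF iqcos] by simp
    also have "\<dots> = (\<integral>x. l * q x \<partial>lborel)"
    proof (intro Bochner_Integration.integral_cong refl)
      fix x :: "real^'n"
      have "(\<integral>y. q x * \<kappa> (x - y) * (1 - cos (\<xi> \<bullet> (x - y))) \<partial>lborel)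
          = q x * (\<integral>y. \<kappa> (x - y) * (1 - cos (\<xi> \<bullet> (x - y))) \<partial>lborel)"
        by (simp add: mult.assoc)
      also have "(\<integral>y. \<kappa> (x - y) * (1 - cos (\<xi> \<bullet> (x - y))) \<partial>lborel) = (\<integral>y. \<kappa> y * (1 - cos (\<xi> \<bullet> y)) \<partial>lborel)"
        by (rule lborel_integral_reflect[of "\<lambda>y. \<kappa> y * (1 - cos (\<xi> \<bullet> y))"]) measurable
      also have "\<dots> = (\<integral>y. 1 - cos (\<xi> \<bullet> y) \<partial>step_law)"
        by (rule integral_step_law[symmetric]) measurable
      also have "\<dots> = l"
      proof -
        have "integrable step_law (\<lambda>v. cos (\<xi> \<bullet> v))"
          by (auto intro!: step.integrable_const_bound[of _ 1])
        then show ?thesis using \<xi> by (simp add: step_cos_def step.prob_space)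
      qed
      finally show "(\<integral>y. q x * \<kappa> (x - y) * (1 - cos (\<xi> \<bullet> (x - y))) \<partial>lborel) = l * q x" by simp
    qed
    finally show ?thesis by (simp add: q1)
  qed

  have energy_eq_mh: "energy u = (\<integral>z. ?c z * (u (fst z) - u (snd z))\<^sup>2 \<partial>?LL) / 2"
    if [measurable]: "u \<in> borel_measurable borel" for u
    unfolding energy_def by (subst integral_joint_mh) auto
  \<comment> \<open>\<open>e\<close> is the energy of \<open>F\<close>; \<rho> below is the square
    of \<open>F\<close> weighted by the refused proposals.\<close>
  define e where "e = (\<integral>z. ?c z * (F (fst z) - F (snd z))\<^sup>2 \<partial>?LL) / 2"
  define \<rho> where "\<rho> = (\<integral>z. ?d z * (F (fst z))\<^sup>2 \<partial>?LL)"
  \<comment> \<open>Accepted pairs: passing to absolute values turns the sum h(x) + h(y) into a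
    difference without increasing it in modulus. Refused proposals contribute (2 h)^2 / 2 = 2 h^2,
    the origin of 2 \<rho>.\<close>
  have S_ge: "e + 2 * \<rho> \<le> S"
  proof -
    have ih: "integrable ?LL (\<lambda>z. ?c z * (h (fst z) + h (snd z))\<^sup>2 + ?d z * (h (fst z) + h (fst z))\<^sup>2)"
    proof (rule dom)
      show "integrable ?LL (\<lambda>z. 2 * (?c z * (F (fst z))\<^sup>2 + ?c z * (F (snd z))\<^sup>2) + 4 * (?d z * (F (fst z))\<^sup>2))"
        using cF2 cF2' dF2 by simp
      show "\<bar>?c z * (h (fst z) + h (snd z))\<^sup>2 + ?d z * (h (fst z) + h (fst z))\<^sup>2\<bar>
        \<le> 2 * (?c z * (F (fst z))\<^sup>2 + ?c z * (F (snd z))\<^sup>2) + 4 * (?d z * (F (fst z))\<^sup>2)" for z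
        using mult_left_mono[OF square_diff_le_double[of "h (fst z)" "- h (snd z)"], of "?c z"]
        by (simp add: F_def algebra_simps power_mult_distrib flip: mult_2)
    qed measurable
    have "2 * (e + 2 * \<rho>) = (\<integral>z. ?c z * (F (fst z) - F (snd z))\<^sup>2 + 4 * (?d z * (F (fst z))\<^sup>2) \<partial>?LL)"
      unfolding e_def \<rho>_def using iFF dF2 by simp
    also have "\<dots> \<le> (\<integral>z. ?c z * (h (fst z) + h (snd z))\<^sup>2 + ?d z * (h (fst z) + h (fst z))\<^sup>2 \<partial>?LL)"
    proof (rule integral_mono)
      fix z
      have "\<bar>F (fst z) - F (snd z)\<bar> \<le> \<bar>h (fst z) + h (snd z)\<bar>"
        unfolding F_def by linarith
      then have "(F (fst z) - F (snd z))\<^sup>2 \<le> (h (fst z) + h (snd z))\<^sup>2" by (simp add: abs_le_square_iff)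
      from mult_left_mono[OF this, of "?c z"]
      show "?c z * (F (fst z) - F (snd z))\<^sup>2 + 4 * (?d z * (F (fst z))\<^sup>2)
        \<le> ?c z * (h (fst z) + h (snd z))\<^sup>2 + ?d z * (h (fst z) + h (fst z))\<^sup>2"
        by (simp add: F_def power_mult_distrib flip: mult_2)
    qed (use iFF dF2 ih in auto)
    also have "\<dots> = 2 * S"
      unfolding S_def coenergy_def by (subst integral_joint_mh) auto
    finally show ?thesis by simp
  qed

  have energies: "energy w + energy v = \<tau>\<^sup>2 * e - 2 * \<tau> * t * (\<integral>z. Y z \<partial>?LL) + t\<^sup>2 * (\<integral>z. ?c z * ?cos z \<partial>?LL)"
  proof -
    \<comment> \<open>The squared difference of \<open>C\<close> is traded through \<open>CD\<close>
      for the cosine minus the squared difference of \<open>D\<close>; the energy of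
      \<open>v\<close> then cancels the latter.\<close>
    have pw: "?c z * (w (fst z) - w (snd z))\<^sup>2
        = \<tau>\<^sup>2 * (?c z * (F (fst z) - F (snd z))\<^sup>2) - 2 * \<tau> * t * (Y z + Y (snd z, fst z))
          + 2 * t\<^sup>2 * (?c z * ?cos z) - t\<^sup>2 * (?c z * (D (fst z) - D (snd z))\<^sup>2)" for z
    proof -
      have CC: "2 * ?cos z = (C (fst z) - C (snd z))\<^sup>2 + (D (fst z) - D (snd z))\<^sup>2"
        using CD[of "fst z" "snd z"] by simp
      have "2 * t\<^sup>2 * (?c z * ?cos z) = t\<^sup>2 * (?c z * ((C (fst z) - C (snd z))\<^sup>2 + (D (fst z) - D (snd z))\<^sup>2))"
        unfolding CC[symmetric] by simp
      then show ?thesis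
        by (simp add: w_def Y_def flow_density_commute[of "snd z" "fst z"] power2_eq_square algebra_simps)
    qed
    have "energy w = (\<tau>\<^sup>2 * (2 * e) - 2 * \<tau> * t * ((\<integral>z. Y z \<partial>?LL) + (\<integral>z. Y z \<partial>?LL))
        + 2 * t\<^sup>2 * (\<integral>z. ?c z * ?cos z \<partial>?LL) - t\<^sup>2 * (\<integral>z. ?c z * (D (fst z) - D (snd z))\<^sup>2 \<partial>?LL)) / 2"
      using iFF iY swap_int[OF iY] iccos iD swap_eq[of Y]
      by (simp add: energy_eq_mh pw e_def)
    moreover have "energy v = t\<^sup>2 * (\<integral>z. ?c z * (D (fst z) - D (snd z))\<^sup>2 \<partial>?LL) / 2"
    proof -
      have "?c z * (v (fst z) - v (snd z))\<^sup>2 = t\<^sup>2 * (?c z * (D (fst z) - D (snd z))\<^sup>2)" for z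
        by (simp add: v_def power2_eq_square algebra_simps)
      then show ?thesis by (subst energy_eq_mh) (measurable, simp only: integral_mult_right_zero)
    qed
    ultimately show ?thesis by (simp add: field_simps)
  qed

  \<comment> \<open>Passage from accepted moves to the free walk. With A = \<tau> F(x) and B = t
    (C(x) - C(y)), each refused proposal costs 2 A B - t^2 (1 - cos). By \<open>CD\<close> the
    subtracted term is at least B^2 / 2, and 2 A^2 - 2 A B + B^2 / 2 = (2 A - B)^2 / 2 >= 0, so the
    cost is at most 2 A^2. It integrates to 2 \<tau>^2 \<rho>, matching the rejection term in
    \<open>S_ge\<close>.\<close>
  have cross: "- 2 * \<tau> * t * (\<integral>z. Y z \<partial>?LL) + t\<^sup>2 * (\<integral>z. ?c z * ?cos z \<partial>?LL)
      \<le> - 2 * \<tau> * t * (l * m) + t\<^sup>2 * l + 2 * \<tau>\<^sup>2 * \<rho>"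
  proof -
    have "(\<integral>z. - 2 * \<tau> * t * Y z + t\<^sup>2 * (?c z * ?cos z) \<partial>?LL)
       \<le> (\<integral>z. - 2 * \<tau> * t * U z + t\<^sup>2 * (?qk z * ?cos z) + 2 * \<tau>\<^sup>2 * (?d z * (F (fst z))\<^sup>2) \<partial>?LL)"
    proof (rule integral_mono)
      fix z
      let ?A = "\<tau> * F (fst z)" and ?B = "t * (C (fst z) - C (snd z))"
      have "t\<^sup>2 * (C (fst z) - C (snd z))\<^sup>2 \<le> t\<^sup>2 * (2 * ?cos z)"
        using CD[of "fst z" "snd z"] zero_le_power2[of "D (fst z) - D (snd z)"]
        by (intro mult_left_mono) (linarith, simp)
      moreover have "0 \<le> (2 * ?A - ?B)\<^sup>2" by simp
      ultimately have "0 \<le> 2 * ?A\<^sup>2 - 2 * (?A * ?B) + t\<^sup>2 * ?cos z"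
        by (simp add: power2_eq_square algebra_simps)
      then have "0 \<le> ?d z * (2 * ?A\<^sup>2 - 2 * (?A * ?B) + t\<^sup>2 * ?cos z)" by simp
      then show "- 2 * \<tau> * t * Y z + t\<^sup>2 * (?c z * ?cos z)
         \<le> - 2 * \<tau> * t * U z + t\<^sup>2 * (?qk z * ?cos z) + 2 * \<tau>\<^sup>2 * (?d z * (F (fst z))\<^sup>2)"
        by (simp add: Y_def U_def reject_density_def power2_eq_square algebra_simps)
    qed (use iY iU iccos iqcos dF2 in auto)
    then show ?thesis
      using iY iU iccos iqcos dF2 by (simp add: intU intcos \<rho>_def)
  qed

  have "c * norm_tot \<le> energy w + energy v"
    using E[OF wL] E[OF vL] by (simp add: norm_tot_def distrib_left)
  also have "\<dots> \<le> \<tau>\<^sup>2 * e - 2 * \<tau> * t * (l * m) + t\<^sup>2 * l + 2 * \<tau>\<^sup>2 * \<rho>"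
    using energies cross by simp
  also have "\<dots> = l * norm_tot + \<tau>\<^sup>2 * (e + 2 * \<rho> - l * n2)"
    by (simp add: norm_tot algebra_simps)
  finally have main: "(c - l) * norm_tot + \<tau>\<^sup>2 * (l * n2 - (e + 2 * \<rho>)) \<le> 0"
    by (simp add: algebra_simps)
  \<comment> \<open>Two nonnegative terms add up to at most 0, so both vanish. Then \<tau> = 0
    reduces \<open>norm_tot\<close> to t^2, which is positive.\<close>
  have "0 < l * n2 - (e + 2 * \<rho>)" using S_ge l by simp
  with main l norm_nonneg have "(c - l) * norm_tot = 0" "\<tau>\<^sup>2 * (l * n2 - (e + 2 * \<rho>)) = 0"
    by (smt (verit) mult_nonneg_nonneg zero_le_power2)+
  then have "norm_tot = 0" "\<tau> = 0" using l \<open>0 < l * n2 - (e + 2 * \<rho>)\<close> by auto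
  then show False using norm_tot t_pos by simp
qed

end

theorem theorem2p2:
  fixes \<Omega> :: "(real^'n) set" and p :: "real^'n \<Rightarrow> real" and k :: "real \<Rightarrow> real"
    and m :: nat and A :: "nat \<Rightarrow> (real^'n) set"
  defines "\<pi> \<equiv> target \<Omega> p"
    and "P \<equiv> mh_kernel \<Omega> k p"
  assumes "convex \<Omega>"
    and "p \<in> borel_measurable (leb_on \<Omega>)"
    and "\<And>x. x \<in> \<Omega> \<Longrightarrow> 0 \<le> p x"
    and "prob_space \<pi>"
    and "proposal_density TYPE('n) k"
    and "\<And>i. i \<in> {1..m} \<Longrightarrow> A i \<in> sets \<pi>"
    and "disjoint_family_on A {1..m}"
    and "(\<Union>i\<in>{1..m}. A i) = \<Omega>"
    and "\<And>i. i \<in> {1..m} \<Longrightarrow> measure \<pi> (A i) > 0"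
  shows "Gap \<pi> P \<ge> 1/2
    * Gap (vector_measure m (\<lambda>i. measure \<pi> (A i))) (matrix_kernel m (P_H \<pi> P A m))
    * (MIN i\<in>{1..m}. Gap (cond_measure \<pi> (A i)) (restricted_kernel \<pi> P (A i)))"
proof -
  interpret MH: metropolis_hastings \<Omega> p k
    using assms(3-7) unfolding \<pi>_def by (rule metropolis_hastings.intro)
  interpret PK: partitioned_kernel \<pi> P A m
  proof (intro partitioned_kernel.intro partitioned_kernel_axioms.intro)
    show "reversible_kernel \<pi> P" unfolding \<pi>_def P_def by (rule MH.reversible_kernel_mh)
    show "(\<Union>i\<in>{1..m}. A i) = space \<pi>" using assms(10) by (simp add: \<pi>_def)
  qed (fact assms)+
  interpret H: reversible_kernel "vector_measure m (\<lambda>i. measure \<pi> (A i))" "matrix_kernel m (P_H \<pi> P A m)"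
    by (rule PK.reversible_kernel_P_H)
  let ?H = "Gap (vector_measure m (\<lambda>i. measure \<pi> (A i))) (matrix_kernel m (P_H \<pi> P A m))"
    and ?G = "\<lambda>i. Gap (cond_measure \<pi> (A i)) (restricted_kernel \<pi> P (A i))"
  define g where "g = (MIN i\<in>{1..m}. ?G i)"
  \<comment> \<open>A probability space is nonempty, so there is at least one block and the minimum
    is attained.\<close>
  have ne: "{1..m} \<noteq> {}"
    using assms(10) PK.not_empty by (auto simp: \<pi>_def)
  have g_le: "g \<le> ?G i" if "i \<in> {1..m}" for i
    unfolding g_def using that by (intro Min_le) auto
  have "g \<in> ?G ` {1..m}" unfolding g_def using ne by (intro Min_in) auto
  then obtain j where j: "j \<in> {1..m}" "g = ?G j" by auto
  interpret R: reversible_kernel "cond_measure \<pi> (A j)" "restricted_kernel \<pi> P (A j)"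
    using PK.A_sets[OF j(1)] PK.A_pos[OF j(1)] by (rule PK.reversible_kernel_restricted)
  have g: "0 \<le> g" "g \<le> 1" unfolding j(2) by (rule R.Gap_nonneg R.Gap_le_1)+
  \<comment> \<open>Brings half of this product into the range c <= 1/2 of
    \<open>coenergy_lower_bound\<close>.\<close>
  have "?H * g \<le> 1" using g H.Gap_nonneg H.Gap_le_1 by (intro mult_le_one)
  have E: "1/2 * ?H * g * (\<integral>x. (u x)\<^sup>2 \<partial>\<pi>) \<le> PK.energy u" if "u \<in> L2_zero \<pi>" for u
    using PK.decomposition_energy[OF that g_le g] by simp
  \<comment> \<open>Both ends with the same constant: the bound \<open>E\<close> settles the upper
    end and is at the same time the hypothesis of \<open>coenergy_lower_bound\<close> for the lower
    one.\<close>
  have "1/2 * ?H * g \<le> Gap \<pi> P"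
  proof (rule PK.le_Gap[OF E])
    fix u assume "u \<in> L2_zero \<pi>"
    then show "1/2 * ?H * g * (\<integral>x. (u x)\<^sup>2 \<partial>\<pi>) \<le> PK.coenergy u"
      using \<open>?H * g \<le> 1\<close> E unfolding \<pi>_def P_def
      by (intro MH.coenergy_lower_bound) auto
  qed (use \<open>?H * g \<le> 1\<close> in auto)
  then show ?thesis unfolding g_def .
qed

end
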